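(* For every $b>-1$, the series $Z=Z^{(b)}_{2}(t,\mathbf{q},\mathbf{p},u_1,u_2)$ specialised at $q_1=1$, $q_m=0$ for $m\geq 2$, satisfies $L^{\mathrm{bip}}_iZ=0$ for all $i\geq 1$, where $$L^{\mathrm{bip}}_i=-p_i^*+t\big(A_i(2)+e_1(u_1,u_2)A_i(1)+e_2(u_1,u_2)A_i(0)\big).$$
   Context: Fix $b>-1$. On symmetric functions written in power sums $p_\lambda=p_{\lambda_1}p_{\lambda_2}\cdots$, define the scalar product $\langle p_\lambda,p_\mu\rangle_b=\delta_{\lambda\mu}(1+b)^{\ell(\lambda)}z_\lambda$, where $\ell(\lambda)$ is the number of parts and $z_\lambda=\prod_i i^{m_i}m_i!$ with $m_i$ the number of parts equal to $i$. The Jack polynomials $P^{(b)}_\lambda$ are the unique symmetric functions with coefficients in $\mathbb{Q}(b)$ of the form $P^{(b)}_\lambda=m_\lambda+\sum_{\mu<\lambda}c_{\lambda\mu}m_\mu$ (monomial symmetric functions, dominance order) which are pairwise orthogonal for $\langle\cdot,\cdot\rangle_b$; set $j^{(b)}_\lambda=\langle P^{(b)}_\lambda,P^{(b)}_\lambda\rangle_b$. Expressing $P^{(b)}_\lambda$ as a polynomial in power sums, $P^{(b)}_\lambda(\mathbf{p})$ means power sums replaced by variables $p_1,p_2,\dotsc$, $P^{(b)}_\lambda(\mathbf{q})$ by $q_1,q_2,\dotsc$, and $P^{(b)}_\lambda(u)$ means every power sum replaced by the scalar $u$. For $k\geq1$, $$Z^{(b)}_k(t,\mathbf{q},\mathbf{p},u_1,\dotsc,u_k)=\sum_{n\geq0}t^n\sum_{\mu\vdash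 n}\frac{1}{j^{(b)}_\mu}P^{(b)}_\mu(\mathbf{q})P^{(b)}_\mu(u_1)\cdots P^{(b)}_\mu(u_k)P^{(b)}_\mu(\mathbf{p}).$$ Operators: $J^{(b)}_i=p_{-i}$ for $i<0$, $J^{(b)}_0=0$, $J^{(b)}_i=(1+b)i\frac{\partial}{\partial p_i}$ for $i>0$; $p_i^*=i\frac{\partial}{\partial p_i}$; $A_i(0)=\frac{\delta_{i,1}}{1+b}$ and $A_i(s+1)=\sum_{n\geq1}J^{(b)}_{i-n}A_n(s)+b(i-1)A_i(s)$ for $i\geq1$, $s\geq0$. $e_m$ denotes the $m$-th elementary symmetric polynomial.
   Formalization: The Jack polynomials in Z are taken in Stanley's normalisation J (coefficient of p_1^n equal to 1), with j = <J,J>, instead of the monic P = m_λ + lower terms; with the monic P the claim fails at order t^2 (e.g. b = 0, i = 1). *)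

theory Defs
  imports
    "HOL-Library.Multiset"
    "HOL-Library.Poly_Mapping"
    "HOL-Computational_Algebra.Polynomial"
    "HOL-Computational_Algebra.Formal_Power_Series"
begin

section \<open>Polynomials in arbitrarily many variables\<close>

text \<open>
  A monomial in variables \<open>'v\<close> is the multiset of its variables, so this is the monoid algebra
  over the free commutative monoid on \<open>'v\<close>, i.e. the polynomial ring; its ring structure is the
  convolution product of \<^theory>\<open>HOL-Library.Poly_Mapping\<close>.
\<close>

type_synonym 'v mpol = "'v multiset \<Rightarrow>\<^sub>0 real"

definition Const :: "real \<Rightarrow> 'v mpol" where
  "Const c = Poly_Mapping.single {#} c"

definition Var :: "'v \<Rightarrow> 'v mpol" where
  "Var v = Poly_Mapping.single {#v#} 1"

definition subst :: "('v \<Rightarrow> 'w mpol) \<Rightarrow> 'v mpol \<Rightarrow> 'w mpol" where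
  "subst g f = (\<Sum>m\<in>Poly_Mapping.keys f.
      Const (Poly_Mapping.lookup f m) * (\<Prod>v\<in>#m. g v))"

definition pdiff :: "'v \<Rightarrow> 'v mpol \<Rightarrow> 'v mpol" where
  "pdiff v f = (\<Sum>m\<in>Poly_Mapping.keys f.
      Poly_Mapping.single (m - {#v#}) (real (count m v) * Poly_Mapping.lookup f m))"

section \<open>Partitions\<close>

text \<open>A partition is the multiset of its (positive) parts.\<close>

definition is_partition :: "nat multiset \<Rightarrow> bool" where
  "is_partition \<nu> \<longleftrightarrow> 0 \<notin># \<nu>"

definition partitions :: "nat \<Rightarrow> nat multiset set" where
  "partitions n = {\<nu>. is_partition \<nu> \<and> sum_mset \<nu> = n}"

definition z_part :: "nat multiset \<Rightarrow> real" where
  "z_part \<nu> = (\<Prod>i\<in>set_mset \<nu>. real i ^ count \<nu> i * fact (count \<nu> i))"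

text \<open>The parts are listed in decreasing order; missing parts count as zero.\<close>

definition dominance_le :: "nat multiset \<Rightarrow> nat multiset \<Rightarrow> bool" where
  "dominance_le \<mu> \<nu> \<longleftrightarrow> sum_mset \<mu> = sum_mset \<nu> \<and>
     (\<forall>k. sum_list (take k (rev (sorted_list_of_multiset \<mu>)))
         \<le> sum_list (take k (rev (sorted_list_of_multiset \<nu>))))"

definition strictly_below :: "nat multiset \<Rightarrow> nat multiset set" where
  "strictly_below \<nu> = {\<mu>. is_partition \<mu> \<and> dominance_le \<mu> \<nu> \<and> \<mu> \<noteq> \<nu>}"

section \<open>Symmetric functions\<close>

text \<open>
  A symmetric function is represented by its expression as a polynomial in the power sums: the
  element \<^term>\<open>f :: nat mpol\<close> has \<^term>\<open>Poly_Mapping.lookup f \<nu>\<close> as coefficient of \<open>p\<^sub>\<nu>\<close>. As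
  monomials are multisets, \<open>p\<^sub>\<nu>\<close> is just the monomial \<open>\<nu>\<close>. Index \<open>0\<close> is not used.
\<close>

definition symfuns :: "nat mpol set" where
  "symfuns = {f. \<forall>\<nu>\<in>Poly_Mapping.keys f. is_partition \<nu>}"

text \<open>
  The underlying variables \<open>x\<^sub>0, x\<^sub>1, \<dots>\<close> enter through all truncations to \<open>x\<^sub>0, \<dots>, x\<^bsub>N-1\<^esub>\<close>
  (the ring of symmetric functions as the limit of the rings of symmetric polynomials): an
  identity of symmetric functions is one that holds in \<open>N\<close> variables for every \<open>N\<close>.
\<close>

definition in_vars :: "nat \<Rightarrow> nat mpol \<Rightarrow> nat mpol" where
  "in_vars N f = subst (\<lambda>k. \<Sum>i<N. Var i ^ k) f"

definition exponents :: "nat multiset \<Rightarrow> nat multiset" where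
  "exponents \<alpha> = image_mset (count \<alpha>) (mset_set (set_mset \<alpha>))"

definition monomial_sym :: "nat \<Rightarrow> nat multiset \<Rightarrow> nat mpol" where
  "monomial_sym N \<nu> =
     (\<Sum>\<alpha> | set_mset \<alpha> \<subseteq> {..<N} \<and> exponents \<alpha> = \<nu>. Poly_Mapping.single \<alpha> 1)"

definition p_pairing :: "real \<Rightarrow> nat multiset \<Rightarrow> nat multiset \<Rightarrow> real" where
  "p_pairing b \<nu> \<mu> = (if \<nu> = \<mu> then (1 + b) ^ size \<nu> * z_part \<nu> else 0)"

definition scalar_prod :: "real \<Rightarrow> nat mpol \<Rightarrow> nat mpol \<Rightarrow> real" where
  "scalar_prod b f g = (\<Sum>\<nu>\<in>Poly_Mapping.keys f. \<Sum>\<mu>\<in>Poly_Mapping.keys g.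
      Poly_Mapping.lookup f \<nu> * Poly_Mapping.lookup g \<mu> * p_pairing b \<nu> \<mu>)"

section \<open>Jack polynomials\<close>

text \<open>The subfield \<open>\<rat>(b)\<close> of the real numbers.\<close>

definition rat_adjoin :: "real \<Rightarrow> real set" where
  "rat_adjoin b = {poly f b / poly g b | f g.
     (\<forall>i. coeff f i \<in> \<rat>) \<and> (\<forall>i. coeff g i \<in> \<rat>) \<and> poly g b \<noteq> 0}"

definition unitriangular :: "real \<Rightarrow> nat multiset \<Rightarrow> nat mpol \<Rightarrow> bool" where
  "unitriangular b \<nu> f \<longleftrightarrow> (\<exists>c. (\<forall>\<mu>\<in>strictly_below \<nu>. c \<mu> \<in> rat_adjoin b) \<and>
     (\<forall>N. in_vars N f =
        monomial_sym N \<nu> + (\<Sum>\<mu>\<in>strictly_below \<nu>. Const (c \<mu>) * monomial_sym N \<mu>)))"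

definition jack_family :: "real \<Rightarrow> (nat multiset \<Rightarrow> nat mpol) \<Rightarrow> bool" where
  "jack_family b P \<longleftrightarrow>
     (\<forall>\<nu>. is_partition \<nu> \<longrightarrow> P \<nu> \<in> symfuns \<and> unitriangular b \<nu> (P \<nu>)) \<and>
     (\<forall>\<nu> \<mu>. is_partition \<nu> \<longrightarrow> is_partition \<mu> \<longrightarrow> \<nu> \<noteq> \<mu> \<longrightarrow> scalar_prod b (P \<nu>) (P \<mu>) = 0)"

text \<open>
  The defining conditions constrain a family only at partitions, so it is the individual value
  at a partition, not the family as a total function, that is uniquely determined.
\<close>

definition jack_P :: "real \<Rightarrow> nat multiset \<Rightarrow> nat mpol" where
  "jack_P b \<nu> = (THE f. \<exists>P. jack_family b P \<and> f = P \<nu>)"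

text \<open>
  The generating series below is not invariant under rescaling of the Jack polynomials, and the
  Virasoro constraints hold for the normalisation of Stanley, \<open>J\<^sub>\<nu>\<close>, in which the coefficient
  of \<open>m\<^bsub>(1,\<dots>,1)\<^esub>\<close> is \<open>n!\<close> for \<open>n = |\<nu>|\<close>. Among the \<open>p\<^sub>\<mu>\<close> with \<open>\<mu> \<turnstile> n\<close> only \<open>p\<^sub>1\<^sup>n\<close> contains the
  monomial \<open>x\<^sub>1 \<cdots> x\<^sub>n\<close>, with coefficient \<open>n!\<close>, so this means that \<open>p\<^sub>1\<^sup>n\<close> has coefficient \<open>1\<close>.
  With the monic \<open>P\<^sub>\<nu> = m\<^sub>\<nu> + \<dots>\<close> in place of \<open>J\<^sub>\<nu>\<close> the constraints fail already at order \<open>t\<^sup>2\<close>.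
\<close>

definition jack :: "real \<Rightarrow> nat multiset \<Rightarrow> nat mpol" where
  "jack b \<nu> =
     Const (1 / Poly_Mapping.lookup (jack_P b \<nu>) (replicate_mset (sum_mset \<nu>) 1)) * jack_P b \<nu>"

definition jack_norm :: "real \<Rightarrow> nat multiset \<Rightarrow> real" where
  "jack_norm b \<nu> = scalar_prod b (jack b \<nu>) (jack b \<nu>)"

section \<open>The generating series\<close>

text \<open>
  The variables \<open>p\<^sub>i\<close>, \<open>q\<^sub>i\<close>, \<open>u\<^sub>j\<close> are indeterminates, with indices starting at \<open>1\<close>; the
  series lives in the power series in \<open>t\<close> over the polynomials in these.
\<close>

datatype var = PV nat | QV nat | UV nat

definition Z_series :: "real \<Rightarrow> nat \<Rightarrow> var mpol fps" where
  "Z_series b k = Abs_fps (\<lambda>n. \<Sum>\<mu>\<in>partitions n.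
      Const (1 / jack_norm b \<mu>) *
      subst (\<lambda>i. Var (QV i)) (jack b \<mu>) *
      (\<Prod>j=1..k. subst (\<lambda>i. Var (UV j)) (jack b \<mu>)) *
      subst (\<lambda>i. Var (PV i)) (jack b \<mu>))"

definition fps_coeffwise :: "('a \<Rightarrow> 'b) \<Rightarrow> 'a fps \<Rightarrow> 'b fps" where
  "fps_coeffwise T F = Abs_fps (\<lambda>n. T (fps_nth F n))"

fun q_special :: "var \<Rightarrow> var mpol" where
  "q_special (PV i) = Var (PV i)"
| "q_special (QV m) = (if m = 1 then 1 else 0)"
| "q_special (UV j) = Var (UV j)"

definition specialise_q :: "var mpol fps \<Rightarrow> var mpol fps" where
  "specialise_q = fps_coeffwise (subst q_special)"

section \<open>The differential operators\<close>

definition J_op :: "real \<Rightarrow> int \<Rightarrow> var mpol \<Rightarrow> var mpol" where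
  "J_op b i f = (if i < 0 then Var (PV (nat (- i))) * f
     else if i = 0 then 0
     else Const ((1 + b) * real_of_int i) * pdiff (PV (nat i)) f)"

definition p_star :: "nat \<Rightarrow> var mpol \<Rightarrow> var mpol" where
  "p_star i f = Const (real i) * pdiff (PV i) f"

text \<open>
  The sum over \<open>n\<close> in the recursion is infinite as an operator, but it has only finitely many
  nonzero terms on each polynomial, since \<open>A\<^sub>n(s)\<close> lowers the degree (with \<open>p\<^sub>m\<close> of degree
  \<open>m\<close>) by \<open>n - 1\<close>. Hence it is a \<^const>\<open>Sum_any\<close>, and the operators act on power series in
  \<open>t\<close> coefficientwise.
\<close>

fun A_op :: "real \<Rightarrow> nat \<Rightarrow> nat \<Rightarrow> var mpol \<Rightarrow> var mpol" where
  "A_op b i 0 f = (if i = 1 then Const (1 / (1 + b)) * f else 0)"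
| "A_op b i (Suc s) f =
     Sum_any (\<lambda>n. if n \<ge> 1 then J_op b (int i - int n) (A_op b n s f) else 0) +
     Const (b * (real i - 1)) * A_op b i s f"

definition elem_sym :: "nat \<Rightarrow> nat \<Rightarrow> var mpol" where
  "elem_sym k m = (\<Sum>S | S \<subseteq> {1..k} \<and> card S = m. \<Prod>j\<in>S. Var (UV j))"

definition L_bip :: "real \<Rightarrow> nat \<Rightarrow> var mpol fps \<Rightarrow> var mpol fps" where
  "L_bip b i F =
     - fps_coeffwise (p_star i) F +
     fps_X * fps_coeffwise (\<lambda>f. A_op b i 2 f + elem_sym 2 1 * A_op b i 1 f
                                 + elem_sym 2 2 * A_op b i 0 f) F"

end

theory Submission
  imports Defs "HOL-Computational_Algebra.Polynomial_FPS"
begin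

text \<open>
  Put \<open>\<alpha> = 1 + b\<close>. The Lax operator of Nazarov and Sklyanin on \<open>\<Lambda>[w]\<close> produces commuting self-adjoint
  operators \<open>H\<^sub>k\<close> on \<open>\<Lambda>\<close> that are triangular in the dominance order, so the Jack polynomials are
  their joint eigenvectors. The generating function of the eigenvalues is a product over the
  \<open>\<alpha>\<close>-contents of the boxes and determines their multiset. Evaluating the commutator of the Lax
  operator with \<open>p\<^sub>1\<close> between Jack polynomials shows that \<open>p\<^sub>1\<close> adds one box and that the cut-and-join
  type operators \<open>F\<^sub>1\<close> and \<open>F\<^sub>2 + p\<^sub>1 H\<^sub>1\<close> multiply the matrix elements of \<open>p\<^sub>1\<close> by the content of this box
  and by its square. Consequently \<open>J\<^sub>\<kappa>(u)\<close> is the product of \<open>u + c\<close> over the contents \<open>c\<close> of \<open>\<kappa>\<close>, and the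
  specialised series satisfies a cut-and-join equation, the sum of the constraints weighted by \<open>p\<^sub>i\<close>.
  The constraint operators obey the Virasoro relations, by which this single equation implies
  each constraint, by induction on the order in \<open>t\<close>.
\<close>

section \<open>Linear maps and derivations on polynomials\<close>

text \<open>The Laplace-Beltrami operator alone cannot give orthogonality: its eigenvalue is
  proportional to the sum of the contents, and for \<alpha> = 1 the partitions (4,1,1) and (3,3)
  already share it. It does separate partitions that are comparable in dominance order. This is
  enough to construct its triangular eigenvectors by back substitution, and to see that a triangular
  operator commuting with it acts on them by scalars; the whole family H_k then separates all
  partitions. As the Jack polynomials are given by a characterisation only, existence, uniqueness
  and membership of the coefficients in Q(b) must all come out of this construction. Back
  substitution moreover yields nonnegative coefficients in the monomial basis, and this positivity
  is why the coefficient of p_1^n, by which Stanley's normalisation divides, does not vanish. The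
  Pieri coefficients enter as matrix elements of p_1 between eigenvectors, and sums over them are
  evaluated by comparing coefficients of p_1^n.\<close>

abbreviation lu where "lu \<equiv> Poly_Mapping.lookup"
abbreviation kys where "kys \<equiv> Poly_Mapping.keys"

definition mon :: "'v multiset \<Rightarrow> 'v mpol" where
  "mon \<mu> = Poly_Mapping.single \<mu> 1"

lemma lookup_mon: "lu (mon \<mu>) \<nu> = (if \<mu> = \<nu> then 1 else 0)"
  by (simp add: mon_def lookup_single when_def)

lemma keys_mon [simp]: "kys (mon \<mu>) = {\<mu>}"
  by (simp add: mon_def)

lemma mon_empty [simp]: "mon {#} = 1"
  by (simp add: mon_def flip: single_one)

lemma mon_add: "mon (\<mu> + \<nu>) = mon \<mu> * mon \<nu>"
  by (simp add: mon_def Poly_Mapping.mult_single)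

lemma Var_eq_mon: "Var v = mon {#v#}"
  by (simp add: mon_def Var_def)

lemma mon_add_mset: "mon (add_mset v \<mu>) = Var v * mon \<mu>"
  using mon_add[of "{#v#}" \<mu>] by (simp add: Var_eq_mon)

lemma mon_replicate: "mon (replicate_mset n v) = Var v ^ n"
  by (induction n) (simp_all add: mon_add_mset)

lemma Const_0 [simp]: "Const 0 = 0"
  by (simp add: Const_def)

lemma Const_1 [simp]: "Const 1 = 1"
  by (simp add: Const_def flip: single_one)

lemma Const_add: "Const (c + d) = Const c + Const d"
  by (simp add: Const_def single_add)

lemma Const_diff: "Const (c - d) = Const c - Const d"
  by (simp add: Const_def single_diff)

lemma Const_uminus: "Const (- c) = - Const c"
  by (simp add: Const_def single_uminus)

lemma Const_mult: "Const (c * d) = Const c * Const d"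
  by (simp add: Const_def Poly_Mapping.mult_single)

lemma Const_sum: "Const (sum f A) = (\<Sum>x\<in>A. Const (f x))"
  by (induction A rule: infinite_finite_induct) (simp_all add: Const_add)

lemma Const_of_nat: "Const (of_nat n) = of_nat n"
  by (induction n) (simp_all add: Const_add)

lemma Const_numeral: "Const (numeral n) = numeral n"
  using Const_of_nat[of "numeral n"] by simp

lemma lookup_Const_mult: "lu (Const c * f) \<mu> = c * lu f \<mu>"
  by (simp add: Const_def map.rep_eq when_def flip: mult_map_scale_conv_mult zero_multiset_def)

lemma lookup_Const: "lu (Const c) \<mu> = (if \<mu> = {#} then c else 0)"
  by (auto simp add: Const_def lookup_single when_def)

lemma Const_eq_iff [simp]: "Const c = Const d \<longleftrightarrow> c = d"
  by (metis lookup_Const)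

lemma Const_eq_0_iff [simp]: "Const c = 0 \<longleftrightarrow> c = 0"
  using Const_eq_iff[of c 0] by simp

lemma single_eq_Const_mon: "Poly_Mapping.single \<mu> c = Const c * mon \<mu>"
  by (simp add: Const_def mon_def Poly_Mapping.mult_single)

lemma mpol_expand:
  assumes "finite S" "kys f \<subseteq> S"
  shows "f = (\<Sum>\<mu>\<in>S. Const (lu f \<mu>) * mon \<mu>)"
proof (rule poly_mapping_eqI)
  fix \<nu>
  have "lu (\<Sum>\<mu>\<in>S. Const (lu f \<mu>) * mon \<mu>) \<nu> = (\<Sum>\<mu>\<in>S. if \<mu> = \<nu> then lu f \<mu> else 0)"
    by (auto simp: lookup_sum lookup_Const_mult lookup_mon intro!: sum.cong)
  also have "\<dots> = lu f \<nu>"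
    using assms by (auto simp: in_keys_iff)
  finally show "lu f \<nu> = lu (\<Sum>\<mu>\<in>S. Const (lu f \<mu>) * mon \<mu>) \<nu>" by simp
qed

definition lin :: "('v multiset \<Rightarrow> 'w mpol) \<Rightarrow> 'v mpol \<Rightarrow> 'w mpol" where
  "lin \<phi> f = (\<Sum>\<mu>\<in>kys f. Const (lu f \<mu>) * \<phi> \<mu>)"

lemma lin_superset:
  assumes "finite S" "kys f \<subseteq> S"
  shows "lin \<phi> f = (\<Sum>\<mu>\<in>S. Const (lu f \<mu>) * \<phi> \<mu>)"
  unfolding lin_def using assms by (intro sum.mono_neutral_left) (auto simp: in_keys_iff)

definition islin :: "('v mpol \<Rightarrow> 'w mpol) \<Rightarrow> bool" where
  "islin T \<longleftrightarrow> (\<forall>f g. T (f + g) = T f + T g) \<and> (\<forall>c f. T (Const c * f) = Const c * T f)"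

lemma islinI [intro?]:
  "(\<And>f g. T (f + g) = T f + T g) \<Longrightarrow> (\<And>c f. T (Const c * f) = Const c * T f) \<Longrightarrow> islin T"
  by (simp add: islin_def)

lemma islin_add: "islin T \<Longrightarrow> T (f + g) = T f + T g"
  and islin_Const: "islin T \<Longrightarrow> T (Const c * f) = Const c * T f"
  by (simp_all add: islin_def)

lemma islin_0: "islin T \<Longrightarrow> T 0 = 0"
  using islin_Const[of T 0 0] by simp

lemma islin_uminus: "islin T \<Longrightarrow> T (- f) = - T f"
  using islin_Const[of T "-1" f] by (simp add: Const_uminus)

lemma islin_diff: "islin T \<Longrightarrow> T (f - g) = T f - T g"
  using islin_add[of T f "- g"] by (simp add: islin_uminus)

lemma islin_sum: "islin T \<Longrightarrow> T (sum f A) = (\<Sum>x\<in>A. T (f x))"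
  by (induction A rule: infinite_finite_induct) (simp_all add: islin_0 islin_add)

lemma islin_lin: "islin (lin \<phi>)"
proof
  fix f g :: "'a mpol"
  let ?S = "kys f \<union> kys g"
  have "kys (f + g) \<subseteq> ?S" by (rule keys_add)
  then show "lin \<phi> (f + g) = lin \<phi> f + lin \<phi> g"
    by (simp add: lin_superset[of ?S] lookup_add Const_add ring_distribs sum.distrib)
next
  fix c and f :: "'a mpol"
  have "kys (Const c * f) \<subseteq> kys f" by (auto simp: in_keys_iff lookup_Const_mult)
  then show "lin \<phi> (Const c * f) = Const c * lin \<phi> f"
    by (simp add: lin_superset[of "kys f"] lookup_Const_mult Const_mult sum_distrib_left mult.assoc)
qed

lemma lin_mon [simp]: "lin \<phi> (mon \<mu>) = \<phi> \<mu>"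
  by (simp add: lin_def lookup_mon)

lemma lookup_lin: "lu (lin \<phi> f) \<nu> = (\<Sum>\<mu>\<in>kys f. lu f \<mu> * lu (\<phi> \<mu>) \<nu>)"
  by (simp add: lin_def lookup_sum lookup_Const_mult)

lemma islin_ext_on:
  assumes "islin S" "islin T" "\<And>\<mu>. \<mu> \<in> kys f \<Longrightarrow> S (mon \<mu>) = T (mon \<mu>)"
  shows "S f = T f"
proof -
  have f: "f = (\<Sum>\<mu>\<in>kys f. Const (lu f \<mu>) * mon \<mu>)" by (rule mpol_expand) simp_all
  have "S (\<Sum>\<mu>\<in>kys f. Const (lu f \<mu>) * mon \<mu>) = T (\<Sum>\<mu>\<in>kys f. Const (lu f \<mu>) * mon \<mu>)"
    by (simp add: islin_sum[OF assms(1)] islin_sum[OF assms(2)]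
      islin_Const[OF assms(1)] islin_Const[OF assms(2)] assms(3))
  then show ?thesis using f by simp
qed

lemma islin_expand:
  assumes "islin T"
  shows "T f = (\<Sum>\<mu>\<in>kys f. Const (lu f \<mu>) * T (mon \<mu>))"
  by (subst mpol_expand[of "kys f" f])
    (simp_all add: islin_sum[OF assms] islin_Const[OF assms] del: mult_cancel_left)

lemma islin_ext:
  "islin S \<Longrightarrow> islin T \<Longrightarrow> (\<And>\<mu>. S (mon \<mu>) = T (mon \<mu>)) \<Longrightarrow> S f = T f"
  by (rule islin_ext_on)

lemma islin_id [simp]: "islin (\<lambda>f. f)" by (simp add: islin_def)
lemma islin_zero [simp]: "islin (\<lambda>f. 0)" by (simp add: islin_def)

lemma islin_comp: "islin S \<Longrightarrow> islin T \<Longrightarrow> islin (\<lambda>f. S (T f))" by (simp add: islin_def)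
lemma islin_plus: "islin S \<Longrightarrow> islin T \<Longrightarrow> islin (\<lambda>f. S f + T f)"
  by (simp add: islin_def algebra_simps)
lemma islin_minus: "islin S \<Longrightarrow> islin T \<Longrightarrow> islin (\<lambda>f. S f - T f)"
  by (simp add: islin_def algebra_simps)
lemma islin_mult: "islin T \<Longrightarrow> islin (\<lambda>f. g * T f)" by (simp add: islin_def algebra_simps)
lemma islin_mult': "islin T \<Longrightarrow> islin (\<lambda>f. T f * g)" by (simp add: islin_def algebra_simps)
lemma islin_setsum: "(\<And>x. x \<in> A \<Longrightarrow> islin (T x)) \<Longrightarrow> islin (\<lambda>f. \<Sum>x\<in>A. T x f)"
  by (simp add: islin_def sum.distrib sum_distrib_left)

lemma islin_funpow:
  fixes T :: "'v mpol \<Rightarrow> 'v mpol"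
  assumes "islin T"
  shows "islin (T ^^ n)"
proof (induction n)
  case (Suc n)
  then show ?case using islin_comp[OF assms Suc] by (simp add: comp_def)
qed (simp add: id_def)

named_theorems islin_rules
lemmas [islin_rules] = islin_id islin_zero islin_lin islin_plus islin_minus islin_mult islin_mult'
  islin_setsum islin_comp[OF islin_lin] islin_funpow islin_comp[OF islin_funpow]

lemma subst_eq_lin: "subst g = lin (\<lambda>\<mu>. \<Prod>v\<in>#\<mu>. g v)"
  by (simp add: subst_def lin_def fun_eq_iff)

lemma islin_subst [islin_rules]: "islin (subst g)"
  by (simp add: subst_eq_lin islin_lin)

lemmas [islin_rules] = islin_comp[OF islin_subst]

lemmas subst_add = islin_add[OF islin_subst]
  and subst_sum = islin_sum[OF islin_subst]
  and subst_0 = islin_0[OF islin_subst]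
  and subst_Const_mult = islin_Const[OF islin_subst]

lemma subst_mon: "subst g (mon \<mu>) = (\<Prod>v\<in>#\<mu>. g v)"
  by (simp add: subst_eq_lin)

lemma subst_Var [simp]: "subst g (Var v) = g v"
  by (simp add: Var_eq_mon subst_mon)

lemma subst_1 [simp]: "subst g 1 = 1"
  using subst_mon[of g "{#}"] by simp

lemma subst_Const [simp]: "subst g (Const c) = Const c"
  using subst_Const_mult[of g c 1] by simp

lemma subst_mult: "subst g (f * h) = subst g f * subst g h"
proof -
  have "subst g (mon \<mu> * h) = subst g (mon \<mu>) * subst g h" for \<mu>
    by (rule islin_ext[of "\<lambda>h. subst g (mon \<mu> * h)" "\<lambda>h. subst g (mon \<mu>) * subst g h"],
        (intro islin_rules)+, simp add: subst_mon flip: mon_add)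
  then show ?thesis
    by - (rule islin_ext[of "\<lambda>f. subst g (f * h)" "\<lambda>f. subst g f * subst g h"],
        (intro islin_rules)+)
qed

lemma subst_power: "subst g (f ^ n) = subst g f ^ n"
  by (induction n) (simp_all add: subst_mult)

lemma subst_prod_mset: "subst g (\<Prod>x\<in>#A. f x) = (\<Prod>x\<in>#A. subst g (f x))"
  by (induction A) (simp_all add: subst_mult)

lemma subst_subst: "subst g (subst h f) = subst (\<lambda>v. subst g (h v)) f"
  by (rule islin_ext[of "\<lambda>f. subst g (subst h f)"],
      (intro islin_rules)+, simp add: subst_mon subst_prod_mset)

lemma subst_cong:
  assumes "\<And>\<mu> v. \<mu> \<in> kys f \<Longrightarrow> v \<in># \<mu> \<Longrightarrow> g v = h v"
  shows "subst g f = subst h f"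
  by (rule islin_ext_on, (intro islin_rules)+)
    (auto simp: subst_mon intro!: arg_cong[of _ _ prod_mset] image_mset_cong assms)

text \<open>The unique derivation with value \<open>g v\<close> on the variable \<open>v\<close>.
  Partial derivatives, the raising part of the Lax operator and the degree operators all have this
  form.\<close>

definition der :: "('v \<Rightarrow> 'v mpol) \<Rightarrow> 'v mpol \<Rightarrow> 'v mpol" where
  "der g = lin (\<lambda>\<mu>. \<Sum>v\<in>#\<mu>. g v * mon (\<mu> - {#v#}))"

lemma islin_der [islin_rules]: "islin (der g)"
  by (simp add: der_def islin_lin)

lemmas [islin_rules] = islin_comp[OF islin_der]

lemmas der_add = islin_add[OF islin_der]
  and der_diff = islin_diff[OF islin_der]
  and der_sum = islin_sum[OF islin_der]
  and der_0 = islin_0[OF islin_der]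
  and der_Const_mult = islin_Const[OF islin_der]

lemma der_mon: "der g (mon \<mu>) = (\<Sum>v\<in>#\<mu>. g v * mon (\<mu> - {#v#}))"
  by (simp add: der_def)

lemma der_Var [simp]: "der g (Var v) = g v"
  by (simp add: Var_eq_mon der_mon)

lemma der_1 [simp]: "der g 1 = 0"
  using der_mon[of g "{#}"] by simp

lemma der_Const [simp]: "der g (Const c) = 0"
  using der_Const_mult[of g c 1] by simp

lemma der_mon_add_mset:
  "der g (mon (add_mset w \<mu>)) = g w * mon \<mu> + Var w * der g (mon \<mu>)"
proof -
  have "(\<Sum>v\<in>#\<mu>. g v * mon (add_mset w \<mu> - {#v#})) = (\<Sum>v\<in>#\<mu>. Var w * (g v * mon (\<mu> - {#v#})))"
    by (intro arg_cong[of _ _ sum_mset] image_mset_cong)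
      (simp add: mon_add_mset mult_ac)
  then show ?thesis by (simp add: der_mon sum_mset_distrib_left)
qed

lemma der_Var_mult: "der g (Var w * f) = g w * f + Var w * der g f"
  by (rule islin_ext[of "\<lambda>f. der g (Var w * f)" "\<lambda>f. g w * f + Var w * der g f"],
      (intro islin_rules)+, simp add: der_mon_add_mset flip: mon_add_mset)

lemma der_mult: "der g (f * h) = der g f * h + f * der g h"
proof -
  have "der g (mon \<mu> * h) = der g (mon \<mu>) * h + mon \<mu> * der g h" for \<mu>
    by (induction \<mu>) (simp_all add: mon_add_mset mult.assoc der_Var_mult, simp add: algebra_simps)
  then show ?thesis
    by - (rule islin_ext[of "\<lambda>f. der g (f * h)" "\<lambda>f. der g f * h + f * der g h"],
        (intro islin_rules)+)
qed

lemma der_power: "der g (f ^ n) = of_nat n * f ^ (n - 1) * der g f"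
proof (induction n)
  case (Suc n)
  then show ?case by (cases n) (simp_all add: der_mult algebra_simps)
qed simp

lemma derivation_ext:
  assumes "islin T" "islin S" "T 1 = S 1"
    and "\<And>v f. T f = S f \<Longrightarrow> T (Var v * f) = S (Var v * f)"
  shows "T f = S f"
proof (rule islin_ext[OF assms(1,2)])
  show "T (mon \<mu>) = S (mon \<mu>)" for \<mu>
    by (induction \<mu>) (simp_all add: assms(3,4) mon_add_mset)
qed

lemma pdiff_eq_der: "pdiff v = der (\<lambda>w. if w = v then 1 else 0)"
proof
  fix f :: "'a mpol"
  have "(\<Sum>w\<in>#\<mu>. (if w = v then 1 else 0) * mon (\<mu> - {#w#}))
      = Const (real (count \<mu> v)) * mon (\<mu> - {#v#})" for \<mu>
  proof -
    have "(\<Sum>w\<in>#\<mu>. (if w = v then 1 else 0) * mon (\<mu> - {#w#})) =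
        (\<Sum>w\<in>#\<mu>. if w = v then mon (\<mu> - {#v#}) else 0)"
      by (intro arg_cong[of _ _ sum_mset] image_mset_cong) simp
    then show ?thesis by (simp add: sum_mset_delta Const_of_nat mult.commute)
  qed
  then show "pdiff v f = der (\<lambda>w. if w = v then 1 else 0) f"
    by (simp add: pdiff_def der_def lin_def single_eq_Const_mon Const_mult mult_ac)
qed

lemma islin_pdiff [islin_rules]: "islin (pdiff v)"
  by (simp add: pdiff_eq_der islin_der)

lemmas [islin_rules] = islin_comp[OF islin_pdiff]

lemma pdiff_mon: "pdiff v (mon \<mu>) = Const (real (count \<mu> v)) * mon (\<mu> - {#v#})"
  by (simp add: pdiff_def lookup_mon single_eq_Const_mon)

lemma pdiff_mult: "pdiff v (f * h) = pdiff v f * h + f * pdiff v h"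
  by (simp add: pdiff_eq_der der_mult)

lemma pdiff_Var: "pdiff v (Var w) = (if w = v then 1 else 0)"
  by (simp add: pdiff_eq_der)

lemma sum_mset_count:
  assumes "finite K" "set_mset \<mu> \<subseteq> K"
  shows "(\<Sum>v\<in>#\<mu>. h v) = (\<Sum>v\<in>K. of_nat (count \<mu> v) * (h v :: 'b :: semiring_1))"
  using assms(2)
proof (induction \<mu>)
  case (add x \<mu>)
  have "(\<Sum>v\<in>K. of_nat (count (add_mset x \<mu>) v) * h v)
      = (\<Sum>v\<in>K. (if v = x then h v else 0) + of_nat (count \<mu> v) * h v)"
    by (intro sum.cong) (auto simp: distrib_right)
  also have "\<dots> = h x + (\<Sum>v\<in>K. of_nat (count \<mu> v) * h v)"
    using add.prems assms(1) by (simp add: sum.distrib sum.delta)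
  finally show ?case using add by simp
qed simp

lemma der_expand:
  assumes "finite V" "\<And>\<mu>. \<mu> \<in> kys f \<Longrightarrow> \<forall>v\<in>#\<mu>. v \<in> V \<or> g v = 0"
  shows "der g f = (\<Sum>v\<in>V. g v * pdiff v f)"
proof (rule islin_ext_on[OF islin_der])
  fix \<mu> assume "\<mu> \<in> kys f"
  then have \<mu>: "\<forall>v\<in>#\<mu>. v \<in> V \<or> g v = 0" using assms(2) by simp
  have "der g (mon \<mu>) = (\<Sum>v\<in>V \<union> set_mset \<mu>. of_nat (count \<mu> v) * (g v * mon (\<mu> - {#v#})))"
    unfolding der_mon using assms(1) by (intro sum_mset_count) auto
  also have "\<dots> = (\<Sum>v\<in>V. of_nat (count \<mu> v) * (g v * mon (\<mu> - {#v#})))"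
    using \<mu> assms(1) by (intro sum.mono_neutral_right) auto
  also have "\<dots> = (\<Sum>v\<in>V. g v * pdiff v (mon \<mu>))"
    by (intro sum.cong refl) (simp add: pdiff_mon Const_of_nat mult_ac)
  finally show "der g (mon \<mu>) = (\<Sum>v\<in>V. g v * pdiff v (mon \<mu>))" .
qed (intro islin_rules)

lemma keys_mon_mult: "kys (mon \<nu> * f) \<subseteq> (+) \<nu> ` kys f"
  using keys_mult[of "mon \<nu>" f] by auto

lemma keys_Const_mult: "kys (Const c * f) \<subseteq> kys f"
  by (auto simp: in_keys_iff lookup_Const_mult)

lemma keys_sum_subset: "kys (sum f A) \<subseteq> (\<Union>x\<in>A. kys (f x))"
  by (induction A rule: infinite_finite_induct) (auto dest: subsetD[OF keys_add])

lemma keys_minus_subset: "kys (f - g) \<subseteq> kys f \<union> kys (g :: 'v mpol)"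
  by (auto simp: in_keys_iff lookup_minus)

lemma keys_lin: "kys (lin \<phi> f) \<subseteq> (\<Union>\<mu>\<in>kys f. kys (\<phi> \<mu>))"
  unfolding lin_def by (rule order_trans[OF keys_sum_subset]) (intro UN_mono keys_Const_mult subset_refl)

section \<open>Symmetric functions with one distinguished variable\<close>

text \<open>
  The variable \<open>w\<close> of the ring \<open>\<Lambda>[w]\<close> is represented by the index \<open>0\<close>, which power sums do not use;
  \<^const>\<open>symfuns\<close> is the subring \<open>\<Lambda>\<close>.
\<close>

lemma symfuns_mon_iff: "mon \<mu> \<in> symfuns \<longleftrightarrow> 0 \<notin># \<mu>"
  by (simp add: symfuns_def is_partition_def)

lemma symfuns_0 [simp]: "0 \<in> symfuns"
  and symfuns_1 [simp]: "1 \<in> symfuns"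
  by (simp_all add: symfuns_def is_partition_def)

lemma symfuns_add [intro]: "f \<in> symfuns \<Longrightarrow> g \<in> symfuns \<Longrightarrow> f + g \<in> symfuns"
  using keys_add[of f g] by (auto simp: symfuns_def)

lemma symfuns_diff [intro]: "f \<in> symfuns \<Longrightarrow> g \<in> symfuns \<Longrightarrow> f - g \<in> symfuns"
  using keys_minus_subset[of f g] by (auto simp: symfuns_def)

lemma symfuns_sum [intro]: "(\<And>x. x \<in> A \<Longrightarrow> f x \<in> symfuns) \<Longrightarrow> sum f A \<in> symfuns"
  by (induction A rule: infinite_finite_induct) auto

lemma symfuns_mult [intro]: "f \<in> symfuns \<Longrightarrow> g \<in> symfuns \<Longrightarrow> f * g \<in> symfuns"
  using keys_mult[of f g] by (auto simp: symfuns_def is_partition_def)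

lemma symfuns_Const [simp]: "Const c \<in> symfuns"
  by (auto simp: symfuns_def is_partition_def Const_def)

lemma symfuns_Var [simp]: "k \<noteq> 0 \<Longrightarrow> Var k \<in> symfuns"
  by (simp add: Var_eq_mon symfuns_mon_iff)

lemma symfuns_Const_mult [intro]: "f \<in> symfuns \<Longrightarrow> Const c * f \<in> symfuns"
  by auto

lemma symfuns_lin:
  assumes "islin T" "\<And>\<mu>. \<mu> \<in> kys f \<Longrightarrow> T (mon \<mu>) \<in> symfuns"
  shows "T f \<in> symfuns"
  unfolding islin_expand[OF assms(1), of f] using assms(2) by auto

text \<open>The factor in \<Lambda> of a monomial of \<Lambda>[w]; the multiplicity of 0 is the
  exponent of w.\<close>

definition nz :: "nat multiset \<Rightarrow> nat multiset" where
  "nz \<mu> = filter_mset (\<lambda>k. k \<noteq> 0) \<mu>"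

lemma nz_split: "\<mu> = replicate_mset (count \<mu> 0) 0 + nz \<mu>"
  by (rule multiset_eqI) (simp add: nz_def)

lemma nz_id: "0 \<notin># \<mu> \<Longrightarrow> nz \<mu> = \<mu>"
  by (rule multiset_eqI) (auto simp: nz_def count_eq_zero_iff)

lemma zero_notin_nz [simp]: "0 \<notin># nz \<mu>"
  by (simp add: nz_def)

lemma nz_plus_replicate: "0 \<notin># \<nu> \<Longrightarrow> nz (replicate_mset m 0 + \<nu>) = \<nu>"
  by (rule multiset_eqI) (auto simp: nz_def count_eq_zero_iff)

lemma count_plus_replicate: "0 \<notin># \<nu> \<Longrightarrow> m + count \<nu> 0 = m"
  by (simp add: count_eq_zero_iff)

lemma mon_split: "mon \<mu> = Var 0 ^ count \<mu> 0 * mon (nz \<mu>)"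
  by (metis mon_add mon_replicate nz_split)

lemma W_ext:
  assumes "islin S" "islin T"
    and "\<And>m f. f \<in> symfuns \<Longrightarrow> S (Var 0 ^ m * f) = T (Var 0 ^ m * f)"
  shows "S g = T g"
  using assms(1,2) by (rule islin_ext) (subst (1 2) mon_split, simp add: assms(3) symfuns_mon_iff)

text \<open>Operators on \<Lambda>[w] are defined on monomials through \<open>count \<mu> 0\<close>
  and \<open>nz \<mu>\<close>; this converts such a definition into a formula for
  \<open>w^m f\<close> with f in \<Lambda>.\<close>

lemma lin_w_power:
  assumes "\<And>\<nu>. 0 \<notin># \<nu> \<Longrightarrow> \<phi> (replicate_mset m 0 + \<nu>) = T (mon \<nu>)" "islin T" "f \<in> symfuns"
  shows "lin \<phi> (Var 0 ^ m * f) = T f"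
  by (rule islin_ext_on[of "\<lambda>f. lin \<phi> (Var 0 ^ m * f)"], (intro islin_rules assms(2))+)
    (use assms(1,3) in \<open>auto simp: symfuns_def is_partition_def simp flip: mon_replicate mon_add\<close>)

section \<open>The Lax operator on \<Lambda>[w]\<close>

locale jack_parameter =
  fixes a :: real
  assumes a_pos: "a > 0"
begin

text \<open>The adjoint of multiplication by p_k for the Jack scalar product, see
  \<open>ip_Var\<close>.\<close>

definition Jm :: "nat \<Rightarrow> nat mpol \<Rightarrow> nat mpol" where
  "Jm k f = Const (a * real k) * pdiff k f"

definition Jp :: "nat mpol \<Rightarrow> nat mpol" where
  "Jp = der (\<lambda>k. if k = 0 then 0 else Const (a * real k) * Var 0 ^ k)"

definition Pm :: "nat mpol \<Rightarrow> nat mpol" where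
  "Pm = lin (\<lambda>\<mu>. \<Sum>t=1..<count \<mu> 0. Var 0 ^ (count \<mu> 0 - t) * Var t * mon (nz \<mu>))"

definition th :: "nat mpol \<Rightarrow> nat mpol" where
  "th = der (\<lambda>k. if k = 0 then Var 0 else 0)"

definition pr :: "nat mpol \<Rightarrow> nat mpol" where
  "pr = lin (\<lambda>\<mu>. if count \<mu> 0 = 0 then 0 else Var (count \<mu> 0) * mon (nz \<mu>))"

text \<open>
  The Lax operator of Nazarov and Sklyanin. Its first summand multiplies by \<open>w\<^sup>k\<close> and
  differentiates in \<open>p\<^sub>k\<close>, the second sends \<open>w\<^sup>m\<close> to the sum of \<open>w\<^sup>m\<^sup>-\<^sup>t p\<^sub>t\<close> with \<open>0 < t < m\<close>, and
  \<^term>\<open>th\<close> is \<open>w \<partial>/\<partial>w\<close>. Instead of extracting a constant term, \<^term>\<open>pr\<close> sends \<open>w\<^sup>m\<close> to \<open>p\<^sub>m\<close>.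
\<close>

definition Z :: "nat mpol \<Rightarrow> nat mpol" where
  "Z f = Jp f + Pm f + Const (a - 1) * th f"

lemma islin_Jm [islin_rules]: "islin (Jm k)"
  unfolding Jm_def by (intro islin_rules)
lemma islin_Jp [islin_rules]: "islin Jp"
  unfolding Jp_def by (intro islin_rules)
lemma islin_Pm [islin_rules]: "islin Pm"
  unfolding Pm_def by (intro islin_rules)
lemma islin_th [islin_rules]: "islin th"
  unfolding th_def by (intro islin_rules)
lemma islin_pr [islin_rules]: "islin pr"
  unfolding pr_def by (intro islin_rules)

lemmas [islin_rules] = islin_comp[OF islin_Jm] islin_comp[OF islin_Jp] islin_comp[OF islin_Pm]
  islin_comp[OF islin_th] islin_comp[OF islin_pr]

lemma islin_Z [islin_rules]: "islin Z"
  unfolding Z_def by (intro islin_rules)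

lemmas [islin_rules] = islin_comp[OF islin_Z]

lemmas Z_add = islin_add[OF islin_Z]
  and Z_Const = islin_Const[OF islin_Z]
lemmas pr_add = islin_add[OF islin_pr]
  and pr_Const = islin_Const[OF islin_pr] and pr_0 = islin_0[OF islin_pr] and pr_sum = islin_sum[OF islin_pr]
lemmas Jp_add = islin_add[OF islin_Jp] and Jp_Const = islin_Const[OF islin_Jp]
lemmas th_add = islin_add[OF islin_th] and th_Const = islin_Const[OF islin_th]
  and th_sum = islin_sum[OF islin_th]

lemma Jp_w: "Jp (Var 0 * g) = Var 0 * Jp g"
  by (simp add: Jp_def der_mult)

lemma Jp_w_power: "Jp (Var 0 ^ m * g) = Var 0 ^ m * Jp g"
  by (induction m) (simp_all add: Jp_w mult.assoc)

lemma Jp_Var: "k \<noteq> 0 \<Longrightarrow> Jp (Var k * g) = Var k * Jp g + Const (a * real k) * (Var 0 ^ k * g)"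
  by (simp add: Jp_def der_mult mult_ac)

lemma th_w: "th (Var 0 * g) = Var 0 * g + Var 0 * th g"
  by (simp add: th_def der_mult)

lemma th_Var: "k \<noteq> 0 \<Longrightarrow> th (Var k * g) = Var k * th g"
  by (simp add: th_def der_mult)

lemma th_symfuns: "f \<in> symfuns \<Longrightarrow> th f = 0"
  by (rule islin_ext_on[of th "\<lambda>f. 0", OF islin_th])
    (auto simp: symfuns_def is_partition_def th_def der_mon intro!: sum_mset.neutral islin_rules)

lemma th_w_power: "f \<in> symfuns \<Longrightarrow> th (Var 0 ^ m * f) = Const (real m) * (Var 0 ^ m * f)"
  by (induction m)
    (simp_all add: th_symfuns th_w mult.assoc Const_add, simp add: algebra_simps)

lemma pr_w_power:
  assumes "f \<in> symfuns"
  shows "pr (Var 0 ^ m * f) = (if m = 0 then 0 else Var m * f)"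
proof (cases "m = 0")
  case True
  have "pr (Var 0 ^ m * f) = (\<lambda>f. 0) f"
    unfolding pr_def using assms by (intro lin_w_power) (auto simp: True count_eq_zero_iff)
  then show ?thesis using True by simp
next
  case False
  have "pr (Var 0 ^ m * f) = (\<lambda>f. Var m * f) f"
    unfolding pr_def using assms False
    by (intro lin_w_power islin_rules) (auto simp: count_plus_replicate nz_plus_replicate)
  then show ?thesis using False by simp
qed

lemma pr_symfuns: "f \<in> symfuns \<Longrightarrow> pr f = 0"
  using pr_w_power[of f 0] by simp

lemma pr_w_symfuns: "f \<in> symfuns \<Longrightarrow> pr (Var 0 * f) = Var 1 * f"
  using pr_w_power[of f 1] by simp

lemma Pm_w_power:
  assumes "f \<in> symfuns"
  shows "Pm (Var 0 ^ m * f) = (\<Sum>t=1..<m. Var 0 ^ (m - t) * (Var t * f))"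
  unfolding Pm_def
  by (subst lin_w_power[where T = "\<lambda>f. \<Sum>t=1..<m. Var 0 ^ (m - t) * (Var t * f)"])
    (auto simp: count_plus_replicate nz_plus_replicate mult.assoc assms intro!: islin_rules)

lemma Pm_symfuns: "f \<in> symfuns \<Longrightarrow> Pm f = 0"
  using Pm_w_power[of f 0] by simp

lemma pr_in_symfuns [simp]: "pr g \<in> symfuns"
proof (rule symfuns_lin[OF islin_pr])
  fix \<mu> show "pr (mon \<mu>) \<in> symfuns"
    by (subst mon_split) (auto simp: pr_w_power symfuns_mon_iff)
qed

lemma Jm_in_symfuns:
  assumes "f \<in> symfuns"
  shows "Jm k f \<in> symfuns"
proof (rule symfuns_lin[OF islin_Jm])
  fix \<mu> assume "\<mu> \<in> kys f"
  then have "0 \<notin># \<mu> - {#k#}"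
    using assms by (auto simp: symfuns_def is_partition_def dest: in_diffD)
  then show "Jm k (mon \<mu>) \<in> symfuns"
    unfolding Jm_def pdiff_mon by (intro symfuns_Const_mult) (simp add: symfuns_mon_iff)
qed

lemma pr_Var: "k \<noteq> 0 \<Longrightarrow> pr (Var k * g) = Var k * pr g"
proof (rule W_ext[of "\<lambda>g. pr (Var k * g)" "\<lambda>g. Var k * pr g"])
  fix m f assume "k \<noteq> 0" "(f :: nat mpol) \<in> symfuns"
  moreover from this have "Var k * f \<in> symfuns" by auto
  ultimately show "pr (Var k * (Var 0 ^ m * f)) = Var k * pr (Var 0 ^ m * f)"
    by (simp only: mult.left_commute[of "Var k" "Var 0 ^ m"] pr_w_power)
      (simp add: mult.left_commute)
qed (intro islin_rules)+

lemma Pm_Var: "k \<noteq> 0 \<Longrightarrow> Pm (Var k * g) = Var k * Pm g"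
proof (rule W_ext[of "\<lambda>g. Pm (Var k * g)" "\<lambda>g. Var k * Pm g"])
  fix m f assume "k \<noteq> 0" "(f :: nat mpol) \<in> symfuns"
  moreover from this have "Var k * f \<in> symfuns" by auto
  ultimately show "Pm (Var k * (Var 0 ^ m * f)) = Var k * Pm (Var 0 ^ m * f)"
    by (simp only: mult.left_commute[of "Var k" "Var 0 ^ m"] Pm_w_power sum_distrib_left)
      (simp add: mult.left_commute)
qed (intro islin_rules)+

text \<open>Raising the exponent of w from m to m + 1 admits one more summand, t = m, which is w
  p_m. This is the only source of \<open>pr\<close> in the commutator of \<open>Z\<close> with
  w.\<close>

lemma Pm_w: "Pm (Var 0 * g) = Var 0 * (Pm g + pr g)"
proof (rule W_ext[of "\<lambda>g. Pm (Var 0 * g)" "\<lambda>g. Var 0 * (Pm g + pr g)"])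
  fix m f assume f: "(f :: nat mpol) \<in> symfuns"
  have "Pm (Var 0 * (Var 0 ^ m * f)) = Pm (Var 0 ^ Suc m * f)" by (simp add: mult.assoc)
  also have "\<dots> = (\<Sum>t=1..<Suc m. Var 0 ^ (Suc m - t) * (Var t * f))"
    using f by (rule Pm_w_power)
  also have "\<dots> = Var 0 * (Pm (Var 0 ^ m * f) + pr (Var 0 ^ m * f))"
    unfolding Pm_w_power[OF f] pr_w_power[OF f]
    by (cases "m = 0") (auto simp: Suc_diff_le distrib_left sum_distrib_left mult.assoc)
  finally show "Pm (Var 0 * (Var 0 ^ m * f)) = Var 0 * (Pm (Var 0 ^ m * f) + pr (Var 0 ^ m * f))" .
qed (intro islin_rules)+

lemma Z_w: "Z (Var 0 * g) = Var 0 * (Z g + Const (a - 1) * g + pr g)"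
  by (simp add: Z_def Jp_w Pm_w th_w) (simp add: algebra_simps)

lemma Z_Var: "k \<noteq> 0 \<Longrightarrow> Z (Var k * g) = Var k * Z g + Const (a * real k) * (Var 0 ^ k * g)"
  by (simp add: Z_def Jp_Var Pm_Var th_Var) (simp add: algebra_simps)

lemma Z_symfuns: "f \<in> symfuns \<Longrightarrow> Z f = Jp f"
  by (simp add: Z_def Pm_symfuns th_symfuns)

lemma Jp_expand:
  assumes "finite K" "0 \<notin> K" "\<And>\<mu>. \<mu> \<in> kys f \<Longrightarrow> set_mset \<mu> \<subseteq> insert 0 K"
  shows "Jp f = (\<Sum>k\<in>K. Var 0 ^ k * Jm k f)"
proof (rule islin_ext_on[OF islin_Jp])
  show "islin (\<lambda>f. \<Sum>k\<in>K. Var 0 ^ k * Jm k f)" by (intro islin_rules)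
  fix \<mu> assume "\<mu> \<in> kys f"
  then have *: "set_mset \<mu> \<subseteq> insert 0 K" using assms(3) by simp
  have "Jp (mon \<mu>) = (\<Sum>v\<in>insert 0 K. of_nat (count \<mu> v) *
      ((if v = 0 then 0 else Const (a * real v) * Var 0 ^ v) * mon (\<mu> - {#v#})))"
    unfolding Jp_def der_mon using assms(1) * by (intro sum_mset_count) auto
  also have "\<dots> = (\<Sum>v\<in>K. of_nat (count \<mu> v) * (Const (a * real v) * Var 0 ^ v * mon (\<mu> - {#v#})))"
    using assms(1,2) by (simp, intro sum.cong) auto
  also have "\<dots> = (\<Sum>k\<in>K. Var 0 ^ k * Jm k (mon \<mu>))"
    by (intro sum.cong) (simp_all add: Jm_def pdiff_mon Const_of_nat mult_ac)
  finally show "Jp (mon \<mu>) = (\<Sum>k\<in>K. Var 0 ^ k * Jm k (mon \<mu>))" .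
qed

text \<open>The ideal generated by w. \<open>Z\<close> maps into it and is symmetric there, but not
  on all of \<Lambda>[w]: for f in \<Lambda> the product of \<open>Jp f\<close> with
  \<open>w^l g\<close> need not vanish, whereas \<open>Pm\<close> produces no constant term to match
  it.\<close>

definition Wp :: "nat mpol set" where
  "Wp = range ((*) (Var 0))"

lemma WpI [intro]: "Var 0 * g \<in> Wp" by (simp add: Wp_def)

lemma Wp_power: "m \<noteq> 0 \<Longrightarrow> Var 0 ^ m * g \<in> Wp"
  by (cases m) (auto simp: mult.assoc)

lemma Wp_0: "0 \<in> Wp" using WpI[of 0] by simp

lemma Wp_add: "f \<in> Wp \<Longrightarrow> g \<in> Wp \<Longrightarrow> f + g \<in> Wp"
  unfolding Wp_def by (auto simp flip: distrib_left)

lemma Wp_mult: "f \<in> Wp \<Longrightarrow> g * f \<in> Wp"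
  unfolding Wp_def by (auto simp: mult.left_commute[of g])

lemma Wp_diff: "f \<in> Wp \<Longrightarrow> g \<in> Wp \<Longrightarrow> f - g \<in> Wp"
  unfolding Wp_def by (auto simp flip: right_diff_distrib)

lemma Wp_sum: "(\<And>x. x \<in> A \<Longrightarrow> f x \<in> Wp) \<Longrightarrow> sum f A \<in> Wp"
  by (induction A rule: infinite_finite_induct) (auto simp: Wp_0 intro: Wp_add)

lemma Jp_in_Wp: "Jp f \<in> Wp"
proof -
  let ?K = "(\<Union>\<mu>\<in>kys f. set_mset \<mu>) - {0}"
  have "Jp f = (\<Sum>k\<in>?K. Var 0 ^ k * Jm k f)"
    by (rule Jp_expand) auto
  then show ?thesis by (auto intro!: Wp_sum Wp_power)
qed

lemma Pm_in_Wp: "Pm f \<in> Wp"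
  unfolding Pm_def lin_def mult.assoc by (intro Wp_sum Wp_mult Wp_power) auto

lemma th_in_Wp: "th f \<in> Wp"
proof -
  have "th (mon \<mu>) \<in> Wp" for \<mu>
    by (subst mon_split, cases "count \<mu> 0 = 0")
      (simp_all only: th_w_power symfuns_mon_iff zero_notin_nz not_False_eq_True, simp_all add: Wp_0 Wp_mult Wp_power)
  then have "(\<Sum>\<mu>\<in>kys f. Const (lu f \<mu>) * th (mon \<mu>)) \<in> Wp"
    by (intro Wp_sum Wp_mult)
  then show ?thesis
    by (simp add: th_def der_def lin_def[of _ f])
qed

lemma Z_in_Wp: "Z f \<in> Wp"
  unfolding Z_def by (intro Wp_add Wp_mult Jp_in_Wp Pm_in_Wp th_in_Wp)


section \<open>The scalar product on \<Lambda>[w] and adjoint operators\<close>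

definition nrm :: "nat multiset \<Rightarrow> real" where
  "nrm \<mu> = a ^ size (nz \<mu>) * z_part (nz \<mu>)"

text \<open>Extends the scalar product of \<Lambda> so that the powers of w are orthonormal, since
  \<open>nrm\<close> sees only the factor in \<Lambda>.\<close>

definition ip :: "nat mpol \<Rightarrow> nat mpol \<Rightarrow> real" where
  "ip f g = (\<Sum>\<mu>\<in>kys f. lu f \<mu> * lu g \<mu> * nrm \<mu>)"

end

lemma z_part_superset:
  assumes "finite S" "set_mset \<nu> \<subseteq> S"
  shows "z_part \<nu> = (\<Prod>i\<in>S. real i ^ count \<nu> i * fact (count \<nu> i))"
  unfolding z_part_def using assms
  by (intro prod.mono_neutral_left) (auto simp: not_in_iff)

lemma z_part_add_mset: "z_part (add_mset k \<nu>) = real k * real (count \<nu> k + 1) * z_part \<nu>"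
proof -
  let ?S = "insert k (set_mset \<nu>)"
  have "z_part (add_mset k \<nu>) =
    (\<Prod>i\<in>?S. (if i = k then real k * real (count \<nu> k + 1) else 1) * (real i ^ count \<nu> i * fact (count \<nu> i)))"
    by (subst z_part_superset[of ?S], simp, simp, intro prod.cong) (simp_all add: mult_ac)
  also have "\<dots> = real k * real (count \<nu> k + 1) * z_part \<nu>"
    by (subst prod.distrib) (simp add: prod.delta z_part_superset[of ?S \<nu>] subset_insertI)
  finally show ?thesis .
qed

lemma z_part_pos: "0 \<notin># \<nu> \<Longrightarrow> z_part \<nu> > 0"
  unfolding z_part_def by (intro prod_pos) (metis fact_gt_zero gr0I mult_pos_pos of_nat_0_less_iff zero_less_power)

context jack_parameter
begin

lemma nrm_pos: "nrm \<mu> > 0"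
  by (simp add: nrm_def a_pos z_part_pos)

lemma nrm_add_mset: "k \<noteq> 0 \<Longrightarrow> nrm (add_mset k \<mu>) = a * real k * real (count \<mu> k + 1) * nrm \<mu>"
  by (simp add: nrm_def nz_def z_part_add_mset)

lemma nrm_w: "nrm (replicate_mset m 0 + \<mu>) = nrm \<mu>"
proof -
  have "nz (replicate_mset m 0 + \<mu>) = nz \<mu>" by (rule multiset_eqI) (simp add: nz_def)
  then show ?thesis by (simp add: nrm_def)
qed

lemma ip_superset:
  assumes "finite S" "kys f \<subseteq> S"
  shows "ip f g = (\<Sum>\<mu>\<in>S. lu f \<mu> * lu g \<mu> * nrm \<mu>)"
  unfolding ip_def using assms by (intro sum.mono_neutral_left) (auto simp: in_keys_iff)

lemma ip_sym: "ip f g = ip g f"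
  by (simp add: ip_superset[of "kys f \<union> kys g"] mult_ac)

lemma ip_add_left: "ip (f + f') g = ip f g + ip f' g"
  by (simp add: ip_superset[of "kys f \<union> kys f'"] keys_add lookup_add distrib_right sum.distrib)

lemma ip_Const_left: "ip (Const c * f) g = c * ip f g"
  by (simp add: ip_superset[of "kys f"] keys_Const_mult lookup_Const_mult sum_distrib_left mult.assoc)

lemma ip_add_right: "ip g (f + f') = ip g f + ip g f'"
  by (simp add: ip_sym[of g] ip_add_left)

lemma ip_Const_right: "ip g (Const c * f) = c * ip g f"
  by (simp add: ip_sym[of g] ip_Const_left)

lemma ip_0_left [simp]: "ip 0 g = 0" and ip_0_right [simp]: "ip g 0 = 0"
  by (simp_all add: ip_sym[of g] ip_def)

lemma ip_diff_left: "ip (f - f') g = ip f g - ip f' g"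
  using ip_add_left[of "f - f'" f' g] by simp

lemma ip_diff_right: "ip g (f - f') = ip g f - ip g f'"
  using ip_add_right[of g "f - f'" f'] by simp

lemma ip_sum_left: "ip (sum f A) g = (\<Sum>x\<in>A. ip (f x) g)"
  by (induction A rule: infinite_finite_induct) (simp_all add: ip_add_left)

lemma ip_sum_right: "ip g (sum f A) = (\<Sum>x\<in>A. ip g (f x))"
  by (induction A rule: infinite_finite_induct) (simp_all add: ip_add_right)

lemma ip_mon: "ip (mon \<mu>) (mon \<nu>) = (if \<mu> = \<nu> then nrm \<mu> else 0)"
  by (auto simp: ip_def lookup_mon)

lemma ip_nonneg: "ip f f \<ge> 0"
  unfolding ip_def
  by (intro sum_nonneg mult_nonneg_nonneg[OF zero_le_square]) (simp add: nrm_pos less_imp_le)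

lemma ip_eq_0_imp: "ip f f = 0 \<Longrightarrow> f = 0"
proof -
  assume "ip f f = 0"
  then have "\<forall>\<mu>\<in>kys f. lu f \<mu> * lu f \<mu> * nrm \<mu> = 0"
    unfolding ip_def by (subst (asm) sum_nonneg_eq_0_iff) (simp_all add: nrm_pos less_imp_le)
  moreover have "nrm \<mu> \<noteq> 0" for \<mu> using nrm_pos[of \<mu>] by simp
  ultimately show "f = 0" by (intro poly_mapping_eqI) (auto simp: in_keys_iff)
qed

lemma ip_pos: "f \<noteq> 0 \<Longrightarrow> ip f f > 0"
  using ip_nonneg[of f] ip_eq_0_imp[of f] by linarith

lemma ip_ext:
  assumes "islin S" "islin S'" "islin T" "islin T'"
    and "\<And>\<mu> \<nu>. \<mu> \<in> kys f \<Longrightarrow> \<nu> \<in> kys g \<Longrightarrow>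
      ip (S (mon \<mu>)) (T (mon \<nu>)) = ip (S' (mon \<mu>)) (T' (mon \<nu>))"
  shows "ip (S f) (T g) = ip (S' f) (T' g)"
proof -
  have *: "ip (S f) (T g) = (\<Sum>\<mu>\<in>kys f. \<Sum>\<nu>\<in>kys g. lu f \<mu> * lu g \<nu> * ip (S (mon \<mu>)) (T (mon \<nu>)))"
    if "islin S" "islin T" for S T
  proof -
    show ?thesis unfolding islin_expand[OF that(1), of f] islin_expand[OF that(2), of g]
      by (simp add: ip_sum_left ip_sum_right ip_Const_left ip_Const_right sum_distrib_left mult.assoc mult.left_commute)
        (rule sum.swap)
  qed
  show ?thesis by (simp add: *[OF assms(1,3)] *[OF assms(2,4)] assms(5) cong: sum.cong)
qed

lemma Jm_mon: "Jm k (mon \<nu>) = Const (a * real k * real (count \<nu> k)) * mon (\<nu> - {#k#})"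
  by (simp add: Jm_def pdiff_mon Const_mult mult.assoc)

lemma ip_Var: "k \<noteq> 0 \<Longrightarrow> ip (Var k * f) g = ip f (Jm k g)"
proof (rule ip_ext[where S = "\<lambda>f. Var k * f" and S' = "\<lambda>f. f" and T = "\<lambda>f. f"])
  fix \<mu> \<nu> :: "nat multiset" assume k: "k \<noteq> 0"
  show "ip (Var k * mon \<mu>) (mon \<nu>) = ip (mon \<mu>) (Jm k (mon \<nu>))"
  proof (cases "k \<in># \<nu>")
    case True
    then obtain \<nu>' where "\<nu> = add_mset k \<nu>'" by (auto dest: multi_member_split)
    then show ?thesis using k
      by (auto simp: Jm_mon ip_Const_right ip_mon nrm_add_mset simp flip: mon_add_mset)
  next
    case False
    then have "add_mset k \<mu> \<noteq> \<nu>" by auto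
    then show ?thesis using False by (simp add: Jm_mon not_in_iff ip_mon flip: mon_add_mset)
  qed
qed (intro islin_rules)+

lemma ip_w_power:
  assumes "f \<in> symfuns" "g \<in> symfuns"
  shows "ip (Var 0 ^ m * f) (Var 0 ^ l * g) = (if m = l then ip f g else 0)"
proof -
  have "ip (Var 0 ^ m * f) (Var 0 ^ l * g) = ip (Const (if m = l then 1 else 0) * f) g"
  proof (rule ip_ext[where S = "\<lambda>f. Var 0 ^ m * f" and S' = "\<lambda>f. Const (if m = l then 1 else 0) * f"
        and T = "\<lambda>f. Var 0 ^ l * f" and T' = "\<lambda>f. f"])
    fix \<mu> \<nu> assume "\<mu> \<in> kys f" "\<nu> \<in> kys g"
    then have *: "0 \<notin># \<mu>" "0 \<notin># \<nu>" using assms by (auto simp: symfuns_def is_partition_def)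
    then have "replicate_mset m 0 + \<mu> = replicate_mset l 0 + \<nu> \<longleftrightarrow> m = l \<and> \<mu> = \<nu>"
      by (metis count_plus_replicate nz_plus_replicate count_replicate_mset count_union)
    then show "ip (Var 0 ^ m * mon \<mu>) (Var 0 ^ l * mon \<nu>) = ip (Const (if m = l then 1 else 0) * mon \<mu>) (mon \<nu>)"
      by (auto simp: ip_Const_left ip_mon nrm_w simp flip: mon_add mon_replicate)
  qed (intro islin_rules)+
  then show ?thesis by (simp add: ip_Const_left)
qed

lemma ip_w_Jp:
  assumes "g \<in> symfuns" "f \<in> symfuns"
  shows "ip (Var 0 ^ m * g) (Jp f) = (if m = 0 then 0 else ip g (Jm m f))"
proof -
  let ?K = "insert m (\<Union>\<mu>\<in>kys f. set_mset \<mu>) - {0}"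
  have "Jp f = (\<Sum>k\<in>?K. Var 0 ^ k * Jm k f)" by (rule Jp_expand) auto
  then have "ip (Var 0 ^ m * g) (Jp f) = (\<Sum>k\<in>?K. if m = k then ip g (Jm k f) else 0)"
    using assms by (simp add: ip_sum_right ip_w_power Jm_in_symfuns)
  then show ?thesis by (auto simp: sum.delta)
qed

text \<open>The product of \<open>w^m g\<close> with \<open>Jp f\<close> picks out
  \<open>Jm m f\<close>, and \<open>Jm m\<close> is adjoint to multiplication by p_m, the value that
  \<open>pr\<close> gives to \<open>w^m\<close>.\<close>

lemma pr_adjoint:
  assumes "f \<in> symfuns"
  shows "ip (pr G) f = ip G (Jp f)"
proof (rule ip_ext[where S = pr and S' = "\<lambda>f. f" and T = "\<lambda>f. f" and T' = Jp])
  fix \<mu> \<nu> assume "\<nu> \<in> kys f"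
  then have *: "mon \<nu> \<in> symfuns" using assms by (auto simp: symfuns_def is_partition_def)
  show "ip (pr (mon \<mu>)) (mon \<nu>) = ip (mon \<mu>) (Jp (mon \<nu>))"
    unfolding mon_split[of \<mu>] using *
    by (simp add: pr_w_power ip_w_Jp symfuns_mon_iff ip_Var count_eq_zero_iff)
qed (intro islin_rules)+

lemma Jp_adjoint_w_power:
  assumes "f \<in> symfuns" "g \<in> symfuns"
  shows "ip (Jp (Var 0 ^ Suc m * f)) (Var 0 ^ l * g) = ip (Var 0 ^ Suc m * f) (Pm (Var 0 ^ l * g))"
proof -
  let ?K = "insert (l - Suc m) (\<Union>\<mu>\<in>kys f. set_mset \<mu>) - {0}"
  have "Jp f = (\<Sum>k\<in>?K. Var 0 ^ k * Jm k f)" by (rule Jp_expand) auto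
  then have "ip (Jp (Var 0 ^ Suc m * f)) (Var 0 ^ l * g)
      = (\<Sum>k\<in>?K. ip (Var 0 ^ (Suc m + k) * Jm k f) (Var 0 ^ l * g))"
    by (simp add: Jp_w_power Jp_w power_add ip_sum_left sum_distrib_left mult.assoc)
  \<comment> \<open>Orthogonality of the powers of w leaves Suc m + k = l. For l at most Suc m the
    truncated difference is 0, an index that \<open>?K\<close> omits.\<close>
  also have "\<dots> = (\<Sum>k\<in>?K. if k = l - Suc m then ip (Jm k f) g else 0)"
    by (intro sum.cong refl, subst ip_w_power) (use assms in \<open>auto simp: Jm_in_symfuns\<close>)
  also have "\<dots> = (if l > Suc m then ip (Jm (l - Suc m) f) g else 0)"
    by (simp add: sum.delta')
  finally have 1: "ip (Jp (Var 0 ^ Suc m * f)) (Var 0 ^ l * g) =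
      (if l > Suc m then ip (Jm (l - Suc m) f) g else 0)" .
  have "ip (Var 0 ^ Suc m * f) (Pm (Var 0 ^ l * g))
      = (\<Sum>t=1..<l. ip (Var 0 ^ Suc m * f) (Var 0 ^ (l - t) * (Var t * g)))"
    using assms by (simp add: Pm_w_power ip_sum_right)
  also have "\<dots> = (\<Sum>t=1..<l. if t = l - Suc m then ip f (Var t * g) else 0)"
  proof (intro sum.cong)
    fix t assume "t \<in> {1..<l}"
    then have "Var t * g \<in> symfuns" "Suc m = l - t \<longleftrightarrow> t = l - Suc m" using assms by auto
    then show "ip (Var 0 ^ Suc m * f) (Var 0 ^ (l - t) * (Var t * g)) =
        (if t = l - Suc m then ip f (Var t * g) else 0)"
      using assms ip_w_power[of f "Var t * g" "Suc m" "l - t"] by simp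
  qed simp
  also have "\<dots> = (if l > Suc m then ip f (Var (l - Suc m) * g) else 0)"
    by (auto simp: sum.delta')
  finally show ?thesis using 1 by (simp add: ip_sym[of f] ip_Var) (simp add: ip_sym)
qed

lemma Jp_adjoint:
  assumes "F \<in> Wp"
  shows "ip (Jp F) G = ip F (Pm G)"
proof -
  obtain F' where F: "F = Var 0 * F'" using assms by (auto simp: Wp_def)
  have "ip (Jp (Var 0 * F')) G = ip (Var 0 * F') (Pm G)"
  proof (rule ip_ext[where S = "\<lambda>f. Jp (Var 0 * f)" and S' = "\<lambda>f. Var 0 * f" and T = "\<lambda>f. f" and T' = Pm])
    fix \<mu> \<nu>
    show "ip (Jp (Var 0 * mon \<mu>)) (mon \<nu>) = ip (Var 0 * mon \<mu>) (Pm (mon \<nu>))"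
      using Jp_adjoint_w_power[of "mon (nz \<mu>)" "mon (nz \<nu>)" "count \<mu> 0" "count \<nu> 0"]
      unfolding mon_split[of \<mu>] mon_split[of \<nu>] by (simp add: symfuns_mon_iff mult.assoc)
  qed (intro islin_rules)+
  then show ?thesis by (simp add: F)
qed

lemma th_adjoint: "ip (th F) G = ip F (th G)"
proof (rule ip_ext[where S = th and S' = "\<lambda>f. f" and T = "\<lambda>f. f" and T' = th])
  fix \<mu> \<nu>
  show "ip (th (mon \<mu>)) (mon \<nu>) = ip (mon \<mu>) (th (mon \<nu>))"
    unfolding mon_split[of \<mu>] mon_split[of \<nu>]
    by (simp add: th_w_power symfuns_mon_iff ip_Const_left ip_Const_right ip_w_power)
qed (intro islin_rules)+

lemma Z_adjoint: "F \<in> Wp \<Longrightarrow> G \<in> Wp \<Longrightarrow> ip (Z F) G = ip F (Z G)"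
  using Jp_adjoint[of F G] Jp_adjoint[of G F] th_adjoint[of F G]
  by (simp add: Z_def ip_add_left ip_add_right ip_Const_left ip_Const_right)
    (simp add: ip_sym)

lemma Z_pow_adjoint: "F \<in> Wp \<Longrightarrow> G \<in> Wp \<Longrightarrow> ip ((Z ^^ k) F) G = ip F ((Z ^^ k) G)"
proof (induction k arbitrary: F)
  case (Suc k)
  have "(Z ^^ k) G \<in> Wp" using Suc.prems by (cases k) (auto simp: Z_in_Wp)
  then have "ip (Z F) ((Z ^^ k) G) = ip F (Z ((Z ^^ k) G))" using Suc.prems by (intro Z_adjoint)
  then show ?case using Suc.IH[of "Z F"] Suc.prems by (simp add: funpow_swap1 Z_in_Wp)
qed simp

text \<open>First-return form of the Nazarov-Sklyanin operators: as \<open>Z\<close> takes values in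
  w\<Lambda>[w], this collects the paths of the full Lax operator from w^0 to w^0 that avoid w^0 in
  between.\<close>

definition H :: "nat \<Rightarrow> nat mpol \<Rightarrow> nat mpol" where
  "H k f = pr ((Z ^^ k) f)"

text \<open>The factor w inserted before projecting raises the degree by one; \<open>F 0\<close> is
  multiplication by p_1.\<close>

definition F :: "nat \<Rightarrow> nat mpol \<Rightarrow> nat mpol" where
  "F k f = pr (Var 0 * (Z ^^ k) f)"

lemma islin_H [islin_rules]: "islin (H k)"
  unfolding H_def by (intro islin_rules)

lemma islin_F [islin_rules]: "islin (F k)"
  unfolding F_def by (intro islin_rules)

lemma H_in_symfuns [simp]: "H k f \<in> symfuns" by (simp add: H_def)
lemma F_in_symfuns [simp]: "F k f \<in> symfuns" by (simp add: F_def)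

lemma H_0: "f \<in> symfuns \<Longrightarrow> H 0 f = 0"
  by (simp add: H_def pr_symfuns)

lemma F_0: "f \<in> symfuns \<Longrightarrow> F 0 f = Var 1 * f"
  by (simp add: F_def pr_w_symfuns)

text \<open>On \<Lambda> the operator \<open>Z\<close> is \<open>Jp\<close>, whose adjoint is
  \<open>pr\<close>. Hence \<open>H (Suc j)\<close> is \<open>Z ^^ j\<close> placed between an
  operator and its adjoint, and \<open>Z\<close> is symmetric on the ideal in between.\<close>

lemma H_adjoint:
  assumes "f \<in> symfuns" "g \<in> symfuns"
  shows "ip (H k f) g = ip f (H k g)"
proof (cases k)
  case 0
  then show ?thesis using assms by (simp add: H_0)
next
  case (Suc j)
  have "ip (H k f) g = ip ((Z ^^ j) (Z f)) (Z g)"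
    using assms by (simp add: H_def Suc pr_adjoint Z_symfuns[of g] funpow_swap1)
  also have "\<dots> = ip (Z f) ((Z ^^ j) (Z g))"
    by (simp add: Z_pow_adjoint Z_in_Wp)
  also have "\<dots> = ip f (H k g)"
    using assms by (simp add: H_def Suc Z_symfuns[of f] funpow_swap1 ip_sym[of "Jp f"] ip_sym[of f] pr_adjoint)
  finally show ?thesis .
qed

section \<open>The Laplace-Beltrami operator and its commutators\<close>

definition B :: "nat mpol \<Rightarrow> nat mpol" where
  "B f = H 2 f - Const (a - 1) * H 1 f"

lemma islin_B [islin_rules]: "islin B"
  unfolding B_def by (intro islin_rules)

lemma B_in_symfuns [simp]: "B f \<in> symfuns"
  unfolding B_def by (intro symfuns_diff symfuns_Const_mult H_in_symfuns)

lemma B_alt: "B f = pr (Z (Z f)) - Const (a - 1) * pr (Z f)"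
  by (simp add: B_def H_def numeral_2_eq_2)

lemma B_adjoint: "f \<in> symfuns \<Longrightarrow> g \<in> symfuns \<Longrightarrow> ip (B f) g = ip f (B g)"
  by (simp add: B_def ip_diff_left ip_diff_right ip_Const_left ip_Const_right H_adjoint)

text \<open>The bracket prescribes the terms that the extension of B to \<Lambda>[w] has to add for
  \<open>pr\<close> to intertwine it with B.\<close>

lemma B_Var:
  assumes "m \<noteq> 0" "f \<in> symfuns"
  shows "B (Var m * f) = Var m * B f + Const (a * real m) *
    (2 * pr (Var 0 ^ m * Jp f) + (\<Sum>t=1..<m. Var (m - t) * (Var t * f)) +
     Const ((a - 1) * (real m - 1)) * (Var m * f))"
proof -
  have 1: "pr (Pm (Var 0 ^ m * f)) = (\<Sum>t=1..<m. Var (m - t) * (Var t * f))"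
    using assms(2) unfolding Pm_w_power[OF assms(2)] pr_sum
    by (intro sum.cong) (auto simp: pr_w_power symfuns_mult)
  have 2: "pr (Z (Var 0 ^ m * f)) = pr (Var 0 ^ m * Jp f) + (\<Sum>t=1..<m. Var (m - t) * (Var t * f))
      + Const ((a - 1) * real m) * (Var m * f)"
    using assms by (simp add: Z_def pr_add pr_Const th_w_power Jp_w_power 1 pr_w_power Const_mult mult.assoc)
  show ?thesis
    using assms
    by (simp add: B_alt Z_Var Z_add Z_Const pr_add pr_Const pr_Var 2 Z_symfuns[OF assms(2)] pr_w_power
        right_diff_distrib)
      (simp add: algebra_simps Const_diff Const_mult Const_add)
qed

text \<open>
  An extension of the Laplace--Beltrami operator \<^term>\<open>B\<close> from \<open>\<Lambda>\<close> to \<open>\<Lambda>[w]\<close> that commutes with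
  \<^term>\<open>Z\<close>; hence \<^term>\<open>B\<close> commutes with all \<^term>\<open>H k\<close>.
\<close>

definition Dw :: "nat mpol \<Rightarrow> nat mpol" where
  "Dw f = lin (\<lambda>\<mu>. Var 0 ^ count \<mu> 0 * B (mon (nz \<mu>))) f
     + Const (2 * a) * (Jp (th f) + th (Pm f)) + Const (a * (a - 1)) * (th (th f) - th f)"

lemma islin_Dw [islin_rules]: "islin Dw"
  unfolding Dw_def by (intro islin_rules)

lemmas Dw_add = islin_add[OF islin_Dw] and Dw_Const = islin_Const[OF islin_Dw]

lemma lin_B_w_power:
  assumes "f \<in> symfuns"
  shows "lin (\<lambda>\<mu>. Var 0 ^ count \<mu> 0 * B (mon (nz \<mu>))) (Var 0 ^ m * f) = Var 0 ^ m * B f"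
  by (subst lin_w_power[where T = "\<lambda>f. Var 0 ^ m * B f"])
    (auto simp: count_plus_replicate nz_plus_replicate assms intro!: islin_rules)

lemma Dw_symfuns: "f \<in> symfuns \<Longrightarrow> Dw f = B f"
  using lin_B_w_power[of f 0] by (simp add: Dw_def th_symfuns Pm_symfuns islin_0[OF islin_Jp] islin_0[OF islin_th])

text \<open>Commuting with w reproduces \<open>Z\<close> itself; this is what makes the index grow
  in \<open>B_F\<close>.\<close>

lemma Dw_w: "Dw (Var 0 * G) = Var 0 * (Dw G + Const (2 * a) * (Z G + pr G))"
proof -
  have 1: "lin (\<lambda>\<mu>. Var 0 ^ count \<mu> 0 * B (mon (nz \<mu>))) (Var 0 * G)
      = Var 0 * lin (\<lambda>\<mu>. Var 0 ^ count \<mu> 0 * B (mon (nz \<mu>))) G" (is "?l (Var 0 * G) = _")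
  proof (rule W_ext[of "\<lambda>G. ?l (Var 0 * G)" "\<lambda>G. Var 0 * ?l G"])
    fix m f assume "(f :: nat mpol) \<in> symfuns"
    then show "?l (Var 0 * (Var 0 ^ m * f)) = Var 0 * ?l (Var 0 ^ m * f)"
      using lin_B_w_power[of f m] lin_B_w_power[of f "Suc m"] by (simp add: mult.assoc)
  qed (intro islin_rules)+
  have 2: "th (pr G) = 0" by (simp add: th_symfuns)
  show ?thesis
    unfolding Dw_def 1
    by (simp add: th_w Jp_w Pm_w th_add Jp_add 2 Z_def Const_mult Const_numeral)
      (simp add: algebra_simps Const_diff)
qed

lemma sum_reflect: "(\<Sum>t=1..<m. f (m - t) t) = (\<Sum>t=1..<m. f t (m - t))" for f :: "nat \<Rightarrow> nat \<Rightarrow> 'b :: comm_monoid_add"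
  by (rule sum.reindex_bij_witness[of _ "\<lambda>t. m - t" "\<lambda>t. m - t"]) auto

lemma pr_Dw: "pr (Dw G) = B (pr G)"
proof (rule W_ext[of "\<lambda>G. pr (Dw G)" "\<lambda>G. B (pr G)"])
  fix m f assume f: "(f :: nat mpol) \<in> symfuns"
  show "pr (Dw (Var 0 ^ m * f)) = B (pr (Var 0 ^ m * f))"
  proof (cases "m = 0")
    case True
    then show ?thesis using f by (simp add: Dw_symfuns pr_symfuns islin_0[OF islin_B])
  next
    case False
    have "th (Pm (Var 0 ^ m * f)) = (\<Sum>t=1..<m. Const (real (m - t)) * (Var 0 ^ (m - t) * (Var t * f)))"
      unfolding Pm_w_power[OF f] th_sum using f by (intro sum.cong) (auto simp: th_w_power symfuns_mult)
    then have "pr (th (Pm (Var 0 ^ m * f))) = (\<Sum>t=1..<m. pr (Const (real (m - t)) * (Var 0 ^ (m - t) * (Var t * f))))"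
      by (simp only: pr_sum)
    also have "\<dots> = (\<Sum>t=1..<m. Const (real (m - t)) * (Var (m - t) * (Var t * f)))"
      using f by (intro sum.cong) (auto simp: pr_Const pr_w_power symfuns_mult)
    finally have 1: "pr (th (Pm (Var 0 ^ m * f))) = (\<Sum>t=1..<m. Const (real (m - t)) * (Var (m - t) * (Var t * f)))" (is "_ = ?S") .
    \<comment> \<open>Averaging with the reflection of t into m - t turns the weight m - t into m /
      2.\<close>
    have "?S = (\<Sum>t=1..<m. Const (real t) * (Var t * (Var (m - t) * f)))"
      by (rule sum_reflect)
    then have "2 * ?S = (\<Sum>t=1..<m. Const (real (m - t)) * (Var (m - t) * (Var t * f)) + Const (real t) * (Var t * (Var (m - t) * f)))"
      by (simp add: sum.distrib)
    also have "\<dots> = Const (real m) * (\<Sum>t=1..<m. Var (m - t) * (Var t * f))"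
      unfolding sum_distrib_left
      by (intro sum.cong) (auto simp: of_nat_diff Const_diff algebra_simps)
    finally have 2: "Const (2 * a) * ?S = Const (a * real m) * (\<Sum>t=1..<m. Var (m - t) * (Var t * f))" (is "_ = _ * ?T")
      by (simp add: Const_mult Const_numeral mult_ac)
    have "pr (Dw (Var 0 ^ m * f)) = Var m * B f +
        (Const (2 * a) * (Const (real m) * pr (Var 0 ^ m * Jp f)) + Const (2 * a) * ?S) +
        Const (a * (a - 1)) * (Const (real m) * (Const (real m) * (Var m * f)) - Const (real m) * (Var m * f))"
      unfolding 1[symmetric] using f False
      by (simp add: Dw_def pr_add pr_Const islin_diff[OF islin_pr] lin_B_w_power
          th_w_power th_Const pr_w_power Jp_Const Jp_w_power distrib_left)
    then show ?thesis
      unfolding 2 pr_w_power[OF f] B_Var[OF False f] if_not_P[OF False]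
      by (simp add: Const_mult Const_diff Const_numeral distrib_left right_diff_distrib left_diff_distrib mult_ac)
  qed
qed (intro islin_rules islin_comp[OF islin_B])+

lemma lin_B_adjoint:
  "ip (lin (\<lambda>\<mu>. Var 0 ^ count \<mu> 0 * B (mon (nz \<mu>))) f) g =
   ip f (lin (\<lambda>\<mu>. Var 0 ^ count \<mu> 0 * B (mon (nz \<mu>))) g)"
proof (rule ip_ext[where S' = "\<lambda>f. f" and T = "\<lambda>f. f"])
  fix \<mu> \<nu>
  show "ip (lin (\<lambda>\<mu>. Var 0 ^ count \<mu> 0 * B (mon (nz \<mu>))) (mon \<mu>)) (mon \<nu>) =
     ip (mon \<mu>) (lin (\<lambda>\<mu>. Var 0 ^ count \<mu> 0 * B (mon (nz \<mu>))) (mon \<nu>))"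
    unfolding lin_mon
    by (subst (2) mon_split, subst (3) mon_split) (simp add: symfuns_mon_iff ip_w_power B_adjoint)
qed (intro islin_rules)+

lemma Dw_adjoint:
  assumes "f \<in> Wp" "g \<in> Wp"
  shows "ip (Dw f) g = ip f (Dw g)"
proof -
  have *: "ip (Jp (th f)) g = ip f (th (Pm g))" for f g
    by (simp add: Jp_adjoint th_in_Wp th_adjoint)
  have "ip (th (Pm f)) g = ip f (Jp (th g))"
    using *[of g f] by (simp add: ip_sym)
  then show ?thesis
    by (simp add: Dw_def ip_add_left ip_add_right ip_Const_left ip_Const_right ip_diff_left ip_diff_right
        lin_B_adjoint * th_adjoint)
qed

lemma Dw_in_Wp:
  assumes "G \<in> Wp" shows "Dw G \<in> Wp"
proof -
  obtain G' where "G = Var 0 * G'" using assms by (auto simp: Wp_def)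
  then show ?thesis by (simp only: Dw_w) (rule WpI)
qed

text \<open>The adjoint statement of \<open>pr_Dw\<close>. Testing against the ideal generated by w
  suffices, since the difference of the two sides lies in it and can be paired with itself.\<close>

lemma Dw_Jp:
  assumes "f \<in> symfuns"
  shows "Dw (Jp f) = Jp (B f)"
proof -
  have *: "ip (Dw (Jp f)) G = ip (Jp (B f)) G" if "G \<in> Wp" for G
  proof -
    have "ip (Dw (Jp f)) G = ip (Dw G) (Jp f)"
      using Dw_adjoint[OF Jp_in_Wp that] by (simp add: ip_sym)
    also have "\<dots> = ip (B (pr G)) f" using assms by (simp add: pr_Dw flip: pr_adjoint)
    also have "\<dots> = ip (pr G) (B f)" using assms by (simp add: B_adjoint)
    also have "\<dots> = ip (Jp (B f)) G" by (simp add: pr_adjoint ip_sym)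
    finally show ?thesis .
  qed
  have "ip (Dw (Jp f) - Jp (B f)) (Dw (Jp f) - Jp (B f)) = 0"
    by (subst ip_diff_left) (simp add: * Wp_diff Dw_in_Wp Jp_in_Wp)
  then show ?thesis using ip_eq_0_imp by fastforce
qed

text \<open>On \<Lambda> this is \<open>Dw_Jp\<close>. Multiplication by w preserves it, because the
  commutators of \<open>Z\<close> and of \<open>Dw\<close> with w involve only w, \<open>Z\<close>,
  \<open>pr\<close> and constants, and \<open>Dw\<close> commutes with \<open>pr\<close>.\<close>

lemma Dw_Z: "Dw (Z G) = Z (Dw G)"
proof (rule W_ext[of "\<lambda>G. Dw (Z G)" "\<lambda>G. Z (Dw G)"])
  fix m f assume f: "(f :: nat mpol) \<in> symfuns"
  have step: "Dw (Z (Var 0 * G)) = Z (Dw (Var 0 * G))" if "Dw (Z G) = Z (Dw G)" for G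
  proof -
    have *: "Dw (pr G) = pr (Dw G)" by (simp add: Dw_symfuns pr_Dw)
    have 1: "Dw (Z (Var 0 * G)) = Var 0 * (Z (Dw G) + Const (a - 1) * Dw G + pr (Dw G) +
        Const (2 * a) * (Z (Z G) + Const (a - 1) * Z G + Z (pr G) + (pr (Z G) + Const (a - 1) * pr G + pr (pr G))))"
      by (simp add: Z_w Dw_w Dw_add Dw_Const Z_add Z_Const pr_add pr_Const that *)
    have 2: "Z (Dw (Var 0 * G)) = Var 0 * (Z (Dw G) + Const (2 * a) * (Z (Z G) + Z (pr G))
        + Const (a - 1) * (Dw G + Const (2 * a) * (Z G + pr G))
        + (pr (Dw G) + Const (2 * a) * (pr (Z G) + pr (pr G))))"
      by (simp add: Z_w Dw_w Dw_add Dw_Const Z_add Z_Const pr_add pr_Const)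
    show ?thesis unfolding 1 2 by (simp add: algebra_simps)
  qed
  show "Dw (Z (Var 0 ^ m * f)) = Z (Dw (Var 0 ^ m * f))"
    by (induction m) (simp_all add: f Z_symfuns Dw_symfuns Dw_Jp mult.assoc step)
qed (intro islin_rules islin_comp[OF islin_Dw])+

lemma Dw_Z_pow: "Dw ((Z ^^ k) G) = (Z ^^ k) (Dw G)"
  by (induction k) (simp_all add: Dw_Z)

lemma B_H: "f \<in> symfuns \<Longrightarrow> B (H k f) = H k (B f)"
  by (simp add: H_def Dw_Z_pow Dw_symfuns flip: pr_Dw)

text \<open>Between eigenvectors of B the left side minus the first term is a multiple of
  \<open>F k\<close>, so this relation determines all matrix elements of \<open>F (Suc k)\<close>
  from those of \<open>F k\<close>.\<close>

lemma B_F: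
  assumes "f \<in> symfuns"
  shows "B (F k f) = F k (B f) + Const (2 * a) * (F (Suc k) f + Var 1 * H k f)"
proof -
  have "B (F k f) = pr (Dw (Var 0 * (Z ^^ k) f))" by (simp add: F_def pr_Dw)
  also have "\<dots> = F k (B f) + Const (2 * a) * (F (Suc k) f + pr (Var 0 * H k f))"
    using assms by (simp add: Dw_w Dw_Z_pow Dw_symfuns F_def H_def pr_add pr_Const distrib_left mult.left_commute[of "Var 0"])
  also have "pr (Var 0 * H k f) = Var 1 * H k f" by (simp add: pr_w_symfuns)
  finally show ?thesis .
qed

lemma Z_pow_w: "(Z ^^ Suc j) (Var 0 * G) =
    (Z ^^ j) (Var 0 * Z G) + Const (a - 1) * (Z ^^ j) (Var 0 * G) + (Z ^^ j) (Var 0 * pr G)"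
proof -
  note l = islin_funpow[OF islin_Z, of j]
  have "(Z ^^ Suc j) (Var 0 * G) = (Z ^^ j) (Z (Var 0 * G))" by (simp add: funpow_swap1)
  then show ?thesis
    by (simp add: Z_w distrib_left mult.left_commute[of "Var 0"] islin_add[OF l] islin_Const[OF l])
qed

text \<open>p_1 is moved through the k factors one at a time, each crossing leaving behind a
  w.\<close>

lemma Z_pow_p1:
  "(Z ^^ k) (Var 1 * f) = Var 1 * (Z ^^ k) f + Const a * (\<Sum>j<k. (Z ^^ j) (Var 0 * (Z ^^ (k - 1 - j)) f))"
proof (induction k)
  case (Suc k)
  have 1: "(\<Sum>j<Suc k. (Z ^^ j) (Var 0 * (Z ^^ (Suc k - 1 - j)) f)) =
      Var 0 * (Z ^^ k) f + (\<Sum>j<k. Z ((Z ^^ j) (Var 0 * (Z ^^ (k - 1 - j)) f)))"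
    unfolding sum.lessThan_Suc_shift by simp
  have 2: "Z (Var 1 * g) = Var 1 * Z g + Const a * (Var 0 * g)" for g
    using Z_Var[of 1 g] by simp
  show ?case
    unfolding 1 by (simp only: funpow.simps comp_apply Suc Z_add Z_Const 2 islin_sum[OF islin_Z] distrib_left add.assoc)
qed simp

end

section \<open>Expansion in monomial symmetric functions\<close>

lemma sum_mset_exponents: "(\<Sum>x\<in>#exponents \<alpha>. g x) = (\<Sum>i\<in>set_mset \<alpha>. g (count \<alpha> i))"
  by (simp add: exponents_def sum_unfold_sum_mset image_mset.compositionality comp_def)

lemma zero_notin_exponents [simp]: "0 \<notin># exponents \<alpha>"
  by (auto simp: exponents_def count_eq_zero_iff)

lemma sum_exponents: "sum_mset (exponents \<alpha>) = size \<alpha>"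
  using sum_mset_exponents[of "\<lambda>x. x" \<alpha>] by (simp add: size_multiset_overloaded_eq)

lemma exponents_split:
  "exponents \<alpha> = (if i \<in># \<alpha> then {#count \<alpha> i#} else {#}) + exponents (filter_mset (\<lambda>j. j \<noteq> i) \<alpha>)"
proof -
  let ?\<beta> = "filter_mset (\<lambda>j. j \<noteq> i) \<alpha>"
  have "exponents ?\<beta> = image_mset (count \<alpha>) (mset_set (set_mset ?\<beta>))"
    unfolding exponents_def by (intro image_mset_cong) auto
  moreover have "set_mset \<alpha> = (if i \<in># \<alpha> then insert i (set_mset ?\<beta>) else set_mset ?\<beta>)"
    by auto
  then have "mset_set (set_mset \<alpha>) = (if i \<in># \<alpha> then {#i#} else {#}) + mset_set (set_mset ?\<beta>)"
    by (smt (verit, best) add.left_neutral add_mset_add_single finite_set_mset mem_Collect_eq mset_set.insert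
        set_mset_filter union_commute)
  ultimately show ?thesis by (simp add: exponents_def)
qed

definition lower_part :: "nat multiset \<Rightarrow> nat \<Rightarrow> nat \<Rightarrow> nat multiset" where
  "lower_part \<mu> k x = \<mu> - {#x#} + (if k < x then {#x - k#} else {#})"

lemma exponents_diff_replicate:
  assumes "k \<noteq> 0" "k \<le> count \<alpha> i"
  shows "exponents (\<alpha> - replicate_mset k i) = lower_part (exponents \<alpha>) k (count \<alpha> i)"
proof -
  let ?\<beta> = "\<alpha> - replicate_mset k i"
  have f: "filter_mset (\<lambda>j. j \<noteq> i) ?\<beta> = filter_mset (\<lambda>j. j \<noteq> i) \<alpha>"
    by (rule multiset_eqI) auto
  have i: "i \<in># \<alpha>" "i \<in># ?\<beta> \<longleftrightarrow> k < count \<alpha> i"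
    using assms by (auto simp: not_in_iff[symmetric] simp flip: count_greater_zero_iff)
  show ?thesis
    by (subst exponents_split[of ?\<beta> i], subst exponents_split[of \<alpha> i])
      (use i in \<open>auto simp: f[simplified] lower_part_def\<close>)
qed

lemma exponents_add_replicate:
  assumes "k \<noteq> 0" "i \<notin># \<alpha>"
  shows "exponents (replicate_mset k i + \<alpha>) = add_mset k (exponents \<alpha>)"
proof -
  have "filter_mset (\<lambda>j. j \<noteq> i) (replicate_mset k i + \<alpha>) = \<alpha>"
    using assms by (intro multiset_eqI) (auto simp: not_in_iff)
  then show ?thesis
    by (subst exponents_split[of _ i]) (use assms in \<open>auto simp: not_in_iff\<close>)
qed

lemma lookup_mon_mult: "lu (mon \<beta> * g) \<alpha> = (if \<beta> \<subseteq># \<alpha> then lu g (\<alpha> - \<beta>) else 0)"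
proof -
  have "mon \<beta> * g = (\<Sum>\<mu>\<in>kys g. Const (lu g \<mu>) * mon (\<beta> + \<mu>))"
    by (subst mpol_expand[of "kys g" g]) (simp_all add: sum_distrib_left mon_add mult_ac)
  then have "lu (mon \<beta> * g) \<alpha> = (\<Sum>\<mu>\<in>kys g. if \<beta> + \<mu> = \<alpha> then lu g \<mu> else 0)"
    by (auto simp: lookup_sum lookup_Const_mult lookup_mon intro!: sum.cong)
  also have "\<dots> = (\<Sum>\<mu>\<in>kys g. if \<mu> = \<alpha> - \<beta> then (if \<beta> \<subseteq># \<alpha> then lu g (\<alpha> - \<beta>) else 0) else 0)"
    by (intro sum.cong) auto
  finally show ?thesis by (auto simp: sum.delta' in_keys_iff)
qed

lemma islin_in_vars [islin_rules]: "islin (in_vars N)"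
  unfolding in_vars_def by (intro islin_rules)

lemmas [islin_rules] = islin_comp[OF islin_in_vars]

lemma in_vars_mult: "in_vars N (f * g) = in_vars N f * in_vars N g"
  by (simp add: in_vars_def subst_mult)

lemma in_vars_Var: "in_vars N (Var k) = (\<Sum>i<N. Var i ^ k)"
  by (simp add: in_vars_def)

text \<open>One function r serves every number of variables. In the expansion of a product of power
  sums, each exponent of a resulting monomial is a sum of parts of \<open>\<nu>\<close>; unless no
  two parts merge, the number of parts drops. This triangularity makes the monomial functions a
  basis.\<close>

lemma in_vars_mon_coeff:
  assumes "0 \<notin># \<nu>"
  shows "\<exists>r. (\<forall>N \<alpha>. lu (in_vars N (mon \<nu>)) \<alpha> = (if set_mset \<alpha> \<subseteq> {..<N} then r (exponents \<alpha>) else 0)) \<and>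
    (\<forall>\<mu>. r \<mu> \<ge> (0 :: real)) \<and> r \<nu> > 0 \<and>
    (\<forall>\<mu>. r \<mu> \<noteq> 0 \<longrightarrow> 0 \<notin># \<mu> \<longrightarrow> sum_mset \<mu> = sum_mset \<nu> \<and> size \<mu> \<le> size \<nu> \<and> (size \<mu> = size \<nu> \<longrightarrow> \<mu> = \<nu>))"
  using assms
proof (induction \<nu>)
  case empty
  have "lu (in_vars N (mon {#})) \<alpha> = (if set_mset \<alpha> \<subseteq> {..<N} then if exponents \<alpha> = {#} then 1 else 0 else 0)" for N \<alpha>
    using sum_exponents[of \<alpha>] lookup_mon[of "{#}" \<alpha>] by (auto simp: in_vars_def exponents_def)
  then show ?case
    by (intro exI[of _ "\<lambda>\<mu>. if \<mu> = {#} then 1 else 0"]) auto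
next
  case (add k \<nu>)
  then obtain r where r: "\<And>N \<alpha>. lu (in_vars N (mon \<nu>)) \<alpha> = (if set_mset \<alpha> \<subseteq> {..<N} then r (exponents \<alpha>) else 0)"
    and r0: "\<And>\<mu>. r \<mu> \<ge> 0" "r \<nu> > 0"
    and r1: "\<And>\<mu>. r \<mu> \<noteq> 0 \<Longrightarrow> 0 \<notin># \<mu> \<Longrightarrow> sum_mset \<mu> = sum_mset \<nu> \<and> size \<mu> \<le> size \<nu> \<and> (size \<mu> = size \<nu> \<longrightarrow> \<mu> = \<nu>)"
    by auto
  have k: "k \<noteq> 0" using add.prems by auto
  \<comment> \<open>To read off the coefficient of a monomial in p_k p_\<nu>, choose the variable
    whose k-th power is taken from p_k; x is its exponent in the monomial.\<close>
  define g where "g \<mu> x = (if k \<le> x then r (lower_part \<mu> k x) else 0)" for \<mu> x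
  have g0: "g \<mu> x \<ge> 0" for \<mu> x by (simp add: g_def r0)
  define r' where "r' \<mu> = (\<Sum>x\<in>#\<mu>. g \<mu> x)" for \<mu>
  have "lu (in_vars N (mon (add_mset k \<nu>))) \<alpha> = (if set_mset \<alpha> \<subseteq> {..<N} then r' (exponents \<alpha>) else 0)" for N \<alpha>
  proof -
    have "lu (in_vars N (mon (add_mset k \<nu>))) \<alpha> =
        (\<Sum>i<N. if k \<le> count \<alpha> i then lu (in_vars N (mon \<nu>)) (\<alpha> - replicate_mset k i) else 0)"
      by (simp add: mon_add_mset in_vars_mult in_vars_Var sum_distrib_right lookup_sum lookup_mon_mult
          count_le_replicate_mset_subset_eq flip: mon_replicate)
    also have "\<dots> = (\<Sum>i<N. if k \<le> count \<alpha> i then if set_mset \<alpha> \<subseteq> {..<N} then r (exponents (\<alpha> - replicate_mset k i)) else 0 else 0)"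
    proof (intro sum.cong refl)
      fix i assume "i \<in> {..<N}"
      then have "set_mset (\<alpha> - replicate_mset k i) \<subseteq> {..<N} \<longleftrightarrow> set_mset \<alpha> \<subseteq> {..<N}"
        by (auto dest: in_diffD simp: subset_iff) (metis diff_zero count_diff count_replicate_mset in_diff_count not_in_iff zero_less_iff_neq_zero)
      then show "(if k \<le> count \<alpha> i then lu (in_vars N (mon \<nu>)) (\<alpha> - replicate_mset k i) else 0) =
         (if k \<le> count \<alpha> i then if set_mset \<alpha> \<subseteq> {..<N} then r (exponents (\<alpha> - replicate_mset k i)) else 0 else 0)"
        by (simp add: r)
    qed
    also have "\<dots> = (if set_mset \<alpha> \<subseteq> {..<N} then r' (exponents \<alpha>) else 0)"
    proof (cases "set_mset \<alpha> \<subseteq> {..<N}")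
      case True
      have "(\<Sum>i<N. if k \<le> count \<alpha> i then r (exponents (\<alpha> - replicate_mset k i)) else 0) =
          (\<Sum>i<N. g (exponents \<alpha>) (count \<alpha> i))"
        by (intro sum.cong) (auto simp: g_def exponents_diff_replicate k)
      also have "\<dots> = (\<Sum>i\<in>set_mset \<alpha>. g (exponents \<alpha>) (count \<alpha> i))"
        using True k by (intro sum.mono_neutral_right) (auto simp: g_def not_in_iff)
      finally show ?thesis unfolding if_P[OF True] by (simp add: r'_def sum_mset_exponents)
    qed (simp cong: if_cong)
    finally show ?thesis .
  qed
  moreover have sum_g_nonneg: "(\<Sum>x\<in>#\<nu>. g \<mu> x) \<ge> 0" for \<mu> \<nu>
    using g0 by (induction \<nu>) simp_all
  then have "r' \<mu> \<ge> 0" for \<mu> by (simp add: r'_def)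
  moreover have "r' (add_mset k \<nu>) > 0"
  proof -
    have "g (add_mset k \<nu>) k = r \<nu>" by (simp add: g_def lower_part_def)
    then show ?thesis using r0(2) sum_g_nonneg[of "add_mset k \<nu>" \<nu>] by (simp add: r'_def)
  qed
  moreover have "sum_mset \<mu> = sum_mset (add_mset k \<nu>) \<and> size \<mu> \<le> size (add_mset k \<nu>) \<and>
      (size \<mu> = size (add_mset k \<nu>) \<longrightarrow> \<mu> = add_mset k \<nu>)" if "r' \<mu> \<noteq> 0" "0 \<notin># \<mu>" for \<mu>
  proof -
    have "\<not> (\<forall>x\<in>#\<mu>. g \<mu> x = 0)"
      using that(1) sum_mset.neutral[of "image_mset (g \<mu>) \<mu>"] by (auto simp: r'_def)
    then obtain x where x: "x \<in># \<mu>" "g \<mu> x \<noteq> 0" by auto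
    then have kx: "k \<le> x" and rx: "r (lower_part \<mu> k x) \<noteq> 0" by (auto simp: g_def split: if_splits)
    obtain \<mu>' where \<mu>': "\<mu> = add_mset x \<mu>'" using x by (auto dest: multi_member_split)
    have "0 \<notin># lower_part \<mu> k x" using that(2) by (auto simp: lower_part_def \<mu>' split: if_splits)
    from r1[OF rx this] show ?thesis using kx
      by (cases "k = x") (auto simp: lower_part_def \<mu>')
  qed
  ultimately show ?case by (intro exI[of _ r'] conjI allI impI) blast+
qed

lemma exponents_surj: "0 \<notin># \<mu> \<Longrightarrow> \<exists>\<alpha>. exponents \<alpha> = \<mu> \<and> set_mset \<alpha> \<subseteq> {..<size \<mu>}"
proof (induction \<mu>)
  case empty
  then show ?case by (intro exI[of _ "{#}"]) (simp add: exponents_def)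
next
  case (add x \<mu>)
  then obtain \<alpha> where \<alpha>: "exponents \<alpha> = \<mu>" "set_mset \<alpha> \<subseteq> {..<size \<mu>}" by auto
  have "size \<mu> \<notin># \<alpha>" using \<alpha>(2) by auto
  then show ?case using add.prems \<alpha>
    by (intro exI[of _ "replicate_mset x (size \<mu>) + \<alpha>"])
      (auto simp: exponents_add_replicate dest!: subsetD split: if_splits)
qed

definition std :: "nat multiset \<Rightarrow> nat multiset" where
  "std \<mu> = (SOME \<alpha>. exponents \<alpha> = \<mu> \<and> set_mset \<alpha> \<subseteq> {..<size \<mu>})"

lemma std:
  assumes "0 \<notin># \<mu>"
  shows "exponents (std \<mu>) = \<mu>" "set_mset (std \<mu>) \<subseteq> {..<size \<mu>}"
  using someI_ex[OF exponents_surj[OF assms]] by (simp_all add: std_def)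

text \<open>The coefficient of \<open>m\<^sub>\<mu>\<close>, read off at one monomial in \<open>\<ell>(\<mu>)\<close> variables.\<close>

definition mcoeff :: "nat mpol \<Rightarrow> nat multiset \<Rightarrow> real" where
  "mcoeff f \<mu> = lu (in_vars (size \<mu>) f) (std \<mu>)"

lemma mcoeff_diff: "mcoeff (f - g) \<mu> = mcoeff f \<mu> - mcoeff g \<mu>"
  by (simp add: mcoeff_def islin_diff[OF islin_in_vars] lookup_minus)

lemma mcoeff_Const: "mcoeff (Const c * f) \<mu> = c * mcoeff f \<mu>"
  by (simp add: mcoeff_def islin_Const[OF islin_in_vars] lookup_Const_mult)

lemma mcoeff_sum: "mcoeff (sum f A) \<mu> = (\<Sum>x\<in>A. mcoeff (f x) \<mu>)"
  by (simp add: mcoeff_def islin_sum[OF islin_in_vars] lookup_sum)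

lemma mcoeff_0 [simp]: "mcoeff 0 \<mu> = 0"
  by (simp add: mcoeff_def islin_0[OF islin_in_vars])

lemma mcoeff_expand: "mcoeff f \<mu> = (\<Sum>\<nu>\<in>kys f. lu f \<nu> * mcoeff (mon \<nu>) \<mu>)"
  by (subst mpol_expand[of "kys f" f]) (simp_all add: mcoeff_sum mcoeff_Const)

text \<open>Symmetry and stability in N: a single number for each partition describes f in all
  numbers of variables.\<close>

lemma lookup_in_vars:
  assumes "f \<in> symfuns"
  shows "lu (in_vars N f) \<alpha> = (if set_mset \<alpha> \<subseteq> {..<N} then mcoeff f (exponents \<alpha>) else 0)"
proof -
  have *: "lu (in_vars N (mon \<nu>)) \<alpha> = (if set_mset \<alpha> \<subseteq> {..<N} then mcoeff (mon \<nu>) (exponents \<alpha>) else 0)"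
    if "\<nu> \<in> kys f" for \<nu>
  proof -
    have "0 \<notin># \<nu>" using that assms by (auto simp: symfuns_def is_partition_def)
    from in_vars_mon_coeff[OF this] obtain r where
      "\<And>N \<alpha>. lu (in_vars N (mon \<nu>)) \<alpha> = (if set_mset \<alpha> \<subseteq> {..<N} then r (exponents \<alpha>) else 0)" by auto
    then show ?thesis using std[of "exponents \<alpha>"] by (simp add: mcoeff_def)
  qed
  have "lu (in_vars N f) \<alpha> = (\<Sum>\<nu>\<in>kys f. lu f \<nu> * lu (in_vars N (mon \<nu>)) \<alpha>)"
    by (subst islin_expand[OF islin_in_vars]) (simp add: lookup_sum lookup_Const_mult)
  then show ?thesis by (simp add: * mcoeff_expand[of f])
qed

lemma mcoeff_mon_pos:
  assumes "0 \<notin># \<nu>" shows "mcoeff (mon \<nu>) \<nu> > 0"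
  using in_vars_mon_coeff[OF assms] std[OF assms] by (auto simp: mcoeff_def)

lemma mcoeff_mon_nonzero:
  assumes "0 \<notin># \<nu>" "0 \<notin># \<mu>" "mcoeff (mon \<nu>) \<mu> \<noteq> 0"
  shows "sum_mset \<mu> = sum_mset \<nu>" "size \<mu> \<le> size \<nu>" "size \<mu> = size \<nu> \<Longrightarrow> \<mu> = \<nu>"
  using in_vars_mon_coeff[OF assms(1)] std[OF assms(2)] assms(2,3) by (auto simp: mcoeff_def)

lemma mcoeff_nonzero:
  assumes "f \<in> symfuns" "0 \<notin># \<mu>" "mcoeff f \<mu> \<noteq> 0"
  shows "\<exists>\<nu>\<in>kys f. sum_mset \<mu> = sum_mset \<nu>"
proof -
  obtain \<nu> where "\<nu> \<in> kys f" "mcoeff (mon \<nu>) \<mu> \<noteq> 0"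
    using assms(3) mcoeff_expand[of f] by (metis (no_types, lifting) mult_zero_right sum.neutral)
  then show ?thesis using assms mcoeff_mon_nonzero[of \<nu> \<mu>] by (auto simp: symfuns_def is_partition_def)
qed

text \<open>At a partition of maximal length in the support, no other power sum product contributes
  to the coefficient of the monomial function.\<close>

lemma mcoeff_inject_0:
  assumes "f \<in> symfuns" "\<And>\<mu>. 0 \<notin># \<mu> \<Longrightarrow> mcoeff f \<mu> = 0"
  shows "f = 0"
proof (rule ccontr)
  assume "f \<noteq> 0"
  then have "kys f \<noteq> {}" by simp
  then obtain \<nu> where \<nu>: "\<nu> \<in> kys f" and max: "\<And>\<mu>. \<mu> \<in> kys f \<Longrightarrow> size \<mu> \<le> size \<nu>"
    using Max_in[of "size ` kys f"] Max_ge[of "size ` kys f"] by fastforce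
  have p: "0 \<notin># \<mu>" if "\<mu> \<in> kys f" for \<mu> using that assms by (auto simp: symfuns_def is_partition_def)
  have "mcoeff f \<nu> = (\<Sum>\<mu>\<in>kys f. if \<mu> = \<nu> then lu f \<nu> * mcoeff (mon \<nu>) \<nu> else 0)"
    unfolding mcoeff_expand[of f]
    using mcoeff_mon_nonzero[OF p p[OF \<nu>]] max by (intro sum.cong) (auto, metis le_antisym)
  also have "\<dots> = lu f \<nu> * mcoeff (mon \<nu>) \<nu>" using \<nu> by simp
  finally show False using assms(2)[OF p[OF \<nu>]] \<nu> mcoeff_mon_pos[OF p[OF \<nu>]] by (auto simp: in_keys_iff)
qed

lemma mcoeff_inject:
  assumes "f \<in> symfuns" "g \<in> symfuns" "\<And>\<mu>. 0 \<notin># \<mu> \<Longrightarrow> mcoeff f \<mu> = mcoeff g \<mu>"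
  shows "f = g"
  using mcoeff_inject_0[of "f - g"] assms by (auto simp: mcoeff_diff)

lemma finite_multisets_bounded:
  assumes "finite S" shows "finite {\<mu>. set_mset \<mu> \<subseteq> S \<and> size \<mu> \<le> n}"
proof (rule finite_subset)
  show "{\<mu>. set_mset \<mu> \<subseteq> S \<and> size \<mu> \<le> n} \<subseteq> mset ` {xs. set xs \<subseteq> S \<and> length xs \<le> n}"
    by (auto simp: image_iff) (metis ex_mset set_mset_mset size_mset)
qed (use finite_lists_length_le[OF assms] in auto)

lemma finite_partitions [simp]: "finite (partitions n)"
proof (rule finite_subset)
  have "size \<mu> \<le> sum_mset \<mu>" if "0 \<notin># \<mu>" for \<mu> using that by (induction \<mu>) auto
  then show "partitions n \<subseteq> {\<mu>. set_mset \<mu> \<subseteq> {..n} \<and> size \<mu> \<le> n}"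
    by (auto simp: partitions_def is_partition_def dest: multi_member_split)
qed (rule finite_multisets_bounded, simp)

lemma partitions_iff: "\<mu> \<in> partitions n \<longleftrightarrow> 0 \<notin># \<mu> \<and> sum_mset \<mu> = n"
  by (simp add: partitions_def is_partition_def)

lemma lookup_monomial_sym:
  "lu (monomial_sym N \<mu>) \<alpha> = (if set_mset \<alpha> \<subseteq> {..<N} \<and> exponents \<alpha> = \<mu> then 1 else 0)"
proof -
  have "finite {\<alpha>. set_mset \<alpha> \<subseteq> {..<N} \<and> exponents \<alpha> = \<mu>}"
    by (rule finite_subset[OF _ finite_multisets_bounded[of "{..<N}" "sum_mset \<mu>"]])
      (auto simp: sum_exponents)
  then show ?thesis
    by (simp add: monomial_sym_def lookup_sum lookup_single when_def)
qed

text \<open>Inverts the triangular system by recursion on the number of parts: subtract from p_\<mu>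
  its shorter monomial functions and divide by the positive diagonal coefficient.\<close>

lemma monomial_function_exists:
  "0 \<notin># \<mu> \<Longrightarrow> \<exists>M. kys M \<subseteq> partitions (sum_mset \<mu>) \<and> (\<forall>\<mu>'. 0 \<notin># \<mu>' \<longrightarrow> mcoeff M \<mu>' = (if \<mu>' = \<mu> then 1 else 0))"
proof (induction "size \<mu>" arbitrary: \<mu> rule: less_induct)
  case less
  let ?S = "{\<mu>' \<in> partitions (sum_mset \<mu>). size \<mu>' < size \<mu>}"
  have "\<forall>\<mu>'\<in>?S. \<exists>M. kys M \<subseteq> partitions (sum_mset \<mu>) \<and> (\<forall>\<mu>''. 0 \<notin># \<mu>'' \<longrightarrow> mcoeff M \<mu>'' = (if \<mu>'' = \<mu>' then 1 else 0))"
  proof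
    fix \<mu>' assume "\<mu>' \<in> ?S"
    then show "\<exists>M. kys M \<subseteq> partitions (sum_mset \<mu>) \<and> (\<forall>\<mu>''. 0 \<notin># \<mu>'' \<longrightarrow> mcoeff M \<mu>'' = (if \<mu>'' = \<mu>' then 1 else 0))"
      using less.hyps[of \<mu>'] by (simp add: partitions_iff)
  qed
  from bchoice[OF this] obtain M where M': "\<forall>\<mu>'\<in>?S. kys (M \<mu>') \<subseteq> partitions (sum_mset \<mu>) \<and>
      (\<forall>\<mu>''. 0 \<notin># \<mu>'' \<longrightarrow> mcoeff (M \<mu>') \<mu>'' = (if \<mu>'' = \<mu>' then 1 else 0))" ..
  then have M: "\<And>\<mu>'. \<mu>' \<in> ?S \<Longrightarrow> kys (M \<mu>') \<subseteq> partitions (sum_mset \<mu>)"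
    "\<And>\<mu>' \<mu>''. \<mu>' \<in> ?S \<Longrightarrow> 0 \<notin># \<mu>'' \<Longrightarrow> mcoeff (M \<mu>') \<mu>'' = (if \<mu>'' = \<mu>' then 1 else 0)"
    by simp_all
  define c where "c = mcoeff (mon \<mu>) \<mu>"
  have c: "c > 0" using less.prems by (simp add: c_def mcoeff_mon_pos)
  define N where "N = Const (1 / c) * (mon \<mu> - (\<Sum>\<mu>'\<in>?S. Const (mcoeff (mon \<mu>) \<mu>') * M \<mu>'))"
  have "kys N \<subseteq> partitions (sum_mset \<mu>)"
  proof -
    have "kys N \<subseteq> insert \<mu> (\<Union>\<mu>'\<in>?S. kys (M \<mu>'))"
      unfolding N_def
      by (rule order_trans[OF keys_Const_mult], rule order_trans[OF keys_minus_subset])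
        (use keys_sum_subset[of "\<lambda>\<mu>'. Const (mcoeff (mon \<mu>) \<mu>') * M \<mu>'" ?S] keys_Const_mult in fastforce)
    moreover have "(\<Union>\<mu>'\<in>?S. kys (M \<mu>')) \<subseteq> partitions (sum_mset \<mu>)" using M(1) by (rule UN_least)
    moreover have "\<mu> \<in> partitions (sum_mset \<mu>)" using less.prems by (simp add: partitions_iff)
    ultimately show ?thesis by blast
  qed
  moreover have "mcoeff N \<nu> = (if \<nu> = \<mu> then 1 else 0)" if \<nu>: "0 \<notin># \<nu>" for \<nu>
  proof -
    have "mcoeff N \<nu> = 1 / c * (mcoeff (mon \<mu>) \<nu> - (\<Sum>\<mu>'\<in>?S. if \<mu>' = \<nu> then mcoeff (mon \<mu>) \<mu>' else 0))"
      unfolding N_def mcoeff_Const mcoeff_diff mcoeff_sum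
      by (intro arg_cong2[of _ _ _ _ "(*)"] arg_cong2[of _ _ _ _ "(-)"] sum.cong refl) (simp add: M(2) \<nu>)
    also have "(\<Sum>\<mu>'\<in>?S. if \<mu>' = \<nu> then mcoeff (mon \<mu>) \<mu>' else 0) = (if \<nu> \<in> ?S then mcoeff (mon \<mu>) \<nu> else 0)"
      by simp
    also have "1 / c * (mcoeff (mon \<mu>) \<nu> - \<dots>) = (if \<nu> = \<mu> then 1 else 0)"
    proof (cases "\<nu> = \<mu>")
      case True
      then show ?thesis using c by (simp add: c_def)
    next
      case False
      then have "\<nu> \<notin> ?S \<Longrightarrow> mcoeff (mon \<mu>) \<nu> = 0"
        using mcoeff_mon_nonzero[OF less.prems \<nu>] \<nu> by (auto simp: partitions_iff) (metis le_neq_implies_less)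
      then show ?thesis using False by auto
    qed
    finally show ?thesis .
  qed
  ultimately show ?case by blast
qed

definition msym :: "nat multiset \<Rightarrow> nat mpol" where
  "msym \<mu> = (SOME M. kys M \<subseteq> partitions (sum_mset \<mu>) \<and> (\<forall>\<mu>'. 0 \<notin># \<mu>' \<longrightarrow> mcoeff M \<mu>' = (if \<mu>' = \<mu> then 1 else 0)))"

lemma msym:
  assumes "0 \<notin># \<mu>"
  shows "kys (msym \<mu>) \<subseteq> partitions (sum_mset \<mu>)"
    and "0 \<notin># \<mu>' \<Longrightarrow> mcoeff (msym \<mu>) \<mu>' = (if \<mu>' = \<mu> then 1 else 0)"
  using someI_ex[OF monomial_function_exists[OF assms]] by (simp_all add: msym_def)

lemma msym_in_symfuns: "0 \<notin># \<mu> \<Longrightarrow> msym \<mu> \<in> symfuns"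
  using msym(1)[of \<mu>] by (auto simp: symfuns_def partitions_def)

lemma msym_expand:
  assumes "f \<in> symfuns" "finite S" "\<And>\<mu>. \<mu> \<in> S \<Longrightarrow> 0 \<notin># \<mu>"
    and "\<And>\<mu>. 0 \<notin># \<mu> \<Longrightarrow> mcoeff f \<mu> \<noteq> 0 \<Longrightarrow> \<mu> \<in> S"
  shows "f = (\<Sum>\<mu>\<in>S. Const (mcoeff f \<mu>) * msym \<mu>)"
proof (rule mcoeff_inject)
  show "(\<Sum>\<mu>\<in>S. Const (mcoeff f \<mu>) * msym \<mu>) \<in> symfuns"
    using assms by (intro symfuns_sum symfuns_Const_mult msym_in_symfuns)
  fix \<nu> :: "nat multiset" assume \<nu>: "0 \<notin># \<nu>"
  have "mcoeff (\<Sum>\<mu>\<in>S. Const (mcoeff f \<mu>) * msym \<mu>) \<nu> = (\<Sum>\<mu>\<in>S. if \<mu> = \<nu> then mcoeff f \<nu> else 0)"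
    unfolding mcoeff_sum by (intro sum.cong refl) (use assms \<nu> in \<open>auto simp: mcoeff_Const msym\<close>)
  then show "mcoeff f \<nu> = mcoeff (\<Sum>\<mu>\<in>S. Const (mcoeff f \<mu>) * msym \<mu>) \<nu>"
    using assms(2) assms(4)[OF \<nu>] by auto
qed (fact assms)

lemma msym_expand_bounded:
  assumes "f \<in> symfuns"
  shows "\<exists>n. \<forall>m\<ge>n. f = (\<Sum>\<mu>\<in>(\<Union>j\<le>m. partitions j). Const (mcoeff f \<mu>) * msym \<mu>)"
proof (intro exI allI impI)
  fix m assume m: "Max (insert 0 (sum_mset ` kys f)) \<le> m"
  show "f = (\<Sum>\<mu>\<in>(\<Union>j\<le>m. partitions j). Const (mcoeff f \<mu>) * msym \<mu>)"
  proof (rule msym_expand[OF assms])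
    fix \<mu> :: "nat multiset" assume \<mu>: "0 \<notin># \<mu>" "mcoeff f \<mu> \<noteq> 0"
    from mcoeff_nonzero[OF assms this] m show "\<mu> \<in> (\<Union>j\<le>m. partitions j)"
      using \<mu> by (auto simp: partitions_iff)
  qed (auto simp: partitions_iff)
qed

section \<open>The dominance order\<close>

text \<open>
  Dominance is expressed through the conjugate partition: \<^term>\<open>\<lambda>t. \<Sum>x\<in>#\<mu>. x - t\<close> counts the boxes of
  \<open>\<mu>\<close> to the right of column \<open>t\<close>.
\<close>

definition trunc :: "nat \<Rightarrow> nat multiset \<Rightarrow> nat" where
  "trunc t \<mu> = (\<Sum>x\<in>#\<mu>. x - t)"

definition dle :: "nat multiset \<Rightarrow> nat multiset \<Rightarrow> bool" where
  "dle \<mu> \<nu> \<longleftrightarrow> sum_mset \<mu> = sum_mset \<nu> \<and> (\<forall>t. trunc t \<mu> \<le> trunc t \<nu>)"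

lemma dle_refl [simp]: "dle \<mu> \<mu>" by (simp add: dle_def)

lemma dle_trans: "dle \<mu> \<nu> \<Longrightarrow> dle \<nu> \<rho> \<Longrightarrow> dle \<mu> \<rho>"
  by (auto simp: dle_def intro: order_trans)

text \<open>Multiplicities are second differences of \<open>trunc\<close>; hence antisymmetry of
  \<open>dle\<close>.\<close>

lemma trunc_second_difference: "t > 0 \<Longrightarrow> trunc (t - 1) \<mu> + trunc (t + 1) \<mu> = 2 * trunc t \<mu> + count \<mu> t"
  unfolding trunc_def by (induction \<mu>) auto

lemma dle_antisym:
  assumes "dle \<mu> \<nu>" "dle \<nu> \<mu>" "0 \<notin># \<mu>" "0 \<notin># \<nu>"
  shows "\<mu> = \<nu>"
proof (rule multiset_eqI)
  fix t
  have "trunc s \<mu> = trunc s \<nu>" for s using assms(1,2) by (auto simp: dle_def intro: antisym)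
  then show "count \<mu> t = count \<nu> t"
    using trunc_second_difference[of t \<mu>] trunc_second_difference[of t \<nu>] assms(3,4)
    by (cases "t = 0") (auto simp: not_in_iff)
qed

lemma trunc_mset: "trunc t (mset xs) = (\<Sum>x\<leftarrow>xs. x - t)"
  by (simp add: trunc_def flip: sum_mset_sum_list)

lemma sum_take_le: "sum_list (take k xs) \<le> k * t + trunc t (mset xs)"
proof -
  have "sum_list ys \<le> length ys * t + (\<Sum>x\<leftarrow>ys. x - t)" for ys :: "nat list" by (induction ys) auto
  from this[of "take k xs"] have "sum_list (take k xs) \<le> length (take k xs) * t + (\<Sum>x\<leftarrow>take k xs. x - t)" .
  also have "\<dots> \<le> k * t + ((\<Sum>x\<leftarrow>take k xs. x - t) + (\<Sum>x\<leftarrow>drop k xs. x - t))"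
    by (intro add_mono mult_le_mono1) auto
  also have "(\<Sum>x\<leftarrow>take k xs. x - t) + (\<Sum>x\<leftarrow>drop k xs. x - t) = trunc t (mset xs)"
    unfolding trunc_mset by (metis append_take_drop_id map_append sum_list_append)
  finally show ?thesis .
qed

lemma sum_take_eq:
  assumes "k \<le> length xs" "\<And>x. x \<in> set (take k xs) \<Longrightarrow> t \<le> x" "\<And>x. x \<in> set (drop k xs) \<Longrightarrow> x \<le> t"
  shows "sum_list (take k xs) = k * t + trunc t (mset xs)"
proof -
  have "sum_list ys = length ys * t + (\<Sum>x\<leftarrow>ys. x - t)" if "\<forall>x\<in>set ys. t \<le> x" for ys :: "nat list"
    using that by (induction ys) auto
  from this[of "take k xs"] have "sum_list (take k xs) = k * t + (\<Sum>x\<leftarrow>take k xs. x - t)"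
    using assms by simp
  moreover have "(\<Sum>x\<leftarrow>drop k xs. x - t) = 0" using assms(3) by (simp add: sum_list_eq_0_iff)
  moreover have "(\<Sum>x\<leftarrow>take k xs. x - t) + (\<Sum>x\<leftarrow>drop k xs. x - t) = trunc t (mset xs)"
    unfolding trunc_mset by (metis append_take_drop_id map_append sum_list_append)
  ultimately show ?thesis by linarith
qed

text \<open>Legendre duality: the sum of the k largest parts is the minimum over t of k t + trunc t,
  attained when t is the k-th part, and conversely trunc t is the maximum over k of that sum minus k
  t, attained when k is the number of parts exceeding t.\<close>

lemma dominance_le_iff_dle: "dominance_le \<mu> \<nu> \<longleftrightarrow> dle \<mu> \<nu>"
proof -
  define xs ys where "xs = rev (sorted_list_of_multiset \<mu>)" and "ys = rev (sorted_list_of_multiset \<nu>)"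
  have m: "mset xs = \<mu>" "mset ys = \<nu>" by (simp_all add: xs_def ys_def)
  have s: "sorted_wrt (\<ge>) xs" "sorted_wrt (\<ge>) ys"
    by (simp_all add: xs_def ys_def sorted_wrt_rev sorted_sorted_list_of_multiset)
  have d: "dominance_le \<mu> \<nu> \<longleftrightarrow> sum_mset \<mu> = sum_mset \<nu> \<and> (\<forall>k. sum_list (take k xs) \<le> sum_list (take k ys))"
    unfolding dominance_le_def xs_def ys_def by (rule refl)
  show ?thesis
  proof
    assume dom: "dominance_le \<mu> \<nu>"
    have "trunc t \<mu> \<le> trunc t \<nu>" for t
    proof -
      define k where "k = length (takeWhile (\<lambda>x. t < x) xs)"
      have *: "take k xs = takeWhile (\<lambda>x. t < x) xs" "drop k xs = dropWhile (\<lambda>x. t < x) xs"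
        unfolding k_def by (rule takeWhile_eq_take[symmetric], rule dropWhile_eq_drop[symmetric])
      have "sum_list (take k xs) = k * t + trunc t (mset xs)"
      proof (rule sum_take_eq)
        show "k \<le> length xs" by (simp add: k_def length_takeWhile_le)
        show "t \<le> x" if "x \<in> set (take k xs)" for x using that unfolding * by (auto dest: set_takeWhileD)
        fix x assume x: "x \<in> set (drop k xs)"
        then obtain y zs where yz: "dropWhile (\<lambda>x. t < x) xs = y # zs" unfolding * by (cases "dropWhile (\<lambda>x. t < x) xs") auto
        then have "y \<le> t" by (metis dropWhile_eq_Cons_conv not_le)
        moreover have "sorted_wrt (\<ge>) (y # zs)" using sorted_wrt_drop[OF s(1), of k] unfolding * yz .
        ultimately show "x \<le> t" using x unfolding * yz by auto
      qed
      moreover have "sum_list (take k xs) \<le> sum_list (take k ys)" using dom by (simp add: d)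
      moreover have "sum_list (take k ys) \<le> k * t + trunc t (mset ys)" by (rule sum_take_le)
      ultimately show ?thesis by (simp add: m)
    qed
    then show "dle \<mu> \<nu>" using dom by (simp add: dle_def d)
  next
    assume dle: "dle \<mu> \<nu>"
    have "sum_list (take k xs) \<le> sum_list (take k ys)" for k
    proof (cases "k = 0 \<or> k > length ys")
      case True
      have "sum_list (take k xs) \<le> sum_list xs"
        by (metis append_take_drop_id le_add1 sum_list_append)
      also have "\<dots> = sum_list ys" using dle m by (simp add: dle_def flip: sum_mset_sum_list)
      finally show ?thesis using True by auto
    next
      case False
      let ?t = "ys ! (k - 1)"
      have "sum_list (take k ys) = k * ?t + trunc ?t (mset ys)"
      proof (rule sum_take_eq)
        show "k \<le> length ys" using False by simp
        show "?t \<le> x" if x: "x \<in> set (take k ys)" for x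
        proof -
          obtain i where "i < k" "x = ys ! i" using x False by (auto simp: in_set_conv_nth)
          then show ?thesis using s(2) False by (cases "i = k - 1") (auto simp: sorted_wrt_iff_nth_less)
        qed
        show "x \<le> ?t" if x: "x \<in> set (drop k ys)" for x
        proof -
          obtain i where "i < length ys - k" "x = ys ! (k + i)" using x unfolding in_set_conv_nth by auto
          then show ?thesis using s(2) False by (auto simp: sorted_wrt_iff_nth_less)
        qed
      qed
      moreover have "sum_list (take k xs) \<le> k * ?t + trunc ?t (mset xs)" by (rule sum_take_le)
      moreover have "trunc ?t \<mu> \<le> trunc ?t \<nu>" using dle by (simp add: dle_def)
      ultimately show ?thesis using m by simp
    qed
    then show "dominance_le \<mu> \<nu>" using dle by (simp add: d dle_def)
  qed
qed

definition sqs :: "nat multiset \<Rightarrow> nat" where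
  "sqs \<mu> = (\<Sum>x\<in>#\<mu>. x * x)"

text \<open>Writes the sum of squares as a sum of \<open>trunc\<close> values, whence it grows
  strictly along dominance.\<close>

lemma sqs_trunc: "set_mset \<mu> \<subseteq> {..n} \<Longrightarrow> sqs \<mu> = sum_mset \<mu> + 2 * (\<Sum>t=1..n. trunc t \<mu>)"
proof (induction \<mu>)
  case (add x \<mu>)
  have *: "x * x = x + 2 * (\<Sum>t=1..n. x - t)" if "x \<le> n" for x
  proof -
    have "(\<Sum>t=1..n. x - t) = (\<Sum>t=1..x. x - t)"
      using that by (intro sum.mono_neutral_right) auto
    also have "\<dots> = (\<Sum>t<x. t)"
      by (rule sum.reindex_bij_witness[of _ "\<lambda>t. x - t" "\<lambda>t. x - t"]) auto
    also have "x + 2 * \<dots> = x * x" by (induction x) auto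
    finally show ?thesis by simp
  qed
  from add show ?case using *[of x]
    by (simp add: sqs_def trunc_def sum.distrib)
qed (simp add: sqs_def trunc_def)

lemma member_le_sum_mset: "x \<in># \<mu> \<Longrightarrow> x \<le> sum_mset \<mu>" for x :: nat
  by (auto dest: multi_member_split)

lemma sqs_less:
  assumes "dle \<mu> \<nu>" "\<mu> \<noteq> \<nu>" "0 \<notin># \<mu>" "0 \<notin># \<nu>"
  shows "sqs \<mu> < sqs \<nu>"
proof -
  let ?n = "sum_mset \<nu>"
  have eq: "sum_mset \<mu> = ?n" using assms by (simp add: dle_def)
  have "\<not> dle \<nu> \<mu>" using assms dle_antisym by blast
  then obtain t where t: "trunc t \<mu> < trunc t \<nu>" using eq by (auto simp: dle_def not_le)
  have "t \<noteq> 0" using t eq by (auto simp: trunc_def intro!: Nat.gr0I)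
  moreover have "t \<le> ?n"
  proof (rule ccontr)
    assume "\<not> t \<le> ?n"
    then have "x - t = 0" if "x \<in># \<nu>" for x using member_le_sum_mset[OF that] by simp
    then have "trunc t \<nu> = 0" by (simp add: trunc_def)
    then show False using t by simp
  qed
  ultimately have "(\<Sum>t=1..?n. trunc t \<mu>) < (\<Sum>t=1..?n. trunc t \<nu>)"
    using t assms(1) by (intro sum_strict_mono_ex1) (auto simp: dle_def intro!: bexI[of _ t])
  then show ?thesis
    using sqs_trunc[of \<mu> ?n] sqs_trunc[of \<nu> ?n] member_le_sum_mset eq by fastforce
qed

section \<open>Divided differences\<close>

definition tr :: "nat \<Rightarrow> nat \<Rightarrow> nat" where
  "tr j i = (if i = 0 then j else if i = j then 0 else i)"

lemma tr_tr [simp]: "tr j (tr j i) = i" and tr_0 [simp]: "tr j 0 = j" and tr_j [simp]: "tr j j = 0"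
  by (auto simp: tr_def)

lemma inj_tr: "inj (tr j)"
  by (rule inj_on_inverseI[of _ "tr j"]) simp

definition swm :: "nat \<Rightarrow> nat multiset \<Rightarrow> nat multiset" where
  "swm j \<alpha> = image_mset (tr j) \<alpha>"

lemma swm_swm [simp]: "swm j (swm j \<alpha>) = \<alpha>"
  by (simp add: swm_def image_mset.compositionality comp_def)

lemma count_swm: "count (swm j \<alpha>) i = count \<alpha> (tr j i)"
proof (induction \<alpha>)
  case (add x \<alpha>)
  have "tr j x = i \<longleftrightarrow> x = tr j i" by auto
  then show ?case using add by (simp add: swm_def)
qed (simp add: swm_def)

lemma swm_eq_iff: "swm j \<alpha> = \<beta> \<longleftrightarrow> \<alpha> = swm j \<beta>"
  by auto

lemma set_swm_subset: "0 < N \<Longrightarrow> j < N \<Longrightarrow> set_mset (swm j \<alpha>) \<subseteq> {..<N} \<longleftrightarrow> set_mset \<alpha> \<subseteq> {..<N}"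
  by (fastforce simp: swm_def tr_def split: if_splits)

lemma exponents_swm [simp]: "exponents (swm j \<alpha>) = exponents \<alpha>"
proof -
  have "mset_set (set_mset (swm j \<alpha>)) = image_mset (tr j) (mset_set (set_mset \<alpha>))"
    unfolding swm_def set_image_mset by (rule image_mset_mset_set[symmetric, OF inj_on_subset[OF inj_tr]]) simp
  then show ?thesis
    by (simp add: exponents_def image_mset.compositionality comp_def count_swm)
qed

definition sw :: "nat \<Rightarrow> nat mpol \<Rightarrow> nat mpol" where
  "sw j = subst (\<lambda>i. Var (tr j i))"

lemma islin_sw [islin_rules]: "islin (sw j)"
  unfolding sw_def by (intro islin_rules)

lemmas [islin_rules] = islin_comp[OF islin_sw]

lemma sw_mon: "sw j (mon \<alpha>) = mon (swm j \<alpha>)"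
  by (induction \<alpha>) (simp_all add: sw_def swm_def subst_mult mon_add_mset)

lemma sw_mult: "sw j (f * g) = sw j f * sw j g"
  by (simp add: sw_def subst_mult)

lemma lookup_sw: "lu (sw j f) \<alpha> = lu f (swm j \<alpha>)"
proof -
  have "lu (sw j f) \<alpha> = (\<Sum>\<mu>\<in>kys f. if \<mu> = swm j \<alpha> then lu f \<mu> else 0)"
    unfolding islin_expand[OF islin_sw, of j f] lookup_sum
    by (intro sum.cong refl) (auto simp: lookup_Const_mult sw_mon lookup_mon)
  then show ?thesis by (simp add: in_keys_iff)
qed

definition put :: "nat \<Rightarrow> nat multiset \<Rightarrow> nat \<Rightarrow> nat \<Rightarrow> nat multiset" where
  "put j \<rho> x y = filter_mset (\<lambda>i. i \<noteq> 0 \<and> i \<noteq> j) \<rho> + replicate_mset x 0 + replicate_mset y j"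

lemma count_put: "j \<noteq> 0 \<Longrightarrow> count (put j \<rho> x y) i = (if i = 0 then x else if i = j then y else count \<rho> i)"
  by (auto simp: put_def)

lemma put_id: "j \<noteq> 0 \<Longrightarrow> put j \<rho> (count \<rho> 0) (count \<rho> j) = \<rho>"
  by (rule multiset_eqI) (auto simp: count_put)

lemma put_swap: "j \<noteq> 0 \<Longrightarrow> put j \<rho> (count \<rho> j) (count \<rho> 0) = swm j \<rho>"
  by (rule multiset_eqI) (auto simp: count_put count_swm tr_def)

lemma put_swm: "j \<noteq> 0 \<Longrightarrow> put j (swm j \<rho>) = put j \<rho>"
  by (intro ext multiset_eqI) (auto simp: count_put count_swm tr_def)

lemma mon_put: "mon (put j \<rho> x y) = mon (filter_mset (\<lambda>i. i \<noteq> 0 \<and> i \<noteq> j) \<rho>) * (Var 0 ^ x * Var j ^ y)"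
  by (simp add: put_def mon_add mon_replicate mult.assoc)

text \<open>The divided difference \<open>x\<^sub>0 (f - s f) / (x\<^sub>0 - x\<^sub>j)\<close>, where \<open>s\<close> exchanges \<open>x\<^sub>0\<close> and \<open>x\<^sub>j\<close>.\<close>

definition ddm :: "nat \<Rightarrow> nat multiset \<Rightarrow> nat mpol" where
  "ddm j \<rho> = (if count \<rho> j \<le> count \<rho> 0
     then (\<Sum>t<count \<rho> 0 - count \<rho> j. mon (put j \<rho> (count \<rho> 0 - t) (count \<rho> j + t)))
     else - (\<Sum>t<count \<rho> j - count \<rho> 0. mon (put j \<rho> (count \<rho> j - t) (count \<rho> 0 + t))))"

definition dd :: "nat \<Rightarrow> nat mpol \<Rightarrow> nat mpol" where
  "dd j = lin (ddm j)"

lemma islin_dd [islin_rules]: "islin (dd j)"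
  unfolding dd_def by (intro islin_rules)

lemmas [islin_rules] = islin_comp[OF islin_dd]

lemma divided_power_sum:
  fixes x y :: "'a :: comm_ring_1"
  assumes "c \<le> d"
  shows "(x - y) * (\<Sum>t<d - c. x ^ (d - t) * y ^ (c + t)) = x * (x ^ d * y ^ c - x ^ c * y ^ d)"
proof -
  define n where "n = d - c"
  have d: "d = c + n" using assms by (simp add: n_def)
  have "(\<Sum>t<n. x ^ (d - t) * y ^ (c + t)) = x * x ^ c * y ^ c * (\<Sum>t<n. x ^ (n - Suc t) * y ^ t)"
    unfolding sum_distrib_left
  proof (intro sum.cong refl)
    fix t assume "t \<in> {..<n}"
    then have "d - t = Suc (c + (n - Suc t))" by (auto simp: d)
    then show "x ^ (d - t) * y ^ (c + t) = x * x ^ c * y ^ c * (x ^ (n - Suc t) * y ^ t)"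
      by (simp add: power_add mult_ac)
  qed
  moreover have "y ^ n - x ^ n = (y - x) * (\<Sum>t<n. x ^ (n - Suc t) * y ^ t)"
    by (rule power_diff_sumr2)
  then have "(x - y) * (\<Sum>t<n. x ^ (n - Suc t) * y ^ t) = x ^ n - y ^ n"
    by (simp add: left_diff_distrib) (metis minus_diff_eq)
  ultimately have "(x - y) * (\<Sum>t<n. x ^ (d - t) * y ^ (c + t)) = x * x ^ c * y ^ c * (x ^ n - y ^ n)"
    by (simp only: mult.left_commute[of "x - y"])
  then show ?thesis by (simp add: d power_add algebra_simps)
qed

lemma dd_characterisation:
  assumes "j \<noteq> 0"
  shows "(Var 0 - Var j) * dd j f = Var 0 * (f - sw j f)"
proof (rule islin_ext[of "\<lambda>f. (Var 0 - Var j) * dd j f" "\<lambda>f. Var 0 * (f - sw j f)"])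
  fix \<rho>
  let ?r = "mon (filter_mset (\<lambda>i. i \<noteq> 0 \<and> i \<noteq> j) \<rho>)"
  let ?c = "count \<rho> j" and ?d = "count \<rho> 0"
  have 1: "mon \<rho> = ?r * (Var 0 ^ ?d * Var j ^ ?c)"
    unfolding mon_put[symmetric] put_id[OF assms] ..
  have 2: "sw j (mon \<rho>) = ?r * (Var 0 ^ ?c * Var j ^ ?d)"
    unfolding mon_put[symmetric] put_swap[OF assms] sw_mon ..
  show "(Var 0 - Var j) * dd j (mon \<rho>) = Var 0 * (mon \<rho> - sw j (mon \<rho>))"
  proof (cases "?c \<le> ?d")
    case True
    have "(Var 0 - Var j) * dd j (mon \<rho>) = ?r * ((Var 0 - Var j) * (\<Sum>t<?d - ?c. Var 0 ^ (?d - t) * Var j ^ (?c + t)))"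
      using True by (simp add: dd_def ddm_def mon_put sum_distrib_left mult_ac)
    then show ?thesis using True unfolding divided_power_sum[OF True] 2 by (subst 1) (simp add: algebra_simps)
  next
    case False
    then have le: "?d \<le> ?c" by simp
    have "(Var 0 - Var j) * dd j (mon \<rho>) = - (?r * ((Var 0 - Var j) * (\<Sum>t<?c - ?d. Var 0 ^ (?c - t) * Var j ^ (?d + t))))"
      using False by (simp add: dd_def ddm_def mon_put sum_distrib_left mult_ac)
    then show ?thesis unfolding divided_power_sum[OF le] 2 by (subst 1) (simp add: algebra_simps)
  qed
qed (intro islin_rules)+

text \<open>Comparing coefficients in x_i g = x_j g trades a factor x_j for a factor x_i. Repeating
  this exhausts the exponent of x_j, and then the right side has coefficient 0.\<close>

lemma Var_diff_cancel:
  assumes "j \<noteq> i" "(Var i - Var j) * g = 0"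
  shows "g = 0"
proof (rule poly_mapping_eqI)
  fix \<alpha>
  have eq: "mon {#i#} * g = mon {#j#} * g" using assms(2) by (simp add: Var_eq_mon left_diff_distrib)
  have "lu g \<alpha> = 0" if "count \<alpha> j = n" for n
    using that
  proof (induction n arbitrary: \<alpha>)
    case 0
    have "lu g \<alpha> = lu (mon {#j#} * g) (add_mset i \<alpha>)"
      unfolding eq[symmetric] by (simp add: lookup_mon_mult)
    then show ?case using 0 assms(1) by (simp add: lookup_mon_mult count_eq_zero_iff)
  next
    case (Suc n)
    have "lu g \<alpha> = lu (mon {#j#} * g) (add_mset i \<alpha>)"
      unfolding eq[symmetric] by (simp add: lookup_mon_mult)
    also have "\<dots> = 0" using Suc assms(1) by (simp add: lookup_mon_mult)
    finally show ?case .
  qed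
  then show "lu g \<alpha> = lu 0 \<alpha>" by simp
qed

lemma dd_mult_symmetric:
  assumes "j \<noteq> 0" "sw j g = g"
  shows "dd j (f * g) = dd j f * g"
proof -
  have "(Var 0 - Var j) * (dd j (f * g) - dd j f * g) =
      (Var 0 - Var j) * dd j (f * g) - (Var 0 - Var j) * dd j f * g"
    by (simp add: algebra_simps)
  also have "\<dots> = 0"
    unfolding dd_characterisation[OF assms(1)] by (simp add: sw_mult assms(2) algebra_simps)
  finally show ?thesis using Var_diff_cancel[of j 0] assms(1) by fastforce
qed

lemma dd_power: "j \<noteq> 0 \<Longrightarrow> dd j (Var 0 ^ m) = (\<Sum>t<m. Var 0 ^ (m - t) * Var j ^ t)"
proof -
  assume "j \<noteq> 0"
  have "filter_mset (\<lambda>i. i \<noteq> 0 \<and> i \<noteq> j) (replicate_mset m 0) = {#}" by (intro multiset_eqI) auto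
  then have "mon (put j (replicate_mset m 0) x y) = Var 0 ^ x * Var j ^ y" for x y
    by (simp only: mon_put mon_empty mult_1)
  then show ?thesis using \<open>j \<noteq> 0\<close> by (simp add: dd_def ddm_def flip: mon_replicate)
qed

lemma trunc_exponents:
  assumes "finite K" "set_mset \<nu> \<subseteq> K"
  shows "trunc t (exponents \<nu>) = (\<Sum>i\<in>K. count \<nu> i - t)"
  unfolding trunc_def sum_mset_exponents using assms
  by (intro sum.mono_neutral_left) (auto simp: not_in_iff)

text \<open>The truncated difference x - t is convex in x, so bringing two exponents of fixed sum
  closer together cannot increase \<open>trunc\<close>. The strict case shows at t equal to the
  larger old exponent minus 1, where the two new exponents contribute nothing.\<close>

lemma dle_exponents_move:
  assumes j: "j \<noteq> 0" and off: "\<And>i. i \<noteq> 0 \<Longrightarrow> i \<noteq> j \<Longrightarrow> count \<nu> i = count \<rho> i"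
    and sum: "count \<nu> 0 + count \<nu> j = count \<rho> 0 + count \<rho> j"
    and le: "count \<nu> 0 \<le> max (count \<rho> 0) (count \<rho> j)" "count \<nu> j \<le> max (count \<rho> 0) (count \<rho> j)"
  shows "dle (exponents \<nu>) (exponents \<rho>)"
    and "count \<nu> 0 < max (count \<rho> 0) (count \<rho> j) \<Longrightarrow> count \<nu> j < max (count \<rho> 0) (count \<rho> j) \<Longrightarrow>
      exponents \<nu> \<noteq> exponents \<rho>"
proof -
  define K where "K = set_mset \<nu> \<union> set_mset \<rho>"
  define S where "S t = (\<Sum>i\<in>K - {0, j}. count \<rho> i - t)" for t
  have K: "trunc t (exponents \<nu>) = (\<Sum>i\<in>K \<union> {0, j}. count \<nu> i - t)"
     "trunc t (exponents \<rho>) = (\<Sum>i\<in>K \<union> {0, j}. count \<rho> i - t)" for t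
    by (rule trunc_exponents; auto simp: K_def)+
  have split: "(\<Sum>i\<in>K \<union> {0, j}. g i) = g 0 + g j + (\<Sum>i\<in>K - {0, j}. g i)" for g :: "nat \<Rightarrow> nat"
  proof -
    have "K \<union> {0, j} = insert 0 (insert j (K - {0, j}))" by auto
    moreover have "finite K" by (simp add: K_def)
    ultimately show ?thesis using j by simp
  qed
  have \<nu>: "trunc t (exponents \<nu>) = (count \<nu> 0 - t) + (count \<nu> j - t) + S t" for t
    unfolding K split S_def by (intro arg_cong2[of _ _ _ _ "(+)"] sum.cong refl) (auto simp: off)
  have \<rho>: "trunc t (exponents \<rho>) = (count \<rho> 0 - t) + (count \<rho> j - t) + S t" for t
    unfolding K split S_def ..
  have "sum_mset (exponents \<nu>) = sum_mset (exponents \<rho>)"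
    using \<nu>[of 0] \<rho>[of 0] sum by (simp add: trunc_def)
  moreover have "(count \<nu> 0 - t) + (count \<nu> j - t) \<le> (count \<rho> 0 - t) + (count \<rho> j - t)" for t
    using sum le by (auto simp: max_def split: if_splits)
  ultimately show "dle (exponents \<nu>) (exponents \<rho>)"
    unfolding dle_def \<nu> \<rho> by simp
  show "exponents \<nu> \<noteq> exponents \<rho>"
    if lt: "count \<nu> 0 < max (count \<rho> 0) (count \<rho> j)" "count \<nu> j < max (count \<rho> 0) (count \<rho> j)"
  proof
    assume "exponents \<nu> = exponents \<rho>"
    then have "(count \<nu> 0 - t) + (count \<nu> j - t) = (count \<rho> 0 - t) + (count \<rho> j - t)" for t
      using \<nu>[of t] \<rho>[of t] by simp
    from this[of "max (count \<rho> 0) (count \<rho> j) - 1"] show False using lt by (auto simp: max_def split: if_splits)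
  qed
qed

lemma lookup_sum_mon: "finite A \<Longrightarrow> lu (\<Sum>t\<in>A. mon (g t)) \<nu> = real (card {t\<in>A. g t = \<nu>})"
  by (simp add: lookup_sum lookup_mon sum.If_cases) (simp add: Int_def)

lemma ddm_support:
  assumes "j \<noteq> 0" "lu (ddm j \<rho>) \<nu> \<noteq> 0"
  shows "dle (exponents \<nu>) (exponents \<rho>)" "set_mset \<nu> \<subseteq> insert 0 (insert j (set_mset \<rho>))"
proof -
  have "\<exists>x y. \<nu> = put j \<rho> x y \<and> x + y = count \<rho> 0 + count \<rho> j \<and> x \<le> max (count \<rho> 0) (count \<rho> j) \<and> y \<le> max (count \<rho> 0) (count \<rho> j)"
  proof (cases "count \<rho> j \<le> count \<rho> 0")
    case True
    then have "{t\<in>{..<count \<rho> 0 - count \<rho> j}. put j \<rho> (count \<rho> 0 - t) (count \<rho> j + t) = \<nu>} \<noteq> {}"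
      using assms(2) by (auto simp: ddm_def lookup_sum_mon)
    then obtain t where "t < count \<rho> 0 - count \<rho> j" "put j \<rho> (count \<rho> 0 - t) (count \<rho> j + t) = \<nu>" by auto
    then show ?thesis using True by (intro exI[of _ "count \<rho> 0 - t"] exI[of _ "count \<rho> j + t"]) auto
  next
    case False
    then have "{t\<in>{..<count \<rho> j - count \<rho> 0}. put j \<rho> (count \<rho> j - t) (count \<rho> 0 + t) = \<nu>} \<noteq> {}"
      using assms(2) by (auto simp: ddm_def lookup_sum_mon)
    then obtain t where "t < count \<rho> j - count \<rho> 0" "put j \<rho> (count \<rho> j - t) (count \<rho> 0 + t) = \<nu>" by auto
    then show ?thesis using False by (intro exI[of _ "count \<rho> j - t"] exI[of _ "count \<rho> 0 + t"]) auto
  qed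
  then obtain x y where *: "\<nu> = put j \<rho> x y" "x + y = count \<rho> 0 + count \<rho> j"
    "x \<le> max (count \<rho> 0) (count \<rho> j)" "y \<le> max (count \<rho> 0) (count \<rho> j)" by auto
  then show "dle (exponents \<nu>) (exponents \<rho>)"
    using assms(1) by (intro dle_exponents_move[of j]) (simp_all add: count_put)
  show "set_mset \<nu> \<subseteq> insert 0 (insert j (set_mset \<rho>))"
    by (auto simp: *(1) put_def split: if_splits)
qed

text \<open>The summands with t > 0 have both exponents strictly inside the interval from l to m, so
  they are strictly lower in dominance; only t = 0 remains on the level of
  \<open>\<rho>\<close>.\<close>

lemma put_inject_exponents:
  assumes j: "j \<noteq> 0" and lt: "count \<rho> 0 \<noteq> count \<rho> j" and max: "m = max (count \<rho> 0) (count \<rho> j)" and min: "l = min (count \<rho> 0) (count \<rho> j)"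
    and \<nu>: "exponents \<nu> = exponents \<rho>"
  shows "lu (\<Sum>t<m - l. mon (put j \<rho> (m - t) (l + t))) \<nu> = (if put j \<rho> m l = \<nu> then 1 else 0)"
proof -
  have "put j \<rho> (m - t) (l + t) \<noteq> \<nu>" if "t < m - l" "t \<noteq> 0" for t
  proof
    assume "put j \<rho> (m - t) (l + t) = \<nu>"
    then have "exponents (put j \<rho> (m - t) (l + t)) = exponents \<rho>" using \<nu> by simp
    moreover have "exponents (put j \<rho> (m - t) (l + t)) \<noteq> exponents \<rho>"
      using that by (intro dle_exponents_move(2)[OF j]) (auto simp: count_put j max min split: if_splits)
    ultimately show False by simp
  qed
  note * = this
  have "{t\<in>{..<m - l}. put j \<rho> (m - t) (l + t) = \<nu>} = (if put j \<rho> m l = \<nu> then {0} else {})"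
  proof (rule set_eqI)
    fix t show "t \<in> {t\<in>{..<m - l}. put j \<rho> (m - t) (l + t) = \<nu>} \<longleftrightarrow> t \<in> (if put j \<rho> m l = \<nu> then {0} else {})"
    proof (cases "t = 0")
      case True
      have "l < m" using lt by (simp add: max min)
      then show ?thesis using True by simp
    next
      case False
      then show ?thesis using *[of t] by simp
    qed
  qed
  then show ?thesis by (simp add: lookup_sum_mon)
qed

text \<open>The factor x_0 in the divided difference keeps, of the two extreme monomials, only the
  one whose larger exponent sits at x_0. It comes from \<open>\<rho>\<close> with sign + or from the
  exchanged monomial with sign -.\<close>

lemma lookup_ddm_orbit:
  assumes j: "j \<noteq> 0" and \<nu>: "exponents \<nu> = exponents \<rho>"
  shows "lu (ddm j \<rho>) \<nu> = (if count \<nu> j < count \<nu> 0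
    then (if \<rho> = \<nu> then 1 else 0) - (if \<rho> = swm j \<nu> then 1 else 0) else 0)"
proof -
  consider "count \<rho> j = count \<rho> 0" | "count \<rho> j < count \<rho> 0" | "count \<rho> j > count \<rho> 0" by linarith
  then show ?thesis
  proof cases
    case 1
    then show ?thesis by (auto simp: ddm_def count_swm)
  next
    case 2
    then have "lu (ddm j \<rho>) \<nu> = (if \<rho> = \<nu> then 1 else 0)"
      using put_inject_exponents[OF j _ _ _ \<nu>, of "count \<rho> 0" "count \<rho> j"] by (simp add: ddm_def put_id[OF j])
    moreover have "\<rho> = \<nu> \<Longrightarrow> count \<nu> j < count \<nu> 0" "\<rho> = swm j \<nu> \<Longrightarrow> \<not> count \<nu> j < count \<nu> 0"
      using 2 by (simp, auto simp: count_swm)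
    ultimately show ?thesis by auto
  next
    case 3
    then have "lu (ddm j \<rho>) \<nu> = - (if swm j \<rho> = \<nu> then 1 else 0)"
      using put_inject_exponents[OF j _ _ _ \<nu>, of "count \<rho> j" "count \<rho> 0"] by (simp add: ddm_def put_swap[OF j])
    moreover have "\<rho> = swm j \<nu> \<Longrightarrow> count \<nu> j < count \<nu> 0" "\<rho> = \<nu> \<Longrightarrow> \<not> count \<nu> j < count \<nu> 0"
      using 3 by (auto simp: count_swm)
    ultimately show ?thesis by (auto simp: swm_eq_iff)
  qed
qed

lemma ddm_swm: "j \<noteq> 0 \<Longrightarrow> ddm j (swm j \<rho>) = - ddm j \<rho>"
  by (auto simp: ddm_def count_swm put_swm)

text \<open>Positivity of \<open>H 2\<close> on monomial functions rests on this sign, after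
  symmetrisation in x_0 and x_j.\<close>

lemma ddm_sign: "(real (count \<rho> 0) - real (count \<rho> j)) * lu (ddm j \<rho>) \<nu> \<ge> 0"
  by (auto simp: ddm_def lookup_sum_mon intro!: mult_nonneg_nonneg mult_nonpos_nonneg)

lemma ddm_integer: "lu (ddm j \<rho>) \<nu> \<in> \<int>"
  by (auto simp: ddm_def lookup_sum_mon)

lemma lookup_Var_pdiff: "lu (Var i * pdiff i f) \<nu> = real (count \<nu> i) * lu f \<nu>"
proof -
  have "Var i * pdiff i f = lin (\<lambda>\<mu>. Const (real (count \<mu> i)) * mon \<mu>) f"
  proof (rule islin_ext[of "\<lambda>f. Var i * pdiff i f"])
    fix \<mu> show "Var i * pdiff i (mon \<mu>) = lin (\<lambda>\<mu>. Const (real (count \<mu> i)) * mon \<mu>) (mon \<mu>)"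
      by (cases "i \<in># \<mu>") (auto simp: pdiff_mon mult.left_commute[of "Var i"] not_in_iff simp flip: mon_add_mset)
  qed (intro islin_rules)+
  then have "lu (Var i * pdiff i f) \<nu> = (\<Sum>\<mu>\<in>kys f. lu f \<mu> * lu (Const (real (count \<mu> i)) * mon \<mu>) \<nu>)"
    by (simp only: lookup_lin)
  also have "\<dots> = (\<Sum>\<mu>\<in>kys f. if \<mu> = \<nu> then real (count \<nu> i) * lu f \<nu> else 0)"
    by (intro sum.cong refl) (simp add: lookup_Const_mult lookup_mon)
  finally have "lu (Var i * pdiff i f) \<nu> = (\<Sum>\<mu>\<in>kys f. if \<mu> = \<nu> then real (count \<nu> i) * lu f \<nu> else 0)" .
  then show ?thesis by (simp add: in_keys_iff)
qed

lemma sw_in_vars: "i < N \<Longrightarrow> sw i (in_vars N f) = in_vars N f"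
proof -
  assume i: "i < N"
  have "(\<Sum>l<N. Var (tr i l) ^ k) = (\<Sum>l<N. Var l ^ k)" for k
    using i by (intro sum.reindex_bij_witness[of _ "tr i" "tr i"]) (auto simp: tr_def)
  then show ?thesis
    by (simp add: sw_def in_vars_def subst_subst subst_sum subst_power)
qed

section \<open>Dunkl-type operators in finitely many variables and triangularity of H_k\<close>

context jack_parameter
begin

text \<open>
  In \<open>N\<close> variables, with \<open>w = x\<^sub>0\<close>, the operator \<^term>\<open>Z\<close> becomes a differential-difference operator
  of Dunkl type, whose action on leading monomials is explicit.
\<close>

definition Y :: "nat \<Rightarrow> nat mpol \<Rightarrow> nat mpol" where
  "Y N f = Const a * (Var 0 * pdiff 0 f) + (\<Sum>j=1..<N. dd j f) - Const (real N) * f"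

lemma islin_Y [islin_rules]: "islin (Y N)"
  unfolding Y_def by (intro islin_rules)

lemmas [islin_rules] = islin_comp[OF islin_Y]

definition E :: "nat \<Rightarrow> nat mpol \<Rightarrow> nat mpol" where
  "E N = subst (\<lambda>k. if k = 0 then Var 0 else \<Sum>i<N. Var i ^ k)"

lemma islin_E [islin_rules]: "islin (E N)"
  unfolding E_def by (intro islin_rules)

lemmas [islin_rules] = islin_comp[OF islin_E]

lemma E_mult: "E N (f * g) = E N f * E N g"
  by (simp add: E_def subst_mult)

lemma E_Const: "E N (Const c) = Const c"
  by (simp add: E_def)

lemma E_w_power: "E N (Var 0 ^ m) = Var 0 ^ m"
  by (simp add: E_def subst_power)

lemma E_symfuns: "f \<in> symfuns \<Longrightarrow> E N f = in_vars N f"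
  unfolding E_def in_vars_def by (rule subst_cong) (auto simp: symfuns_def is_partition_def)

lemma E_Var: "k \<noteq> 0 \<Longrightarrow> E N (Var k) = (\<Sum>i<N. Var i ^ k)"
  by (simp add: E_def)

lemma pdiff_power_sum:
  assumes "0 < N" "k \<noteq> 0"
  shows "Var 0 * pdiff 0 (\<Sum>i<N. Var i ^ k :: nat mpol) = Const (real k) * Var 0 ^ k"
proof -
  have "Var 0 * pdiff 0 (\<Sum>i<N. Var i ^ k :: nat mpol) = (\<Sum>i<N. if i = 0 then Const (real k) * Var 0 ^ k else 0)"
    unfolding islin_sum[OF islin_pdiff] sum_distrib_left
  proof (intro sum.cong refl)
    fix i
    have "pdiff 0 (Var i ^ k :: nat mpol) = of_nat k * Var i ^ (k - 1) * (if i = 0 then 1 else 0)"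
      by (simp add: pdiff_eq_der der_power)
    moreover have "Var 0 * Var 0 ^ (k - 1) = (Var 0 ^ k :: nat mpol)" using assms(2) by (cases k) auto
    moreover have "Var 0 * (of_nat k * Var 0 ^ (k - 1)) = of_nat k * (Var 0 * Var 0 ^ (k - 1) :: nat mpol)"
      by (rule mult.left_commute)
    ultimately show "Var 0 * pdiff 0 (Var i ^ k) = (if i = 0 then Const (real k) * Var 0 ^ k else (0 :: nat mpol))"
      by (simp add: Const_of_nat)
  qed
  then show ?thesis using assms(1) by simp
qed

text \<open>Chain rule: x_0 d/dx_0 sends the k-th power sum to k x_0^k, which is what
  \<open>Jp\<close> does to p_k up to the factor a.\<close>

lemma E_Jp:
  assumes "0 < N" "f \<in> symfuns"
  shows "E N (Jp f) = Const a * (Var 0 * pdiff 0 (E N f))"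
proof (rule islin_ext_on[of "\<lambda>f. E N (Jp f)" "\<lambda>f. Const a * (Var 0 * pdiff 0 (E N f))"])
  fix \<mu> assume "\<mu> \<in> kys f"
  then have "0 \<notin># \<mu>" using assms(2) by (auto simp: symfuns_def is_partition_def)
  then show "E N (Jp (mon \<mu>)) = Const a * (Var 0 * pdiff 0 (E N (mon \<mu>)))"
  proof (induction \<mu>)
    case empty
    then show ?case by (simp add: Jp_def E_def subst_0 pdiff_eq_der)
  next
    case (add k \<mu>)
    then have k: "k \<noteq> 0" by auto
    have "E N (Jp (mon (add_mset k \<mu>))) = E N (Var k) * E N (Jp (mon \<mu>)) + Const (a * real k) * (Var 0 ^ k * E N (mon \<mu>))"
      using k by (simp add: mon_add_mset Jp_Var islin_add[OF islin_E] E_Const E_mult E_w_power)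
    also have "Const (a * real k) * (Var 0 ^ k * E N (mon \<mu>)) = Const a * (Var 0 * pdiff 0 (E N (Var k)) * E N (mon \<mu>))"
      using pdiff_power_sum[OF assms(1) k] k by (simp add: E_Var Const_mult mult_ac)
    finally show ?case using add by (simp add: mon_add_mset E_mult pdiff_mult algebra_simps)
  qed
qed (intro islin_rules)+

text \<open>Summed over j, the divided differences of x_0^m are the sum over t < m of x_0^(m-t) (p_t
  - x_0^t). The term with p_0 = N is cancelled by the last summand of \<open>Y\<close>, the terms
  with t > 0 form \<open>Pm\<close>, and the m subtracted copies of x_0^m change the coefficient a
  of w d/dw into a - 1.\<close>

lemma E_Z_w_power:
  assumes N: "0 < N" and f: "f \<in> symfuns"
  shows "E N (Z (Var 0 ^ Suc m * f)) = Y N (E N (Var 0 ^ Suc m * f))"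
proof -
  let ?x = "Var 0 :: nat mpol" and ?m = "Suc m"
  define g where "g = E N f"
  have sg: "sw j g = g" if "j < N" for j using that f by (simp add: g_def E_symfuns sw_in_vars)
  define p where "p t = (\<Sum>i<N. Var i ^ t :: nat mpol)" for t
  have Pm: "E N (Pm (?x ^ ?m * f)) = (\<Sum>t=1..<?m. ?x ^ (?m - t) * p t) * g"
    unfolding Pm_w_power[OF f] islin_sum[OF islin_E] sum_distrib_right
    by (intro sum.cong refl) (simp add: E_mult E_w_power E_Var p_def g_def mult.assoc)
  have 1: "E N (Z (?x ^ ?m * f)) = Const a * (?x ^ ?m * (?x * pdiff 0 g)) + (\<Sum>t=1..<?m. ?x ^ (?m - t) * p t) * g
      + Const ((a - 1) * real ?m) * (?x ^ ?m * g)"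
    unfolding Z_def th_w_power[OF f] Jp_w_power islin_add[OF islin_E] Pm E_mult E_Const E_w_power E_Jp[OF N f]
    by (simp add: g_def Const_mult mult_ac)
  have dd: "(\<Sum>j=1..<N. dd j (?x ^ ?m * g)) = (\<Sum>j=1..<N. \<Sum>t<?m. ?x ^ (?m - t) * Var j ^ t) * g"
    unfolding sum_distrib_right by (intro sum.cong refl) (simp add: dd_mult_symmetric sg dd_power sum_distrib_right del: power_Suc sum.lessThan_Suc)
  have "(\<Sum>j=1..<N. \<Sum>t<?m. ?x ^ (?m - t) * Var j ^ t) = (\<Sum>t<?m. ?x ^ (?m - t) * (\<Sum>j=1..<N. Var j ^ t))"
    by (subst sum.swap) (simp add: sum_distrib_left)
  also have "\<dots> = (\<Sum>t<?m. ?x ^ (?m - t) * p t - ?x ^ ?m)"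
  proof (intro sum.cong refl)
    fix t assume t: "t \<in> {..<?m}"
    have "p t = ?x ^ t + (\<Sum>j=1..<N. Var j ^ t)"
      using N unfolding p_def lessThan_atLeast0 by (simp add: sum.atLeast_Suc_lessThan)
    moreover have "?x ^ (?m - t) * ?x ^ t = ?x ^ ?m" using t by (simp flip: power_add)
    ultimately show "?x ^ (?m - t) * (\<Sum>j=1..<N. Var j ^ t) = ?x ^ (?m - t) * p t - ?x ^ ?m"
      by (simp add: distrib_left)
  qed
  also have "\<dots> = (\<Sum>t<?m. ?x ^ (?m - t) * p t) - Const (real ?m) * ?x ^ ?m"
    by (simp add: sum_subtractf Const_of_nat del: power_Suc of_nat_Suc)
  also have "(\<Sum>t<?m. ?x ^ (?m - t) * p t) = Const (real N) * ?x ^ ?m + (\<Sum>t=1..<?m. ?x ^ (?m - t) * p t)"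
  proof -
    have "p 0 = Const (real N)" by (simp add: p_def Const_of_nat)
    then show ?thesis unfolding lessThan_atLeast0 by (subst sum.atLeast_Suc_lessThan) (simp_all add: mult.commute)
  qed
  finally have dd2: "(\<Sum>j=1..<N. \<Sum>t<?m. ?x ^ (?m - t) * Var j ^ t) =
      Const (real N) * ?x ^ ?m + (\<Sum>t=1..<?m. ?x ^ (?m - t) * p t) - Const (real ?m) * ?x ^ ?m" .
  have pd: "?x * pdiff 0 (?x ^ ?m * g) = Const (real ?m) * (?x ^ ?m * g) + ?x ^ ?m * (?x * pdiff 0 g)"
  proof -
    have "pdiff 0 (?x ^ ?m) = Const (real ?m) * ?x ^ m"
      unfolding pdiff_eq_der der_power by (simp add: Const_of_nat del: of_nat_Suc)
    then show ?thesis unfolding pdiff_mult by (simp add: algebra_simps)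
  qed
  have 2: "E N (?x ^ ?m * f) = ?x ^ ?m * g" by (simp only: E_mult E_w_power g_def)
  show ?thesis
    unfolding 1 2 Y_def dd dd2 pd
    by (simp add: Const_mult Const_diff algebra_simps del: power_Suc of_nat_Suc)
qed

lemma E_Z:
  assumes "0 < N" "G \<in> Wp"
  shows "E N (Z G) = Y N (E N G)"
proof -
  obtain G' where G: "G = Var 0 * G'" using assms(2) by (auto simp: Wp_def)
  have "E N (Z (Var 0 * G')) = Y N (E N (Var 0 * G'))"
  proof (rule W_ext[of "\<lambda>G'. E N (Z (Var 0 * G'))" "\<lambda>G'. Y N (E N (Var 0 * G'))"])
    fix m f assume "(f :: nat mpol) \<in> symfuns"
    from E_Z_w_power[OF assms(1) this, of m]
    show "E N (Z (Var 0 * (Var 0 ^ m * f))) = Y N (E N (Var 0 * (Var 0 ^ m * f)))"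
      by (simp add: mult.assoc)
  qed (intro islin_rules)+
  then show ?thesis by (simp add: G)
qed

text \<open>Replacing w^m by p_m means summing over the N variables that can play the role of
  w.\<close>

lemma in_vars_pr:
  assumes "0 < N" "G \<in> Wp"
  shows "in_vars N (pr G) = (\<Sum>i<N. sw i (E N G))"
proof -
  obtain G' where G: "G = Var 0 * G'" using assms(2) by (auto simp: Wp_def)
  have "in_vars N (pr (Var 0 * G')) = (\<Sum>i<N. sw i (E N (Var 0 * G')))"
  proof (rule W_ext[of "\<lambda>G'. in_vars N (pr (Var 0 * G'))" "\<lambda>G'. \<Sum>i<N. sw i (E N (Var 0 * G'))"])
    fix m f assume f: "(f :: nat mpol) \<in> symfuns"
    have "in_vars N (pr (Var 0 ^ Suc m * f)) = (\<Sum>i<N. Var i ^ Suc m * in_vars N f)"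
      unfolding pr_w_power[OF f] by (simp add: in_vars_mult in_vars_Var sum_distrib_right)
    also have "\<dots> = (\<Sum>i<N. sw i (E N (Var 0 ^ Suc m * f)))"
    proof (intro sum.cong refl)
      fix i assume "i \<in> {..<N}"
      moreover have "sw i (Var 0 ^ Suc m) = Var i ^ Suc m" by (simp add: sw_def subst_power subst_mult)
      ultimately show "Var i ^ Suc m * in_vars N f = sw i (E N (Var 0 ^ Suc m * f))"
        unfolding E_mult E_w_power sw_mult by (simp add: sw_in_vars E_symfuns[OF f])
    qed
    finally show "in_vars N (pr (Var 0 * (Var 0 ^ m * f))) = (\<Sum>i<N. sw i (E N (Var 0 * (Var 0 ^ m * f))))"
      by (simp add: mult.assoc)
  qed (intro islin_rules)+
  then show ?thesis by (simp add: G)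
qed

lemma in_vars_H:
  assumes "0 < N" "f \<in> symfuns"
  shows "in_vars N (H (Suc k) f) = (\<Sum>i<N. sw i ((Y N ^^ k) (Const a * (Var 0 * pdiff 0 (in_vars N f)))))"
proof -
  have "(Z ^^ k) (Jp f) \<in> Wp \<and> E N ((Z ^^ k) (Jp f)) = (Y N ^^ k) (Const a * (Var 0 * pdiff 0 (in_vars N f)))"
    by (induction k) (simp_all add: E_Jp assms E_symfuns Jp_in_Wp Z_in_Wp E_Z)
  moreover have "(Z ^^ Suc k) f = (Z ^^ k) (Jp f)"
    using assms by (simp add: Z_symfuns funpow_swap1)
  ultimately show ?thesis unfolding H_def by (simp add: in_vars_pr assms(1))
qed

text \<open>
  The leading part of \<open>f\<close> in dominance order consists of the monomials with exponents \<open>\<kappa>\<close>, and the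
  coefficient of such a monomial depends only on the exponent of \<open>x\<^sub>0\<close>.
\<close>

definition LD :: "nat \<Rightarrow> nat multiset \<Rightarrow> (nat \<Rightarrow> real) \<Rightarrow> nat mpol \<Rightarrow> bool" where
  "LD N \<kappa> y f \<longleftrightarrow>
    (\<forall>\<nu>. lu f \<nu> \<noteq> 0 \<longrightarrow> set_mset \<nu> \<subseteq> {..<N} \<and> dle (exponents \<nu>) \<kappa>) \<and>
    (\<forall>\<nu>. set_mset \<nu> \<subseteq> {..<N} \<longrightarrow> exponents \<nu> = \<kappa> \<longrightarrow> lu f \<nu> = y (count \<nu> 0))"

text \<open>The effect of \<open>Y\<close> on leading coefficients, as functions of the exponent c
  of x_0. Each variable with exponent x contributes y(c) - y(min x c); the N copies of y(c) cancel
  the last summand of \<open>Y\<close>, so the number of variables drops out.\<close>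

definition ystep :: "nat multiset \<Rightarrow> (nat \<Rightarrow> real) \<Rightarrow> nat \<Rightarrow> real" where
  "ystep \<kappa> y c = a * real c * y c - (\<Sum>x\<in>#\<kappa>. y (min x c))"

lemma dd_leading:
  assumes N: "0 < j" "j < N" and LD: "LD N \<kappa> y f"
  shows "lu (dd j f) \<nu> \<noteq> 0 \<Longrightarrow> set_mset \<nu> \<subseteq> {..<N} \<and> dle (exponents \<nu>) \<kappa>"
    and "set_mset \<nu> \<subseteq> {..<N} \<Longrightarrow> exponents \<nu> = \<kappa> \<Longrightarrow>
      lu (dd j f) \<nu> = (if count \<nu> j < count \<nu> 0 then y (count \<nu> 0) - y (count \<nu> j) else 0)"
proof -
  have j: "j \<noteq> 0" using N by simp
  have dd: "lu (dd j f) \<nu> = (\<Sum>\<rho>\<in>kys f. lu f \<rho> * lu (ddm j \<rho>) \<nu>)"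
    by (simp add: dd_def lookup_lin)
  {
    assume "lu (dd j f) \<nu> \<noteq> 0"
    then have "(\<Sum>\<rho>\<in>kys f. lu f \<rho> * lu (ddm j \<rho>) \<nu>) \<noteq> 0" unfolding dd .
    from sum.not_neutral_contains_not_neutral[OF this]
    obtain \<rho> where "\<rho> \<in> kys f" and n0: "lu (ddm j \<rho>) \<nu> \<noteq> 0" by auto
    then have "set_mset \<rho> \<subseteq> {..<N}" "dle (exponents \<rho>) \<kappa>" using LD by (auto simp: LD_def in_keys_iff)
    then show "set_mset \<nu> \<subseteq> {..<N} \<and> dle (exponents \<nu>) \<kappa>"
      using ddm_support[OF j n0] N dle_trans by auto
  }
  assume \<nu>: "set_mset \<nu> \<subseteq> {..<N}" "exponents \<nu> = \<kappa>"
  have "lu f \<rho> * lu (ddm j \<rho>) \<nu> = (if count \<nu> j < count \<nu> 0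
    then (if \<rho> = \<nu> then lu f \<nu> else 0) - (if \<rho> = swm j \<nu> then lu f (swm j \<nu>) else 0) else 0)" if "\<rho> \<in> kys f" for \<rho>
  proof (cases "exponents \<rho> = \<kappa>")
    case True
    then show ?thesis using lookup_ddm_orbit[OF j, of \<nu> \<rho>] \<nu> by auto
  next
    case False
    then have "\<rho> \<noteq> \<nu>" "\<rho> \<noteq> swm j \<nu>" using \<nu> by auto
    moreover have "lu (ddm j \<rho>) \<nu> = 0"
    proof (rule ccontr)
      assume "lu (ddm j \<rho>) \<nu> \<noteq> 0"
      then have "dle \<kappa> (exponents \<rho>)" using ddm_support(1)[OF j] \<nu> by auto
      moreover have "dle (exponents \<rho>) \<kappa>" using LD that by (auto simp: LD_def in_keys_iff)
      ultimately have "\<kappa> = exponents \<rho>" using \<nu>(2) by (intro dle_antisym) auto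
      then show False using False by simp
    qed
    ultimately show ?thesis by simp
  qed
  then have "lu (dd j f) \<nu> = (if count \<nu> j < count \<nu> 0 then lu f \<nu> - lu f (swm j \<nu>) else 0)"
    unfolding dd by (auto simp: sum_subtractf in_keys_iff)
  moreover have "lu f \<nu> = y (count \<nu> 0)" using LD \<nu> by (auto simp: LD_def)
  moreover have "lu f (swm j \<nu>) = y (count \<nu> j)"
    using LD \<nu> N by (auto simp: LD_def count_swm set_swm_subset)
  ultimately show "lu (dd j f) \<nu> = (if count \<nu> j < count \<nu> 0 then y (count \<nu> 0) - y (count \<nu> j) else 0)" by simp
qed

lemma LD_Y:
  assumes N: "0 < N" and LD: "LD N \<kappa> y f" and y0: "y 0 = 0"
  shows "LD N \<kappa> (ystep \<kappa> y) (Y N f)"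
proof -
  have Y: "lu (Y N f) \<nu> = a * real (count \<nu> 0) * lu f \<nu> + (\<Sum>j=1..<N. lu (dd j f) \<nu>) - real N * lu f \<nu>" for \<nu>
    by (simp add: Y_def lookup_add lookup_minus lookup_Const_mult lookup_Var_pdiff lookup_sum)
  have "set_mset \<nu> \<subseteq> {..<N} \<and> dle (exponents \<nu>) \<kappa>" if "lu (Y N f) \<nu> \<noteq> 0" for \<nu>
  proof (cases "lu f \<nu> = 0")
    case True
    then have "(\<Sum>j=1..<N. lu (dd j f) \<nu>) \<noteq> 0" using that unfolding Y by simp
    from sum.not_neutral_contains_not_neutral[OF this]
    obtain j where "j \<in> {1..<N}" "lu (dd j f) \<nu> \<noteq> 0" .
    then show ?thesis using dd_leading(1)[OF _ _ LD, of j \<nu>] by auto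
  qed (use LD in \<open>auto simp: LD_def\<close>)
  moreover have "lu (Y N f) \<nu> = ystep \<kappa> y (count \<nu> 0)" if \<nu>: "set_mset \<nu> \<subseteq> {..<N}" "exponents \<nu> = \<kappa>" for \<nu>
  proof -
    let ?c = "count \<nu> 0"
    have f: "lu f \<nu> = y ?c" using LD \<nu> by (auto simp: LD_def)
    have "(\<Sum>j=1..<N. lu (dd j f) \<nu>) = (\<Sum>j=1..<N. if count \<nu> j < ?c then y ?c - y (count \<nu> j) else 0)"
      using dd_leading(2)[OF _ _ LD _ \<nu>(2)] \<nu>(1) by (intro sum.cong) auto
    also have "\<dots> = (\<Sum>j=1..<N. y ?c - y (min (count \<nu> j) ?c))"
      by (intro sum.cong) (auto simp: min_def)
    also have "\<dots> = (\<Sum>j<N. y ?c - y (min (count \<nu> j) ?c))"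
      using N unfolding lessThan_atLeast0 by (simp add: sum.atLeast_Suc_lessThan)
    also have "\<dots> = real N * y ?c - (\<Sum>j<N. y (min (count \<nu> j) ?c))"
      by (simp add: sum_subtractf)
    \<comment> \<open>Variables absent from the monomial contribute y 0 = 0, so only the parts of
      \<open>\<kappa>\<close> remain.\<close>
    also have "(\<Sum>j<N. y (min (count \<nu> j) ?c)) = (\<Sum>x\<in>#\<kappa>. y (min x ?c))"
      unfolding \<nu>(2)[symmetric] sum_mset_exponents using \<nu>(1) y0
      by (intro sum.mono_neutral_right) (auto simp: not_in_iff)
    finally show ?thesis unfolding Y f ystep_def by simp
  qed
  ultimately show ?thesis unfolding LD_def by blast
qed

definition yk :: "nat multiset \<Rightarrow> nat \<Rightarrow> nat \<Rightarrow> real" where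
  "yk \<kappa> k = (ystep \<kappa> ^^ k) (\<lambda>c. a * real c)"

lemma yk_0 [simp]: "yk \<kappa> k 0 = 0"
proof (induction k)
  case (Suc k)
  have "(\<Sum>x\<in>#\<kappa>. yk \<kappa> k (min x 0)) = 0" using Suc by simp
  then show ?case by (simp add: yk_def ystep_def)
qed (simp add: yk_def)

lemma ystep_scale: "ystep \<kappa> (\<lambda>c. s * y c) = (\<lambda>c. s * ystep \<kappa> y c)"
  by (simp add: ystep_def fun_eq_iff algebra_simps sum_mset_distrib_left)

text \<open>The diagonal entry of \<open>H k\<close> at the monomial function of
  \<open>\<kappa>\<close>, later its eigenvalue on the Jack polynomial. The sum over parts comes
  from the symmetrisation over the variables in \<open>in_vars_H\<close>.\<close>

definition h :: "nat \<Rightarrow> nat multiset \<Rightarrow> real" where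
  "h k \<kappa> = (case k of 0 \<Rightarrow> 0 | Suc k \<Rightarrow> \<Sum>x\<in>#\<kappa>. yk \<kappa> k x)"

text \<open>\<open>Y\<close> and x_0 d/dx_0 never raise exponents in dominance, and on the top level
  they act through \<open>ystep\<close>; symmetrising over the variables preserves both
  facts.\<close>

lemma H_triangular:
  assumes f: "f \<in> symfuns" and supp: "\<And>\<mu>. 0 \<notin># \<mu> \<Longrightarrow> mcoeff f \<mu> \<noteq> 0 \<Longrightarrow> dle \<mu> \<kappa>" and \<kappa>: "0 \<notin># \<kappa>"
  shows "0 \<notin># \<mu> \<Longrightarrow> mcoeff (H k f) \<mu> \<noteq> 0 \<Longrightarrow> dle \<mu> \<kappa>"
    and "mcoeff (H k f) \<kappa> = h k \<kappa> * mcoeff f \<kappa>"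
proof -
  have main: "(mcoeff (H k f) \<mu> \<noteq> 0 \<longrightarrow> dle \<mu> \<kappa>) \<and> (\<mu> = \<kappa> \<longrightarrow> mcoeff (H k f) \<kappa> = h k \<kappa> * mcoeff f \<kappa>)"
    if \<mu>: "0 \<notin># \<mu>" for \<mu>
  proof (cases k)
    case 0
    then show ?thesis using f by (simp add: H_0 h_def)
  next
    case (Suc l)
    \<comment> \<open>One variable more than \<open>\<mu>\<close> has parts, so that x_0 exists also
      for the empty partition.\<close>
    define N where "N = Suc (size \<mu>)"
    have N: "0 < N" by (simp add: N_def)
    let ?s = "mcoeff f \<kappa>"
    let ?g = "(Y N ^^ l) (Const a * (Var 0 * pdiff 0 (in_vars N f)))"
    have "LD N \<kappa> (\<lambda>c. ?s * (a * real c)) (Const a * (Var 0 * pdiff 0 (in_vars N f)))"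
      unfolding LD_def lookup_Const_mult lookup_Var_pdiff lookup_in_vars[OF f]
      using supp by (auto split: if_splits)
    then have "LD N \<kappa> (\<lambda>c. ?s * yk \<kappa> l c) ?g"
    proof (induction l)
      case (Suc l)
      have "LD N \<kappa> (ystep \<kappa> (\<lambda>c. ?s * yk \<kappa> l c)) (Y N ((Y N ^^ l) (Const a * (Var 0 * pdiff 0 (in_vars N f)))))"
        by (rule LD_Y[OF N Suc.IH[OF Suc.prems]]) simp
      then show ?case unfolding ystep_scale by (simp add: yk_def)
    qed (simp add: yk_def)
    then have g1: "\<And>\<nu>. lu ?g \<nu> \<noteq> 0 \<Longrightarrow> set_mset \<nu> \<subseteq> {..<N} \<and> dle (exponents \<nu>) \<kappa>"
      and g2: "\<And>\<nu>. set_mset \<nu> \<subseteq> {..<N} \<Longrightarrow> exponents \<nu> = \<kappa> \<Longrightarrow> lu ?g \<nu> = ?s * yk \<kappa> l (count \<nu> 0)"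
      by (auto simp: LD_def)
    have sub: "set_mset (std \<mu>) \<subseteq> {..<N}" using std(2)[OF \<mu>] by (auto simp: N_def)
    then have mc: "mcoeff (H k f) \<mu> = (\<Sum>i<N. lu ?g (swm i (std \<mu>)))"
      using lookup_in_vars[of "H (Suc l) f" N "std \<mu>"] std(1)[OF \<mu>]
      by (simp add: Suc in_vars_H[OF N f] lookup_sum lookup_sw)
    have "dle \<mu> \<kappa>" if nz: "mcoeff (H k f) \<mu> \<noteq> 0"
    proof -
      from sum.not_neutral_contains_not_neutral[OF nz[unfolded mc]]
      obtain i where "lu ?g (swm i (std \<mu>)) \<noteq> 0" .
      from g1[OF this] show ?thesis using std(1)[OF \<mu>] by simp
    qed
    moreover have "mcoeff (H k f) \<kappa> = h k \<kappa> * mcoeff f \<kappa>" if [simp]: "\<mu> = \<kappa>"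
    proof -
      have "mcoeff (H k f) \<kappa> = (\<Sum>i<N. ?s * yk \<kappa> l (count (std \<mu>) i))"
        unfolding mc[simplified] using sub std(1)[OF \<mu>]
        by (intro sum.cong) (auto simp: g2 set_swm_subset[OF N] count_swm)
      also have "\<dots> = (\<Sum>i\<in>set_mset (std \<mu>). ?s * yk \<kappa> l (count (std \<mu>) i))"
        using sub by (intro sum.mono_neutral_right) (auto simp: not_in_iff)
      also have "\<dots> = (\<Sum>x\<in>#\<kappa>. ?s * yk \<kappa> l x)"
        using sum_mset_exponents[of "\<lambda>x. ?s * yk \<kappa> l x" "std \<mu>"] std(1)[OF \<mu>] by simp
      finally show ?thesis by (simp add: h_def Suc sum_mset_distrib_left mult.commute)
    qed
    ultimately show ?thesis by blast
  qed
  show "0 \<notin># \<mu> \<Longrightarrow> mcoeff (H k f) \<mu> \<noteq> 0 \<Longrightarrow> dle \<mu> \<kappa>" "mcoeff (H k f) \<kappa> = h k \<kappa> * mcoeff f \<kappa>"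
    using main[of \<mu>] main[OF \<kappa>] by blast+
qed

text \<open>The divided difference changes sign when x_0 and x_j are exchanged. Averaging over the
  exchange replaces the exponent of x_0 by half the difference of the two exponents, whose sign
  agrees with that of the divided difference. This gives at once the nonnegativity and, through the
  integer c, membership in Q(b).\<close>

lemma H2_msym:
  assumes \<kappa>: "0 \<notin># \<kappa>" and \<mu>: "0 \<notin># \<mu>" and neq: "\<mu> \<noteq> \<kappa>"
  shows "\<exists>c. c \<in> \<int> \<and> 2 * mcoeff (H 2 (msym \<kappa>)) \<mu> = a * c \<and> c \<ge> 0"
proof -
  define N where "N = Suc (size \<mu>)"
  have N: "0 < N" by (simp add: N_def)
  note f = msym_in_symfuns[OF \<kappa>]
  define g where "g = Const a * (Var 0 * pdiff 0 (in_vars N (msym \<kappa>)))"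
  define Orb where "Orb = {\<rho>. set_mset \<rho> \<subseteq> {..<N} \<and> exponents \<rho> = \<kappa>}"
  have finO: "finite Orb" unfolding Orb_def
    by (rule finite_subset[OF _ finite_multisets_bounded[of "{..<N}" "sum_mset \<kappa>"]]) (auto simp: sum_exponents)
  have lg: "lu g \<rho> = (if \<rho> \<in> Orb then a * real (count \<rho> 0) else 0)" for \<rho>
    unfolding g_def lookup_Const_mult lookup_Var_pdiff lookup_in_vars[OF f] by (simp add: msym(2)[OF \<kappa>] \<kappa> Orb_def)
  define c where "c j \<nu> = (\<Sum>\<rho>\<in>Orb. (real (count \<rho> 0) - real (count \<rho> j)) * lu (ddm j \<rho>) \<nu>)" for j \<nu>
  have dd: "2 * lu (dd j g) \<nu> = a * c j \<nu>" if j: "j \<in> {1..<N}" for j \<nu>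
  proof -
    have j0: "j \<noteq> 0" using j by simp
    have "lu (dd j g) \<nu> = (\<Sum>\<rho>\<in>kys g. lu g \<rho> * lu (ddm j \<rho>) \<nu>)" by (simp add: dd_def lookup_lin)
    also have "\<dots> = (\<Sum>\<rho>\<in>Orb. a * real (count \<rho> 0) * lu (ddm j \<rho>) \<nu>)"
      using finO by (intro sum.mono_neutral_cong_left) (auto simp: in_keys_iff lg count_eq_zero_iff split: if_splits)
    finally have 1: "lu (dd j g) \<nu> = (\<Sum>\<rho>\<in>Orb. a * real (count \<rho> 0) * lu (ddm j \<rho>) \<nu>)" .
    also have "\<dots> = (\<Sum>\<rho>\<in>Orb. - (a * real (count \<rho> j) * lu (ddm j \<rho>) \<nu>))"
      using j N by (intro sum.reindex_bij_witness[of _ "swm j" "swm j"])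
        (auto simp: Orb_def set_swm_subset count_swm ddm_swm)
    finally have 2: "lu (dd j g) \<nu> = (\<Sum>\<rho>\<in>Orb. - (a * real (count \<rho> j) * lu (ddm j \<rho>) \<nu>))" .
    have "2 * lu (dd j g) \<nu> = lu (dd j g) \<nu> + lu (dd j g) \<nu>" by simp
    also have "\<dots> = (\<Sum>\<rho>\<in>Orb. a * ((real (count \<rho> 0) - real (count \<rho> j)) * lu (ddm j \<rho>) \<nu>))"
      by (subst 1, subst 2) (simp add: algebra_simps flip: sum.distrib)
    finally show ?thesis by (simp add: c_def sum_distrib_left)
  qed
  have c_int: "c j \<nu> \<in> \<int>" and c_nonneg: "c j \<nu> \<ge> 0" for j \<nu>
    unfolding c_def by (auto intro!: sum_nonneg Ints_sum Ints_mult Ints_diff ddm_integer ddm_sign simp: Ints_of_nat)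
  have sub: "set_mset (std \<mu>) \<subseteq> {..<N}" using std(2)[OF \<mu>] by (auto simp: N_def)
  have Y: "lu (Y N g) \<nu> = (\<Sum>j=1..<N. lu (dd j g) \<nu>)" if "exponents \<nu> = \<mu>" for \<nu>
    using that neq lg[of \<nu>] by (simp add: Y_def lookup_add lookup_minus lookup_Const_mult lookup_Var_pdiff lookup_sum Orb_def)
  have "mcoeff (H 2 (msym \<kappa>)) \<mu> = (\<Sum>i<N. lu (Y N g) (swm i (std \<mu>)))"
    using lookup_in_vars[of "H 2 (msym \<kappa>)" N "std \<mu>"] std(1)[OF \<mu>] sub
    by (simp add: in_vars_H[OF N f] lookup_sum lookup_sw numeral_2_eq_2 g_def)
  also have "\<dots> = (\<Sum>i<N. \<Sum>j=1..<N. lu (dd j g) (swm i (std \<mu>)))"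
    by (intro sum.cong Y) (simp_all add: std(1)[OF \<mu>])
  finally have "2 * mcoeff (H 2 (msym \<kappa>)) \<mu> = (\<Sum>i<N. \<Sum>j=1..<N. 2 * lu (dd j g) (swm i (std \<mu>)))"
    by (simp add: sum_distrib_left)
  also have "\<dots> = (\<Sum>i<N. \<Sum>j=1..<N. a * c j (swm i (std \<mu>)))"
    using dd by (intro sum.cong) auto
  also have "\<dots> = a * (\<Sum>i<N. \<Sum>j=1..<N. c j (swm i (std \<mu>)))"
    by (simp add: sum_distrib_left)
  finally show ?thesis
    by (intro exI[of _ "\<Sum>i<N. \<Sum>j=1..<N. c j (swm i (std \<mu>))"])
      (auto intro!: sum_nonneg Ints_sum c_int c_nonneg)
qed

lemma h_1: "h 1 \<kappa> = a * real (sum_mset \<kappa>)"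
  by (simp add: h_def yk_def sum_mset_distrib_left)

lemma h_2: "h 2 \<kappa> = a\<^sup>2 * real (sqs \<kappa>) - a * real (\<Sum>x\<in>#\<kappa>. \<Sum>y\<in>#\<kappa>. min y x)"
proof -
  have "ystep \<kappa> (\<lambda>c. a * real c) = (\<lambda>x. a\<^sup>2 * real (x * x) - a * real (\<Sum>y\<in>#\<kappa>. min y x))"
    by (rule ext) (simp add: ystep_def power2_eq_square sum_mset_distrib_left image_mset.compositionality comp_def)
  then have "h 2 \<kappa> = (\<Sum>x\<in>#\<kappa>. a\<^sup>2 * real (x * x) - a * real (\<Sum>y\<in>#\<kappa>. min y x))"
    by (simp add: h_def yk_def numeral_2_eq_2 del: of_nat_sum_mset)
  also have "\<dots> = a\<^sup>2 * real (sqs \<kappa>) - a * real (\<Sum>x\<in>#\<kappa>. \<Sum>y\<in>#\<kappa>. min y x)"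
  proof -
    have "(\<Sum>x\<in>#M. A * real (x * x) - a * real (\<Sum>y\<in>#\<kappa>. min y x)) =
        A * real (sqs M) - a * real (\<Sum>x\<in>#M. \<Sum>y\<in>#\<kappa>. min y x)" for M A
      by (induction M) (simp_all add: sqs_def algebra_simps del: of_nat_sum_mset)
    then show ?thesis .
  qed
  finally show ?thesis .
qed

end

section \<open>The field of coefficients\<close>

lemma rat_poly_mult:
  assumes "\<forall>i. coeff f i \<in> \<rat>" "\<forall>i. coeff g i \<in> \<rat>"
  shows "\<forall>i. coeff (f * g) i \<in> (\<rat> :: real set)"
proof
  fix i
  have "(\<Sum>j\<in>A. coeff f j * coeff g (i - j)) \<in> \<rat>" for A
    using assms by (induction A rule: infinite_finite_induct) auto
  then show "coeff (f * g) i \<in> \<rat>" by (simp add: coeff_mult)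
qed

lemma rat_adjoinI:
  "(\<forall>i. coeff f i \<in> \<rat>) \<Longrightarrow> (\<forall>i. coeff g i \<in> \<rat>) \<Longrightarrow> poly g b \<noteq> 0 \<Longrightarrow> poly f b / poly g b \<in> rat_adjoin b"
  unfolding rat_adjoin_def by blast

lemma rat_adjoinE:
  assumes "x \<in> rat_adjoin b"
  obtains f g where "x = poly f b / poly g b" "\<forall>i. coeff f i \<in> \<rat>" "\<forall>i. coeff g i \<in> \<rat>" "poly g b \<noteq> 0"
  using assms unfolding rat_adjoin_def by blast

lemma rat_adjoin_Rats: "x \<in> \<rat> \<Longrightarrow> x \<in> rat_adjoin b"
  using rat_adjoinI[of "[:x:]" "[:1:]" b] by (auto simp: coeff_pCons split: nat.splits)

lemma rat_adjoin_generator: "b \<in> rat_adjoin b"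
  using rat_adjoinI[of "[:0, 1:]" "[:1:]" b] by (auto simp: coeff_pCons split: nat.splits)

lemma rat_adjoin_add: "x \<in> rat_adjoin b \<Longrightarrow> y \<in> rat_adjoin b \<Longrightarrow> x + y \<in> rat_adjoin b"
proof -
  assume "x \<in> rat_adjoin b" "y \<in> rat_adjoin b"
  then obtain f g f' g' where *: "x = poly f b / poly g b" "\<forall>i. coeff f i \<in> \<rat>" "\<forall>i. coeff g i \<in> \<rat>" "poly g b \<noteq> 0"
    "y = poly f' b / poly g' b" "\<forall>i. coeff f' i \<in> \<rat>" "\<forall>i. coeff g' i \<in> \<rat>" "poly g' b \<noteq> 0"
    by (metis rat_adjoinE)
  have "x + y = poly (f * g' + f' * g) b / poly (g * g') b"
    unfolding *(1,5) add_frac_eq[OF *(4,8)] by simp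
  also have "\<dots> \<in> rat_adjoin b"
    using * rat_poly_mult[of f g'] rat_poly_mult[of f' g] rat_poly_mult[of g g']
    by (intro rat_adjoinI) auto
  finally show ?thesis .
qed

lemma rat_adjoin_mult: "x \<in> rat_adjoin b \<Longrightarrow> y \<in> rat_adjoin b \<Longrightarrow> x * y \<in> rat_adjoin b"
proof -
  assume "x \<in> rat_adjoin b" "y \<in> rat_adjoin b"
  then obtain f g f' g' where *: "x = poly f b / poly g b" "\<forall>i. coeff f i \<in> \<rat>" "\<forall>i. coeff g i \<in> \<rat>" "poly g b \<noteq> 0"
    "y = poly f' b / poly g' b" "\<forall>i. coeff f' i \<in> \<rat>" "\<forall>i. coeff g' i \<in> \<rat>" "poly g' b \<noteq> 0"
    by (metis rat_adjoinE)
  then have "x * y = poly (f * f') b / poly (g * g') b" by simp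
  also have "\<dots> \<in> rat_adjoin b"
    using * rat_poly_mult[of f f'] rat_poly_mult[of g g'] by (intro rat_adjoinI) auto
  finally show ?thesis .
qed

lemma rat_adjoin_inverse: "x \<in> rat_adjoin b \<Longrightarrow> inverse x \<in> rat_adjoin b"
proof (cases "x = 0")
  case False
  assume "x \<in> rat_adjoin b"
  then obtain f g where *: "x = poly f b / poly g b" "\<forall>i. coeff f i \<in> \<rat>" "\<forall>i. coeff g i \<in> \<rat>" "poly g b \<noteq> 0"
    by (metis rat_adjoinE)
  then have "inverse x = poly g b / poly f b" "poly f b \<noteq> 0" using False by auto
  then show ?thesis using * rat_adjoinI[of g f b] by simp
qed (simp add: rat_adjoin_Rats)

lemma rat_adjoin_divide: "x \<in> rat_adjoin b \<Longrightarrow> y \<in> rat_adjoin b \<Longrightarrow> x / y \<in> rat_adjoin b"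
  by (simp add: divide_inverse rat_adjoin_mult rat_adjoin_inverse)

lemma rat_adjoin_diff: "x \<in> rat_adjoin b \<Longrightarrow> y \<in> rat_adjoin b \<Longrightarrow> x - y \<in> rat_adjoin b"
  using rat_adjoin_add[of x b "-1 * y"] rat_adjoin_mult[of "-1" b y] rat_adjoin_Rats[of "-1" b] by auto

lemma rat_adjoin_sum: "(\<And>x. x \<in> A \<Longrightarrow> f x \<in> rat_adjoin b) \<Longrightarrow> sum f A \<in> rat_adjoin b"
  by (induction A rule: infinite_finite_induct) (auto simp: rat_adjoin_Rats intro: rat_adjoin_add)

section \<open>Eigenvectors\<close>

lemma sum_min: "(\<Sum>y\<in>#\<mu>. min y x) + trunc x \<mu> = sum_mset \<mu>"
  unfolding trunc_def by (induction \<mu>) auto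

text \<open>By \<open>sum_min\<close> the inner sum is n - trunc x and hence decreases in dominance;
  this is applied to each of the two arguments of min in turn.\<close>

lemma sum_min_antimono:
  assumes "dle \<mu> \<kappa>"
  shows "(\<Sum>x\<in>#\<kappa>. \<Sum>y\<in>#\<kappa>. min y x) \<le> (\<Sum>x\<in>#\<mu>. \<Sum>y\<in>#\<mu>. min y x)"
proof -
  have le: "(\<Sum>y\<in>#\<kappa>. min y x) \<le> (\<Sum>y\<in>#\<mu>. min y x)" for x
  proof -
    have "sum_mset \<mu> = sum_mset \<kappa>" "trunc x \<mu> \<le> trunc x \<kappa>" using assms by (auto simp: dle_def)
    then show ?thesis using sum_min[of x \<mu>] sum_min[of x \<kappa>] by linarith
  qed
  have "(\<Sum>x\<in>#\<kappa>. \<Sum>y\<in>#\<kappa>. min y x) \<le> (\<Sum>x\<in>#\<kappa>. \<Sum>y\<in>#\<mu>. min y x)"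
    by (rule sum_mset_mono) (rule le)
  also have "\<dots> = (\<Sum>y\<in>#\<mu>. \<Sum>x\<in>#\<kappa>. min x y)"
    by (subst sum_mset.swap) (simp add: min.commute)
  also have "\<dots> \<le> (\<Sum>y\<in>#\<mu>. \<Sum>x\<in>#\<mu>. min x y)"
    by (rule sum_mset_mono) (rule le)
  finally show ?thesis .
qed

section \<open>Triangular eigenvectors with nonnegative coefficients in Q(b)\<close>

context jack_parameter
begin

text \<open>For positive a the two terms of \<open>h_2\<close> move in the same direction along
  dominance. The differences are the denominators of the back substitution.\<close>

lemma h_2_less:
  assumes "dle \<mu> \<kappa>" "\<mu> \<noteq> \<kappa>" "0 \<notin># \<mu>" "0 \<notin># \<kappa>"
  shows "h 2 \<mu> < h 2 \<kappa>"
proof -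
  have "a\<^sup>2 * real (sqs \<mu>) < a\<^sup>2 * real (sqs \<kappa>)" using sqs_less[OF assms] a_pos by simp
  moreover have "a * real (\<Sum>x\<in>#\<kappa>. \<Sum>y\<in>#\<kappa>. min y x) \<le> a * real (\<Sum>x\<in>#\<mu>. \<Sum>y\<in>#\<mu>. min y x)"
    using sum_min_antimono[OF assms(1)] a_pos by (intro mult_left_mono of_nat_mono) auto
  ultimately show ?thesis unfolding h_2 by linarith
qed

definition md :: "nat multiset \<Rightarrow> nat multiset \<Rightarrow> real" where
  "md \<nu> \<mu> = mcoeff (H 2 (msym \<nu>)) \<mu>"

lemma md_diag: "0 \<notin># \<nu> \<Longrightarrow> md \<nu> \<nu> = h 2 \<nu>"
  unfolding md_def by (subst H_triangular(2)) (auto simp: msym msym_in_symfuns split: if_splits)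

lemma md_triangular: "0 \<notin># \<nu> \<Longrightarrow> 0 \<notin># \<mu> \<Longrightarrow> md \<nu> \<mu> \<noteq> 0 \<Longrightarrow> dle \<mu> \<nu>"
  unfolding md_def by (erule (1) H_triangular(1)[rotated 3, OF _ _ _ _]) (auto simp: msym msym_in_symfuns split: if_splits)

lemma md_nonneg: "0 \<notin># \<nu> \<Longrightarrow> 0 \<notin># \<mu> \<Longrightarrow> \<mu> \<noteq> \<nu> \<Longrightarrow> md \<nu> \<mu> \<ge> 0"
  using H2_msym[of \<nu> \<mu>] a_pos unfolding md_def by (metis less_imp_le mult_nonneg_nonneg zero_le_mult_iff zero_less_numeral not_less)

lemma a_in_rat_adjoin: "a \<in> rat_adjoin (a - 1)"
  using rat_adjoin_add[OF rat_adjoin_generator[of "a - 1"] rat_adjoin_Rats[of 1 "a - 1"]] by simp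

lemma md_rat_adjoin: "0 \<notin># \<nu> \<Longrightarrow> 0 \<notin># \<mu> \<Longrightarrow> \<mu> \<noteq> \<nu> \<Longrightarrow> md \<nu> \<mu> \<in> rat_adjoin (a - 1)"
proof -
  assume "0 \<notin># \<nu>" "0 \<notin># \<mu>" "\<mu> \<noteq> \<nu>"
  then obtain c where c: "c \<in> \<int>" "2 * md \<nu> \<mu> = a * c" using H2_msym[of \<nu> \<mu>] by (auto simp: md_def)
  then have eq: "md \<nu> \<mu> = a * (c / 2)" by simp
  have "c / 2 \<in> \<rat>" using c(1) Ints_subset_Rats by auto
  then show ?thesis unfolding eq by (intro rat_adjoin_mult a_in_rat_adjoin rat_adjoin_Rats)
qed

lemma h_2_rat_adjoin: "h 2 \<mu> \<in> rat_adjoin (a - 1)"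
  unfolding h_2 power2_eq_square
  by (intro rat_adjoin_diff rat_adjoin_mult a_in_rat_adjoin) (auto intro!: rat_adjoin_Rats Rats_of_nat simp del: of_nat_sum_mset)

text \<open>
  Back substitution for the eigenvector of the triangular operator \<^term>\<open>H 2\<close> with leading term
  \<open>m\<^sub>\<kappa>\<close>; the sum of the squares of the parts refines the dominance order and serves as recursion measure.
\<close>

function cc :: "nat multiset \<Rightarrow> nat multiset \<Rightarrow> real" where
  "cc \<kappa> \<mu> = (if \<mu> = \<kappa> then 1 else if 0 \<notin># \<mu> \<and> dle \<mu> \<kappa> then
     (\<Sum>\<nu> | \<nu> \<in> partitions (sum_mset \<kappa>) \<and> sqs \<mu> < sqs \<nu> \<and> sqs \<nu> \<le> sqs \<kappa>. cc \<kappa> \<nu> * md \<nu> \<mu>) / (h 2 \<kappa> - h 2 \<mu>)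
     else 0)"
  by auto
termination by (relation "measure (\<lambda>(\<kappa>, \<mu>). sqs \<kappa> - sqs \<mu>)") auto

declare cc.simps [simp del]

lemma cc_diag [simp]: "cc \<kappa> \<kappa> = 1"
  by (simp add: cc.simps)

lemma cc_nonzero: "0 \<notin># \<kappa> \<Longrightarrow> cc \<kappa> \<mu> \<noteq> 0 \<Longrightarrow> 0 \<notin># \<mu> \<and> dle \<mu> \<kappa>"
  by (subst (asm) cc.simps) (auto split: if_splits)

text \<open>Off-diagonal entries of \<open>H 2\<close> are nonnegative and the denominators
  positive, so no sign can appear. Nonnegativity is used in \<open>tcoef_nonzero\<close>, membership
  in Q(b) in the characterisation of Jack polynomials.\<close>

lemma cc_properties: "0 \<notin># \<kappa> \<Longrightarrow> cc \<kappa> \<mu> \<ge> 0 \<and> cc \<kappa> \<mu> \<in> rat_adjoin (a - 1)"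
proof (induction \<kappa> \<mu> rule: cc.induct)
  case (1 \<kappa> \<mu>)
  show ?case
  proof (cases "\<mu> \<noteq> \<kappa> \<and> 0 \<notin># \<mu> \<and> dle \<mu> \<kappa>")
    case True
    let ?S = "{\<nu>. \<nu> \<in> partitions (sum_mset \<kappa>) \<and> sqs \<mu> < sqs \<nu> \<and> sqs \<nu> \<le> sqs \<kappa>}"
    have eq: "cc \<kappa> \<mu> = (\<Sum>\<nu>\<in>?S. cc \<kappa> \<nu> * md \<nu> \<mu>) / (h 2 \<kappa> - h 2 \<mu>)"
      using True by (subst cc.simps) simp
    have IH: "cc \<kappa> \<nu> \<ge> 0 \<and> cc \<kappa> \<nu> \<in> rat_adjoin (a - 1)" "md \<nu> \<mu> \<ge> 0 \<and> md \<nu> \<mu> \<in> rat_adjoin (a - 1)"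
      if "\<nu> \<in> ?S" for \<nu>
      using that 1 True md_nonneg[of \<nu> \<mu>] md_rat_adjoin[of \<nu> \<mu>] by (auto simp: partitions_iff)
    have "h 2 \<kappa> - h 2 \<mu> > 0" using h_2_less[of \<mu> \<kappa>] True 1(2) by simp
    then have "cc \<kappa> \<mu> \<ge> 0" unfolding eq using IH by (intro divide_nonneg_pos sum_nonneg mult_nonneg_nonneg) auto
    moreover have "cc \<kappa> \<mu> \<in> rat_adjoin (a - 1)"
      unfolding eq using IH by (intro rat_adjoin_divide rat_adjoin_sum rat_adjoin_mult rat_adjoin_diff h_2_rat_adjoin) auto
    ultimately show ?thesis by simp
  next
    case False
    then show ?thesis by (subst (1 2) cc.simps) (auto simp: rat_adjoin_Rats)
  qed
qed

definition P :: "nat multiset \<Rightarrow> nat mpol" where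
  "P \<kappa> = (\<Sum>\<mu>\<in>partitions (sum_mset \<kappa>). Const (cc \<kappa> \<mu>) * msym \<mu>)"

lemma keys_msym_sum: "kys (\<Sum>\<mu>\<in>partitions n. Const (c \<mu>) * msym \<mu>) \<subseteq> partitions n"
proof (rule order_trans[OF keys_sum_subset], rule UN_least)
  fix \<mu> assume "\<mu> \<in> partitions n"
  then show "kys (Const (c \<mu>) * msym \<mu>) \<subseteq> partitions n"
    using msym(1)[of \<mu>] keys_Const_mult[of "c \<mu>" "msym \<mu>"] by (auto simp: partitions_iff)
qed

lemma keys_P: "kys (P \<kappa>) \<subseteq> partitions (sum_mset \<kappa>)"
  unfolding P_def by (rule keys_msym_sum)

lemma P_in_symfuns [simp]: "P \<kappa> \<in> symfuns"
  using keys_P[of \<kappa>] by (auto simp: symfuns_def partitions_def)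

lemma mcoeff_msym_sum:
  assumes "0 \<notin># \<mu>"
  shows "mcoeff (\<Sum>\<nu>\<in>partitions n. Const (c \<nu>) * msym \<nu>) \<mu> = (if \<mu> \<in> partitions n then c \<mu> else 0)"
proof -
  have "mcoeff (\<Sum>\<nu>\<in>partitions n. Const (c \<nu>) * msym \<nu>) \<mu> = (\<Sum>\<nu>\<in>partitions n. if \<nu> = \<mu> then c \<nu> else 0)"
    unfolding mcoeff_sum mcoeff_Const by (intro sum.cong refl) (auto simp: msym(2) assms partitions_iff)
  then show ?thesis by simp
qed

lemma mcoeff_P:
  assumes "0 \<notin># \<kappa>" "0 \<notin># \<mu>"
  shows "mcoeff (P \<kappa>) \<mu> = cc \<kappa> \<mu>"
  unfolding P_def mcoeff_msym_sum[OF assms(2)]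
  using cc_nonzero[OF assms(1), of \<mu>] by (auto simp: partitions_iff assms dle_def)

lemma mcoeff_H2_sum:
  "mcoeff (H 2 (\<Sum>\<nu>\<in>S. Const (c \<nu>) * msym \<nu>)) \<mu> = (\<Sum>\<nu>\<in>S. c \<nu> * md \<nu> \<mu>)"
  by (simp add: islin_sum[OF islin_H] islin_Const[OF islin_H] mcoeff_sum mcoeff_Const md_def)

text \<open>At each \<open>\<mu>\<close> below \<open>\<kappa>\<close> the eigenvalue equation is
  the recursion for \<open>cc\<close>. The recursion ranges over all partitions between them by sum
  of squares; those outside the dominance interval contribute 0.\<close>

lemma H2_P:
  assumes \<kappa>: "0 \<notin># \<kappa>"
  shows "H 2 (P \<kappa>) = Const (h 2 \<kappa>) * P \<kappa>"
proof (rule mcoeff_inject)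
  fix \<mu> :: "nat multiset" assume \<mu>: "0 \<notin># \<mu>"
  let ?S = "partitions (sum_mset \<kappa>)"
  have nz: "dle \<mu> \<nu> \<and> dle \<nu> \<kappa>" if "\<nu> \<in> ?S" "cc \<kappa> \<nu> * md \<nu> \<mu> \<noteq> 0" for \<nu>
    using that cc_nonzero[OF \<kappa>, of \<nu>] md_triangular[of \<nu> \<mu>] \<mu> by (auto simp: partitions_iff)
  have sum: "mcoeff (H 2 (P \<kappa>)) \<mu> = (\<Sum>\<nu>\<in>?S. cc \<kappa> \<nu> * md \<nu> \<mu>)"
    unfolding P_def by (rule mcoeff_H2_sum)
  have "(\<Sum>\<nu>\<in>?S. cc \<kappa> \<nu> * md \<nu> \<mu>) = h 2 \<kappa> * cc \<kappa> \<mu>"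
  proof (cases "dle \<mu> \<kappa>")
    case False
    then have "cc \<kappa> \<mu> = 0" using cc_nonzero[OF \<kappa>] by blast
    moreover have "cc \<kappa> \<nu> * md \<nu> \<mu> = 0" if "\<nu> \<in> ?S" for \<nu>
      using nz[OF that] False dle_trans by blast
    then have "(\<Sum>\<nu>\<in>?S. cc \<kappa> \<nu> * md \<nu> \<mu>) = 0" by (rule sum.neutral[OF ballI])
    ultimately show ?thesis by simp
  next
    case True
    then have \<mu>S: "\<mu> \<in> ?S" using \<mu> by (simp add: partitions_iff dle_def)
    have "(\<Sum>\<nu>\<in>?S. cc \<kappa> \<nu> * md \<nu> \<mu>) = cc \<kappa> \<mu> * h 2 \<mu> + (\<Sum>\<nu>\<in>?S - {\<mu>}. cc \<kappa> \<nu> * md \<nu> \<mu>)"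
      using \<mu>S \<mu> by (simp add: sum.remove md_diag)
    also have "(\<Sum>\<nu>\<in>?S - {\<mu>}. cc \<kappa> \<nu> * md \<nu> \<mu>) = (h 2 \<kappa> - h 2 \<mu>) * cc \<kappa> \<mu>"
    proof (cases "\<mu> = \<kappa>")
      case True
      have "cc \<kappa> \<nu> * md \<nu> \<mu> = 0" if "\<nu> \<in> ?S - {\<mu>}" for \<nu>
        using nz[of \<nu>] that True dle_antisym[of \<nu> \<kappa>] \<kappa> by (auto simp: partitions_iff)
      then have "(\<Sum>\<nu>\<in>?S - {\<mu>}. cc \<kappa> \<nu> * md \<nu> \<mu>) = 0" by (rule sum.neutral[OF ballI])
      then show ?thesis using True by simp
    next
      case False
      let ?T = "{\<nu>. \<nu> \<in> ?S \<and> sqs \<mu> < sqs \<nu> \<and> sqs \<nu> \<le> sqs \<kappa>}"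
      have "sqs \<mu> < sqs \<nu> \<and> sqs \<nu> \<le> sqs \<kappa>" if "\<nu> \<in> ?S - {\<mu>}" "cc \<kappa> \<nu> * md \<nu> \<mu> \<noteq> 0" for \<nu>
        using nz[of \<nu>] that sqs_less[of \<mu> \<nu>] sqs_less[of \<nu> \<kappa>] \<kappa> \<mu> by (cases "\<nu> = \<kappa>") (auto simp: partitions_iff less_imp_le)
      then have "(\<Sum>\<nu>\<in>?S - {\<mu>}. cc \<kappa> \<nu> * md \<nu> \<mu>) = (\<Sum>\<nu>\<in>?T. cc \<kappa> \<nu> * md \<nu> \<mu>)"
        by (intro sum.mono_neutral_right) auto
      moreover have "cc \<kappa> \<mu> = (\<Sum>\<nu>\<in>?T. cc \<kappa> \<nu> * md \<nu> \<mu>) / (h 2 \<kappa> - h 2 \<mu>)"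
        using False True \<mu> by (subst cc.simps) simp
      moreover have "h 2 \<mu> < h 2 \<kappa>" using h_2_less[OF True False \<mu> \<kappa>] .
      ultimately show ?thesis by simp
    qed
    finally show ?thesis by (simp add: algebra_simps)
  qed
  then show "mcoeff (H 2 (P \<kappa>)) \<mu> = mcoeff (Const (h 2 \<kappa>) * P \<kappa>) \<mu>"
    by (simp add: sum mcoeff_Const mcoeff_P \<kappa> \<mu>)
qed auto

lemma H1_mon: "0 \<notin># \<nu> \<Longrightarrow> H 1 (mon \<nu>) = Const (a * real (sum_mset \<nu>)) * mon \<nu>"
proof (induction \<nu>)
  case empty
  then show ?case by (simp add: H_def Z_symfuns Jp_def pr_0)
next
  case (add k \<nu>)
  then have k: "k \<noteq> 0" and s: "mon \<nu> \<in> symfuns" by (auto simp: symfuns_mon_iff)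
  have *: "H 1 f = pr (Jp f)" if "f \<in> symfuns" for f using that by (simp add: H_def Z_symfuns)
  have "H 1 (mon (add_mset k \<nu>)) = Var k * H 1 (mon \<nu>) + Const (a * real k) * (Var k * mon \<nu>)"
    using k s by (subst (1 2) *) (auto simp: mon_add_mset Jp_Var pr_add pr_Const pr_Var pr_w_power)
  then show ?case using add
    by (simp add: mon_add_mset Const_add distrib_left del: of_nat_sum_mset) (simp add: algebra_simps)
qed

lemma H1_homogeneous: "kys f \<subseteq> partitions n \<Longrightarrow> H 1 f = Const (a * real n) * f"
  by (rule islin_ext_on[of "H 1"], rule islin_H, intro islin_rules)
    (auto simp: H1_mon partitions_iff simp del: of_nat_sum_mset One_nat_def)

lemma symfuns_homogeneous: "kys f \<subseteq> partitions n \<Longrightarrow> f \<in> symfuns"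
  by (auto simp: symfuns_def partitions_def)

text \<open>Equals 2 a times the sum of the \<alpha>-contents of \<open>\<kappa>\<close>.\<close>

definition kap :: "nat multiset \<Rightarrow> real" where
  "kap \<kappa> = h 2 \<kappa> - (a - 1) * h 1 \<kappa>"

lemma B_P: "0 \<notin># \<kappa> \<Longrightarrow> B (P \<kappa>) = Const (kap \<kappa>) * P \<kappa>"
  unfolding B_def H2_P H1_homogeneous[OF keys_P] kap_def h_1
  by (simp only: Const_diff Const_mult left_diff_distrib mult.assoc)

text \<open>B commutes with \<open>H k\<close>, so the defect g is an eigenvector of
  \<open>H 2\<close> with the eigenvalue of \<open>\<kappa>\<close>, although all its terms lie
  strictly below \<open>\<kappa>\<close>. At a term \<open>\<mu>\<close> with maximal sum of squares
  the eigenvalue would have to be that of \<open>\<mu>\<close>, which is smaller.\<close>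

lemma H_P:
  assumes \<kappa>: "0 \<notin># \<kappa>"
  shows "H k (P \<kappa>) = Const (h k \<kappa>) * P \<kappa>"
proof (rule ccontr)
  define n where "n = sum_mset \<kappa>"
  define g where "g = H k (P \<kappa>) - Const (h k \<kappa>) * P \<kappa>"
  assume "H k (P \<kappa>) \<noteq> Const (h k \<kappa>) * P \<kappa>"
  then have "g \<noteq> 0" by (simp add: g_def)
  have g: "g \<in> symfuns" unfolding g_def by (intro symfuns_diff symfuns_Const_mult H_in_symfuns P_in_symfuns)
  have supp: "dle \<mu> \<kappa>" if "0 \<notin># \<mu>" "mcoeff (P \<kappa>) \<mu> \<noteq> 0" for \<mu>
    using that cc_nonzero[OF \<kappa>] mcoeff_P[OF \<kappa>] by auto
  have g_supp: "dle \<mu> \<kappa>" if "0 \<notin># \<mu>" "mcoeff g \<mu> \<noteq> 0" for \<mu>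
  proof (cases "mcoeff (P \<kappa>) \<mu> = 0")
    case True
    then have "mcoeff (H k (P \<kappa>)) \<mu> \<noteq> 0" using that(2) by (simp add: g_def mcoeff_diff mcoeff_Const)
    then show ?thesis using H_triangular(1)[OF P_in_symfuns supp \<kappa> that(1)] by blast
  qed (use supp that in blast)
  have g_\<kappa>: "mcoeff g \<kappa> = 0"
    using H_triangular(2)[OF P_in_symfuns supp \<kappa>, where k = k] by (simp add: g_def mcoeff_diff mcoeff_Const)
  define S where "S = {\<mu>\<in>partitions n. mcoeff g \<mu> \<noteq> 0}"
  have "S \<noteq> {}"
  proof
    assume "S = {}"
    then have "mcoeff g \<mu> = 0" if "0 \<notin># \<mu>" for \<mu>
      using g_supp[OF that] that by (auto simp: S_def partitions_iff n_def dle_def)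
    then show False using mcoeff_inject_0[OF g] \<open>g \<noteq> 0\<close> by blast
  qed
  moreover have "finite S" by (simp add: S_def)
  ultimately obtain \<mu> where \<mu>S: "\<mu> \<in> S" and max: "\<And>\<nu>. \<nu> \<in> S \<Longrightarrow> sqs \<nu> \<le> sqs \<mu>"
    using Max_in[of "sqs ` S"] Max_ge[of "sqs ` S"] by fastforce
  have \<mu>: "0 \<notin># \<mu>" "mcoeff g \<mu> \<noteq> 0" using \<mu>S by (auto simp: S_def partitions_iff)
  have g_eq: "g = (\<Sum>\<nu>\<in>partitions n. Const (mcoeff g \<nu>) * msym \<nu>)"
    using g_supp by (intro msym_expand[OF g]) (auto simp: partitions_iff n_def dle_def)
  have "mcoeff (H 2 g) \<mu> = (\<Sum>\<nu>\<in>partitions n. mcoeff g \<nu> * md \<nu> \<mu>)"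
    by (subst g_eq) (rule mcoeff_H2_sum)
  also have "\<dots> = (\<Sum>\<nu>\<in>partitions n. if \<nu> = \<mu> then mcoeff g \<mu> * h 2 \<mu> else 0)"
  proof (intro sum.cong refl)
    fix \<nu> assume \<nu>: "\<nu> \<in> partitions n"
    show "mcoeff g \<nu> * md \<nu> \<mu> = (if \<nu> = \<mu> then mcoeff g \<mu> * h 2 \<mu> else 0)"
    proof (cases "\<nu> = \<mu>")
      case False
      have "mcoeff g \<nu> = 0 \<or> md \<nu> \<mu> = 0"
        using md_triangular[of \<nu> \<mu>] sqs_less[of \<mu> \<nu>] max[of \<nu>] \<mu> \<nu> False by (fastforce simp: S_def partitions_iff)
      then show ?thesis using False by auto
    qed (simp add: md_diag \<mu>)
  qed
  also have "\<dots> = mcoeff g \<mu> * h 2 \<mu>" using \<mu>S by (simp add: S_def)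
  finally have 1: "mcoeff (H 2 g) \<mu> = mcoeff g \<mu> * h 2 \<mu>" .
  have kg: "kys g \<subseteq> partitions n" by (subst g_eq) (rule keys_msym_sum)
  have "B g = Const (kap \<kappa>) * g"
    unfolding g_def islin_diff[OF islin_B] islin_Const[OF islin_B] B_H[OF P_in_symfuns] B_P[OF \<kappa>] islin_Const[OF islin_H]
    by (simp add: algebra_simps)
  then have "H 2 g - Const (a - 1) * (Const (a * real n) * g) = Const (h 2 \<kappa>) * g - Const (a - 1) * (Const (a * real n) * g)"
    unfolding B_def H1_homogeneous[OF kg] kap_def h_1 n_def
    by (simp only: Const_diff Const_mult left_diff_distrib mult.assoc)
  then have "H 2 g = Const (h 2 \<kappa>) * g" by simp
  then have "mcoeff g \<mu> * h 2 \<mu> = h 2 \<kappa> * mcoeff g \<mu>" using 1 by (simp only: mcoeff_Const)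
  moreover have "h 2 \<mu> < h 2 \<kappa>" using h_2_less[OF g_supp[OF \<mu>] _ \<mu>(1) \<kappa>] \<mu> g_\<kappa> by blast
  ultimately show False using \<mu>(2) by simp
qed

section \<open>Eigenvalues and contents\<close>

text \<open>The c-th part of the conjugate partition.\<close>

definition col :: "nat multiset \<Rightarrow> nat \<Rightarrow> nat" where
  "col \<kappa> c = size (filter_mset (\<lambda>t. c \<le> t) \<kappa>)"

lemma col_Suc: "col \<kappa> c = col \<kappa> (Suc c) + count \<kappa> c"
  unfolding col_def by (induction \<kappa>) auto

lemma col_antimono: "c \<le> c' \<Longrightarrow> col \<kappa> c' \<le> col \<kappa> c"
  unfolding col_def by (induction \<kappa>) auto

lemma col_eq_0: "sum_mset \<kappa> < c \<Longrightarrow> col \<kappa> c = 0"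
  using member_le_sum_mset by (fastforce simp: col_def)

definition L :: "real \<Rightarrow> real fps" where
  "L v = 1 - fps_const v * fps_X"

lemma L_0 [simp]: "L 0 = 1" by (simp add: L_def)

lemma L_nonzero [simp]: "L v \<noteq> 0"
proof
  assume "L v = 0"
  then have "fps_nth (L v) 0 = 0" by simp
  then show False by (simp add: L_def)
qed

text \<open>One minus the first-return series, that is, the reciprocal of the generating series of
  the vacuum moments of the full Lax operator. It factorises completely.\<close>

definition eta :: "nat multiset \<Rightarrow> real fps" where
  "eta \<kappa> = Abs_fps (\<lambda>k. case k of 0 \<Rightarrow> 1 | Suc k \<Rightarrow> - h k \<kappa>)"

definition yf :: "nat multiset \<Rightarrow> nat \<Rightarrow> real fps" where
  "yf \<kappa> c = Abs_fps (\<lambda>k. yk \<kappa> k c)"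

lemma fps_nth_sum_mset: "fps_nth (\<Sum>x\<in>#M. f x) k = (\<Sum>x\<in>#M. fps_nth (f x) k)"
  by (induction M) auto

lemma yf_rec: "yf \<kappa> c = fps_const (a * real c) + fps_X * (fps_const (a * real c) * yf \<kappa> c - (\<Sum>t\<in>#\<kappa>. yf \<kappa> (min t c)))"
proof (rule fps_ext)
  fix k show "fps_nth (yf \<kappa> c) k = fps_nth (fps_const (a * real c) + fps_X * (fps_const (a * real c) * yf \<kappa> c - (\<Sum>t\<in>#\<kappa>. yf \<kappa> (min t c)))) k"
    by (cases k) (simp_all add: yf_def yk_def ystep_def fps_nth_sum_mset)
qed

lemma eta_yf: "eta \<kappa> = 1 - fps_X * (fps_X * (\<Sum>t\<in>#\<kappa>. yf \<kappa> t))"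
proof (rule fps_ext)
  fix k show "fps_nth (eta \<kappa>) k = fps_nth (1 - fps_X * (fps_X * (\<Sum>t\<in>#\<kappa>. yf \<kappa> t))) k"
    by (auto simp: eta_def yf_def h_def fps_nth_sum_mset split: nat.splits)
qed

text \<open>All l parts of size at least c see the same value y in the recursion, which is therefore
  linear in y with factor 1 - (A - l) X; multiplying by this factor eliminates y.\<close>

lemma eta_columns_step:
  fixes q s y X A l m :: "'b :: comm_ring_1"
  assumes "q = 1 - X * (X * s)" "y = A + X * (A * y - (s + l * y))" "l = l' + m"
  shows "(q - X * (X * (m * y)) + l' * X) * (1 - (A - l) * X) = (q + l * X) * (1 - (A - l') * X)"
proof -
  have y: "y * (1 - (A - l) * X) = A - X * s" using assms(2) by (simp add: algebra_simps)
  have "(q - X * (X * (m * y)) + l' * X) * (1 - (A - l) * X)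
      = (q + l' * X) * (1 - (A - l) * X) - X * (X * (m * (y * (1 - (A - l) * X))))"
    by (simp add: algebra_simps)
  also have "\<dots> = (q + l * X) * (1 - (A - l') * X)"
    unfolding y unfolding assms(1,3) by (simp add: algebra_simps)
  finally show ?thesis .
qed

text \<open>\<open>q c\<close> keeps only the parts smaller than c and interpolates between 1 and
  \<open>eta \<kappa>\<close>; passing from c to c + 1 exchanges one linear factor.\<close>

lemma eta_columns:
  assumes \<kappa>: "0 \<notin># \<kappa>" and n: "sum_mset \<kappa> \<le> n"
  shows "eta \<kappa> * (\<Prod>c=1..n. L (a * real c - real (col \<kappa> c))) =
    L (- real (col \<kappa> 1)) * (\<Prod>c=1..n. L (a * real c - real (col \<kappa> (Suc c))))"
proof -
  define q where "q c = 1 - fps_X * (fps_X * (\<Sum>t\<in>#filter_mset (\<lambda>t. t < c) \<kappa>. yf \<kappa> t))" for c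
  have step: "(q (Suc c) + of_nat (col \<kappa> (Suc c)) * fps_X) * L (a * real c - real (col \<kappa> c)) =
     (q c + of_nat (col \<kappa> c) * fps_X) * L (a * real c - real (col \<kappa> (Suc c)))" for c
  proof -
    let ?s = "\<Sum>t\<in>#filter_mset (\<lambda>t. t < c) \<kappa>. yf \<kappa> t"
    have "(\<Sum>t\<in>#M. yf \<kappa> (min t c)) = (\<Sum>t\<in>#filter_mset (\<lambda>t. t < c) M. yf \<kappa> t) + of_nat (col M c) * yf \<kappa> c" for M
      unfolding col_def by (induction M) (auto simp: min_def algebra_simps)
    then have y: "yf \<kappa> c = fps_const (a * real c) + fps_X * (fps_const (a * real c) * yf \<kappa> c - (?s + of_nat (col \<kappa> c) * yf \<kappa> c))"
      by (subst yf_rec) simp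
    have "(\<Sum>t\<in>#filter_mset (\<lambda>t. t < Suc c) M. yf \<kappa> t) = (\<Sum>t\<in>#filter_mset (\<lambda>t. t < c) M. yf \<kappa> t) + of_nat (count M c) * yf \<kappa> c" for M
      by (induction M) (auto simp: algebra_simps less_Suc_eq)
    then have q: "q (Suc c) = q c - fps_X * (fps_X * (of_nat (count \<kappa> c) * yf \<kappa> c))"
      by (simp add: q_def algebra_simps)
    have LL: "L (a * real c - real k) = 1 - (fps_const (a * real c) - of_nat k) * fps_X" for k
      by (simp add: L_def fps_of_nat flip: fps_const_sub)
    show ?thesis unfolding q LL
      by (rule eta_columns_step[OF _ y]) (simp_all add: q_def col_Suc[of \<kappa> c])
  qed
  have "(q (Suc m) + of_nat (col \<kappa> (Suc m)) * fps_X) * (\<Prod>c=1..m. L (a * real c - real (col \<kappa> c))) =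
    L (- real (col \<kappa> 1)) * (\<Prod>c=1..m. L (a * real c - real (col \<kappa> (Suc c))))" for m
  proof (induction m)
    case 0
    have "filter_mset (\<lambda>t. t < Suc 0) \<kappa> = {#}" using \<kappa> by (intro multiset_eqI) (auto simp: count_eq_zero_iff)
    then have "q (Suc 0) = 1" unfolding q_def by (simp only: image_mset_empty sum_mset.empty mult_zero_right diff_zero)
    then show ?case by (simp add: L_def fps_of_nat flip: fps_const_neg)
  next
    case (Suc m)
    let ?Q = "\<lambda>m. q (Suc m) + of_nat (col \<kappa> (Suc m)) * fps_X"
    let ?L = "L (a * real (Suc m) - real (col \<kappa> (Suc m)))" and ?L' = "L (a * real (Suc m) - real (col \<kappa> (Suc (Suc m))))"
    let ?P = "\<Prod>c=1..m. L (a * real c - real (col \<kappa> c))" and ?P' = "\<Prod>c=1..m. L (a * real c - real (col \<kappa> (Suc c)))"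
    have "?Q (Suc m) * (?P * ?L) = (?Q (Suc m) * ?L) * ?P" by (simp only: mult_ac)
    also have "\<dots> = ?L' * (?Q m * ?P)" unfolding step by (simp only: mult_ac)
    also have "\<dots> = L (- real (col \<kappa> 1)) * (?P' * ?L')" unfolding Suc by (simp only: mult_ac)
    finally show ?case by simp
  qed
  from this[of n] show ?thesis
  proof -
    assume *: "(q (Suc n) + of_nat (col \<kappa> (Suc n)) * fps_X) * (\<Prod>c=1..n. L (a * real c - real (col \<kappa> c))) =
      L (- real (col \<kappa> 1)) * (\<Prod>c=1..n. L (a * real c - real (col \<kappa> (Suc c))))"
    have "filter_mset (\<lambda>t. t < Suc n) \<kappa> = \<kappa>"
      using member_le_sum_mset[of _ \<kappa>] n by (intro multiset_eqI) (fastforce simp: not_in_iff)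
    then have "q (Suc n) = eta \<kappa>" by (simp add: q_def eta_yf)
    moreover have "col \<kappa> (Suc n) = 0" using n by (intro col_eq_0) simp
    ultimately show ?thesis using * by simp
  qed
qed

text \<open>The box in row \<open>i + 1\<close> and column \<open>c\<close> has \<open>\<alpha>\<close>-content \<open>\<alpha> (c - 1) - i\<close>.\<close>

definition colcont :: "nat \<Rightarrow> nat \<Rightarrow> real multiset" where
  "colcont c l = image_mset (\<lambda>i. a * (real c - 1) - real i) (mset_set {..<l})"

definition cont :: "nat multiset \<Rightarrow> real multiset" where
  "cont \<kappa> = (\<Sum>c=1..sum_mset \<kappa>. colcont c (col \<kappa> c))"

text \<open>Numerator of the factors that the boxes contribute to \<open>eta\<close>: a box of
  content v contributes (1 - (v+a)X)(1 - (v-1)X) divided by (1 - vX)(1 - (v+a-1)X). Quotients are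
  kept in cross-multiplied form.\<close>

definition Num :: "real multiset \<Rightarrow> real fps" where
  "Num M = (\<Prod>v\<in>#M. L (v + a) * L (v - 1))"

definition Den :: "real multiset \<Rightarrow> real fps" where
  "Den M = (\<Prod>v\<in>#M. L v * L (v + a - 1))"

lemma Num_empty [simp]: "Num {#} = 1" and Den_empty [simp]: "Den {#} = 1"
  by (simp_all add: Num_def Den_def)

lemma Num_add: "Num (M + M') = Num M * Num M'" and Den_add: "Den (M + M') = Den M * Den M'"
  by (simp_all add: Num_def Den_def)

lemma Num_sum: "Num (\<Sum>c\<in>A. f c) = (\<Prod>c\<in>A. Num (f c))" and Den_sum: "Den (\<Sum>c\<in>A. f c) = (\<Prod>c\<in>A. Den (f c))"
  by (induction A rule: infinite_finite_induct) (auto simp: Num_add Den_add)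

lemma colcont_Suc: "colcont c (Suc l) = add_mset (a * (real c - 1) - real l) (colcont c l)"
  by (simp add: colcont_def lessThan_Suc)

text \<open>Down a column the content drops by 1, so consecutive box factors cancel and only the two
  ends remain.\<close>

lemma colcont_ratio:
  "Num (colcont c l) * (L (a * (real c - 1)) * L (a * real c - real l)) =
   Den (colcont c l) * (L (a * (real c - 1) - real l) * L (a * real c))"
proof (induction l)
  case 0
  then show ?case by (simp add: colcont_def Num_def Den_def)
next
  case (Suc l)
  let ?p = "a * (real c - 1)"
  have p: "?p - real l + a = a * real c - real l" "?p - real l - 1 = ?p - real (Suc l)"
    "a * real c - real l - 1 = a * real c - real (Suc l)" by (simp_all add: algebra_simps)
  have N: "Num (colcont c (Suc l)) = L (a * real c - real l) * L (?p - real (Suc l)) * Num (colcont c l)"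
    unfolding colcont_Suc Num_def image_mset_add_mset prod_mset.add_mset p ..
  have D: "Den (colcont c (Suc l)) = L (?p - real l) * L (a * real c - real (Suc l)) * Den (colcont c l)"
    unfolding colcont_Suc Den_def image_mset_add_mset prod_mset.add_mset p ..
  have "Num (colcont c (Suc l)) * (L ?p * L (a * real c - real (Suc l))) =
      L (?p - real (Suc l)) * L (a * real c - real (Suc l)) * (Num (colcont c l) * (L ?p * L (a * real c - real l)))"
    unfolding N by (simp only: mult_ac)
  also have "\<dots> = Den (colcont c (Suc l)) * (L (?p - real (Suc l)) * L (a * real c))"
    unfolding Suc D by (simp only: mult_ac)
  finally show ?case .
qed

lemma prod_shift: "(\<Prod>c=1..n. f (c - 1)) * f n = f 0 * (\<Prod>c=1..n. f c)" for f :: "nat \<Rightarrow> 'b :: comm_monoid_mult"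
  by (induction n) (simp_all add: mult_ac)

lemma eta_cont:
  assumes "0 \<notin># \<kappa>"
  shows "eta \<kappa> * Den (cont \<kappa>) = Num (cont \<kappa>)"
proof -
  define n where "n = sum_mset \<kappa>"
  let ?A = "\<Prod>c=1..n. L (a * (real c - 1))" and ?B = "\<Prod>c=1..n. L (a * real c - real (col \<kappa> c))"
  let ?C = "\<Prod>c=1..n. L (a * (real c - 1) - real (col \<kappa> c))" and ?D = "\<Prod>c=1..n. L (a * real c)"
  have 1: "Num (cont \<kappa>) * (?A * ?B) = Den (cont \<kappa>) * (?C * ?D)"
    unfolding cont_def Num_sum Den_sum n_def prod.distrib[symmetric] by (intro prod.cong refl colcont_ratio)
  have 2: "?A * L (a * real n) = ?D"
    using prod_shift[of "\<lambda>c. L (a * real c)" n] by (simp add: of_nat_diff cong: prod.cong_simp)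
  have 3: "eta \<kappa> * ?B = ?C * L (a * real n)"
    using eta_columns[OF assms, of n] prod_shift[of "\<lambda>c. L (a * real c - real (col \<kappa> (Suc c)))" n] col_eq_0[of \<kappa> "Suc n"]
    by (simp add: n_def of_nat_diff cong: prod.cong_simp)
  have "eta \<kappa> * Den (cont \<kappa>) * (?A * ?B) = Den (cont \<kappa>) * ?A * (eta \<kappa> * ?B)" by (simp only: mult_ac)
  also have "\<dots> = Den (cont \<kappa>) * (?C * ?D)" unfolding 3 2[symmetric] by (simp only: mult_ac)
  also have "\<dots> = Num (cont \<kappa>) * (?A * ?B)" using 1 by simp
  finally show ?thesis by simp
qed

lemma size_cont: "size (cont \<kappa>) = sum_mset \<kappa>"
proof -
  have "(\<Sum>c=1..n. col \<mu> c) = sum_mset \<mu>" if "sum_mset \<mu> \<le> n" for \<mu> n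
    using that
  proof (induction \<mu>)
    case (add x \<mu>)
    have "(\<Sum>c=1..n. col (add_mset x \<mu>) c) = (\<Sum>c=1..n. (if c \<le> x then 1 else 0) + col \<mu> c)"
      by (intro sum.cong) (auto simp: col_def)
    also have "\<dots> = card ({1..n} \<inter> {c. c \<le> x}) + (\<Sum>c=1..n. col \<mu> c)" by (simp add: sum.distrib sum.If_cases)
    also have "{1..n} \<inter> {c. c \<le> x} = {1..x}" using add.prems by auto
    finally show ?case using add by simp
  qed (simp add: col_def)
  then have "(\<Sum>c=1..sum_mset \<kappa>. col \<kappa> c) = sum_mset \<kappa>" by simp
  moreover have "size (\<Sum>c\<in>A. colcont c (g c)) = (\<Sum>c\<in>A. g c)" if "finite A" for A g
    using that by (induction A) (auto simp: colcont_def)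
  ultimately show ?thesis by (simp add: cont_def)
qed

text \<open>In the first column c where the lengths differ, take the lowest box of the longer one.
  In the other partition the boxes from column c onwards lie in strictly higher rows and have base a
  (c' - 1) at least a (c - 1), so their contents are all larger.\<close>

lemma cont_inject:
  assumes "0 \<notin># \<kappa>" "0 \<notin># \<mu>" "cont \<kappa> = cont \<mu>"
  shows "\<kappa> = \<mu>"
proof -
  have s: "sum_mset \<kappa> = sum_mset \<mu>" using assms(3) size_cont by metis
  define n where "n = sum_mset \<mu>"
  have *: "\<not> col \<mu> c < col \<kappa> c"
    if c: "c \<in> {1..n}" and IH: "\<And>c'. c' \<in> {1..<c} \<Longrightarrow> col \<kappa> c' = col \<mu> c'"
      and eq: "(\<Sum>c=1..n. colcont c (col \<kappa> c)) = (\<Sum>c=1..n. colcont c (col \<mu> c))" for c \<kappa> \<mu>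
  proof
    assume lt: "col \<mu> c < col \<kappa> c"
    have split: "{1..n} = {1..<c} \<union> {c..n}" using c by auto
    have "(\<Sum>c'=c..n. colcont c' (col \<kappa> c')) = (\<Sum>c'=c..n. colcont c' (col \<mu> c'))"
      using eq IH unfolding split by (subst (asm) (1 2) sum.union_disjoint) auto
    moreover have "a * (real c - 1) - real (col \<kappa> c - 1) \<in># colcont c (col \<kappa> c)"
      using lt by (auto simp: colcont_def intro!: image_eqI[of _ _ "col \<kappa> c - 1"])
    then have "a * (real c - 1) - real (col \<kappa> c - 1) \<in># (\<Sum>c'=c..n. colcont c' (col \<kappa> c'))"
      using c by (auto simp: set_mset_sum)
    ultimately obtain c' i where *: "c' \<in> {c..n}" "i < col \<mu> c'" "a * (real c - 1) - real (col \<kappa> c - 1) = a * (real c' - 1) - real i"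
      by (auto simp: set_mset_sum colcont_def)
    have "i < col \<kappa> c - 1" using *(1,2) lt col_antimono[of c c' \<mu>] by auto
    moreover have "a * (real c - 1) \<le> a * (real c' - 1)" using *(1) a_pos by auto
    ultimately show False using *(3) by linarith
  qed
  have "c \<in> {1..n} \<longrightarrow> col \<kappa> c = col \<mu> c" for c
  proof (induction c rule: less_induct)
    case (less c)
    have eq: "(\<Sum>c=1..n. colcont c (col \<kappa> c)) = (\<Sum>c=1..n. colcont c (col \<mu> c))"
      using assms(3) s by (simp add: cont_def n_def)
    show ?case
      using *[of c \<kappa> \<mu>] *[of c \<mu> \<kappa>] less eq by (force simp: not_less)
  qed
  moreover have "col \<kappa> c = col \<mu> c" if "c > n" for c
    using that s by (simp add: col_eq_0 n_def)
  ultimately have "col \<kappa> c = col \<mu> c" if "c \<noteq> 0" for c using that by (cases "c \<le> n") auto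
  then have "count \<kappa> c = count \<mu> c" for c
    using col_Suc[of \<kappa> c] col_Suc[of \<mu> c] assms(1,2) by (cases "c = 0") (auto simp: not_in_iff)
  then show ?thesis by (rule multiset_eqI)
qed

text \<open>A nonzero v is visible as the root 1 / v, but \<open>L 0 = 1\<close> hides the zeros;
  their number is recovered from the sizes.\<close>

lemma prod_L_inject:
  assumes "(\<Prod>v\<in>#M. L v) = (\<Prod>v\<in>#M'. L v)" "size M = size M'"
  shows "M = M'"
proof -
  define T T' where "T = M - M'" and "T' = M' - M"
  have M: "M = T + M \<inter># M'" "M' = T' + M \<inter># M'" by (auto simp: T_def T'_def multiset_eq_iff)
  have ne: "(\<Prod>v\<in>#C. L v) \<noteq> 0" for C by (induction C) auto
  have eq: "(\<Prod>v\<in>#T. L v) = (\<Prod>v\<in>#T'. L v)"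
    using assms(1) ne[of "M \<inter># M'"] by (subst (asm) M(1), subst (asm) M(2)) simp
  have poly: "(\<Prod>v\<in>#C. L v) = fps_of_poly (\<Prod>v\<in>#C. [:1, - v:])" for C
    by (induction C) (simp_all add: fps_of_poly_mult L_def fps_of_poly_pCons fps_of_poly_linear)
  have peq: "(\<Prod>v\<in>#T. [:1, - v:]) = (\<Prod>v\<in>#T'. [:1, - v:])"
    using eq unfolding poly by simp
  have ev: "poly (\<Prod>v\<in>#C. [:1, - v:]) x = (\<Prod>v\<in>#C. 1 - x * v)" for C and x :: real
    by (induction C) (simp_all add: algebra_simps)
  have disj: "v \<notin># T'" if "v \<in># T" for v using that by (auto simp: T_def T'_def in_diff_count)
  have zero: "v = 0" if "v \<in># C" "(\<Prod>v\<in>#C. [:1, - v:]) = (\<Prod>v\<in>#C'. [:1, - v:])" "v \<notin># C'" for v :: real and C C'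
  proof (rule ccontr)
    assume v: "v \<noteq> 0"
    have eqv: "(\<Prod>w\<in>#C. 1 - (1 / v) * w) = (\<Prod>w\<in>#C'. 1 - (1 / v) * w)"
      using arg_cong[OF that(2), of "\<lambda>p. poly p (1 / v)"] unfolding ev .
    have "0 = 1 - (1 / v) * v" using v by simp
    then have "0 \<in># image_mset (\<lambda>w. 1 - (1 / v) * w) C" unfolding set_image_mset using that(1) by (rule image_eqI)
    then have "0 \<in># image_mset (\<lambda>w. 1 - (1 / v) * w) C'" using eqv by (metis prod_mset_zero_iff)
    then obtain w where "w \<in># C'" "1 - (1 / v) * w = 0" by auto
    then have "w = v" using v by (simp add: field_simps)
    then show False using \<open>w \<in># C'\<close> that(3) by simp
  qed
  have "size T = size T'" using assms(2) M by (metis add_right_cancel size_union)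
  moreover have "T = {#} \<or> T' = {#}"
  proof (rule ccontr)
    assume "\<not> ?thesis"
    then obtain v w where vw: "v \<in># T" "w \<in># T'" by (auto simp: ex_in_conv[symmetric] simp flip: set_mset_eq_empty_iff)
    then have "v = 0" "w = 0" using zero[OF _ peq] zero[OF _ peq[symmetric]] disj by blast+
    then show False using vw disj by blast
  qed
  ultimately have "T = {#}" "T' = {#}" by auto
  then show ?thesis using M by simp
qed

text \<open>The largest zero of the eigenvalue series of a multiset \<open>M\<close> is \<open>Max M + a\<close>, and no pole cancels it.\<close>

lemma ratio_inject:
  assumes "Num M * Den M' = Num M' * Den M" "size M = size M'"
  shows "M = M'"
proof -
  \<comment> \<open>Cross multiplication collects the numerator values of the first multiset and the
    denominator values of the second.\<close>
  define G where "G M M' = image_mset (\<lambda>v. v + a) M + image_mset (\<lambda>v. v - 1) M + (M' + image_mset (\<lambda>v. v + a - 1) M')" for M M'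
  have "Num M * Den M' = (\<Prod>v\<in>#G M M'. L v)" for M M'
    by (simp add: Num_def Den_def G_def prod_mset.distrib image_mset.compositionality comp_def)
  then have GM: "G M M' = G M' M"
    using assms by (intro prod_L_inject) (simp_all add: G_def)
  define T T' where "T = M - M'" and "T' = M' - M"
  have M: "M = T + M \<inter># M'" "M' = T' + M \<inter># M'" by (auto simp: T_def T'_def multiset_eq_iff)
  have Gadd: "G (T + C) (T' + C) = G T T' + G C C" for T T' C by (simp add: G_def)
  have GT: "G T T' = G T' T"
  proof -
    have "G (T + M \<inter># M') (T' + M \<inter># M') = G (T' + M \<inter># M') (T + M \<inter># M')"
      by (simp only: M[symmetric] GM)
    then show ?thesis unfolding Gadd by simp
  qed
  have disj: "v \<notin># T'" if "v \<in># T" for v using that by (auto simp: T_def T'_def in_diff_count)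
  have no_max: False if "m \<in># C" "m \<notin># C'" "\<And>v. v \<in># C + C' \<Longrightarrow> v \<le> m" "G C C' = G C' C" for m C C'
  proof -
    have "m + a \<in># G C C'" using that(1) by (auto simp: G_def)
    then have "m + a \<in># G C' C" using that(4) by simp
    then consider "m \<in># C'" | v where "v \<in># C'" "v - 1 = m + a" | "m + a \<in># C" | v where "v \<in># C" "v + a - 1 = m + a"
      by (auto simp: G_def)
    then show False
    proof cases
      case (2 v) then show False using that(3)[of v] a_pos by auto
    next
      case 3 then show False using that(3)[of "m + a"] a_pos by auto
    next
      case (4 v) then show False using that(3)[of v] by auto
    qed (use that in auto)
  qed
  have "T + T' = {#}"
  proof (rule ccontr)
    assume "T + T' \<noteq> {#}"
    then have ne: "set_mset (T + T') \<noteq> {}" by simp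
    define m where "m = Max (set_mset (T + T'))"
    have "m \<in># T + T'" "\<And>v. v \<in># T + T' \<Longrightarrow> v \<le> m"
      using Max_in[OF _ ne] Max_ge[of "set_mset (T + T')"] by (auto simp: m_def)
    then show False
      using no_max[of m T T'] no_max[of m T' T] GT disj by (auto simp: add.commute)
  qed
  then show ?thesis using M by simp
qed

lemma h_inject:
  assumes "0 \<notin># \<kappa>" "0 \<notin># \<mu>" "\<And>k. h k \<kappa> = h k \<mu>"
  shows "\<kappa> = \<mu>"
proof -
  have "sum_mset \<kappa> = sum_mset \<mu>" using assms(3)[of 1] a_pos by (simp add: h_1 del: of_nat_sum_mset One_nat_def)
  moreover have "eta \<kappa> = eta \<mu>" by (simp add: eta_def assms(3) cong: nat.case_cong)
  then have "Num (cont \<kappa>) * Den (cont \<mu>) = Num (cont \<mu>) * Den (cont \<kappa>)"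
    using eta_cont[OF assms(1)] eta_cont[OF assms(2)] by (metis mult.assoc mult.commute)
  ultimately have "cont \<kappa> = cont \<mu>" by (intro ratio_inject) (simp_all add: size_cont)
  then show ?thesis by (rule cont_inject[OF assms(1,2)])
qed

lemma P_orthogonal:
  assumes "0 \<notin># \<kappa>" "0 \<notin># \<mu>" "\<kappa> \<noteq> \<mu>"
  shows "ip (P \<kappa>) (P \<mu>) = 0"
proof -
  obtain k where "h k \<kappa> \<noteq> h k \<mu>" using h_inject assms by blast
  moreover have "h k \<kappa> * ip (P \<kappa>) (P \<mu>) = h k \<mu> * ip (P \<kappa>) (P \<mu>)"
    using H_adjoint[of "P \<kappa>" "P \<mu>" k] assms by (simp add: H_P ip_Const_left ip_Const_right)
  ultimately show ?thesis by simp
qed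

lemma P_nonzero: "0 \<notin># \<kappa> \<Longrightarrow> P \<kappa> \<noteq> 0"
  using mcoeff_P[of \<kappa> \<kappa>] by auto

text \<open>The passage from monomial functions to the eigenvectors is unitriangular, so on a set
  closed downwards in dominance orthogonality to the one family gives orthogonality to the
  other.\<close>

lemma ip_msym_zero:
  assumes D: "\<And>\<mu> \<nu>. \<mu> \<in> D \<Longrightarrow> 0 \<notin># \<nu> \<Longrightarrow> dle \<nu> \<mu> \<Longrightarrow> \<nu> \<in> D"
    and zero: "\<And>\<mu>. \<mu> \<in> D \<Longrightarrow> 0 \<notin># \<mu> \<Longrightarrow> ip f (P \<mu>) = 0"
  shows "\<mu> \<in> D \<Longrightarrow> 0 \<notin># \<mu> \<Longrightarrow> ip f (msym \<mu>) = 0"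
proof (induction "sqs \<mu>" arbitrary: \<mu> rule: less_induct)
  case less
  let ?S = "partitions (sum_mset \<mu>)"
  have "ip f (P \<mu>) = (\<Sum>\<nu>\<in>?S. cc \<mu> \<nu> * ip f (msym \<nu>))"
    by (simp add: P_def ip_sum_right ip_Const_right)
  also have "\<dots> = (\<Sum>\<nu>\<in>?S. if \<nu> = \<mu> then ip f (msym \<mu>) else 0)"
  proof (intro sum.cong refl)
    fix \<nu> assume "\<nu> \<in> ?S"
    show "cc \<mu> \<nu> * ip f (msym \<nu>) = (if \<nu> = \<mu> then ip f (msym \<mu>) else 0)"
    proof (cases "\<nu> = \<mu> \<or> cc \<mu> \<nu> = 0")
      case False
      then have "0 \<notin># \<nu>" "dle \<nu> \<mu>" using cc_nonzero[OF less.prems(2)] by auto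
      then show ?thesis using less.hyps[of \<nu>] sqs_less[of \<nu> \<mu>] D[of \<mu> \<nu>] less.prems False by simp
    qed auto
  qed
  also have "\<dots> = ip f (msym \<mu>)" using less.prems by (simp add: partitions_iff)
  finally show ?case using zero[OF less.prems] by simp
qed

lemma ip_P_zero_imp_zero:
  assumes "f \<in> symfuns" "\<And>\<mu>. 0 \<notin># \<mu> \<Longrightarrow> ip f (P \<mu>) = 0"
  shows "f = 0"
proof -
  obtain n where n: "f = (\<Sum>\<mu>\<in>(\<Union>j\<le>n. partitions j). Const (mcoeff f \<mu>) * msym \<mu>)"
    using msym_expand_bounded[OF assms(1)] by blast
  have "ip f (msym \<mu>) = 0" if "0 \<notin># \<mu>" for \<mu>
    using ip_msym_zero[of UNIV f \<mu>] assms(2) that by simp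
  then have "ip f f = 0"
    by (subst (2) n) (auto simp: ip_sum_right ip_Const_right partitions_iff intro!: sum.neutral)
  then show ?thesis by (rule ip_eq_0_imp)
qed

lemma P_expand:
  assumes "f \<in> symfuns" "\<And>\<mu>. 0 \<notin># \<mu> \<Longrightarrow> \<mu> \<notin> partitions m \<Longrightarrow> ip f (P \<mu>) = 0"
  shows "f = (\<Sum>\<kappa>\<in>partitions m. Const (ip f (P \<kappa>) / ip (P \<kappa>) (P \<kappa>)) * P \<kappa>)"
proof -
  let ?g = "\<Sum>\<kappa>\<in>partitions m. Const (ip f (P \<kappa>) / ip (P \<kappa>) (P \<kappa>)) * P \<kappa>"
  have "f - ?g = 0"
  proof (rule ip_P_zero_imp_zero)
    show "f - ?g \<in> symfuns" using assms by (intro symfuns_diff symfuns_sum symfuns_Const_mult) auto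
    fix \<mu> :: "nat multiset" assume \<mu>: "0 \<notin># \<mu>"
    have pos: "ip (P \<mu>) (P \<mu>) \<noteq> 0" using ip_pos[OF P_nonzero[OF \<mu>]] by simp
    have "ip ?g (P \<mu>) = (\<Sum>\<kappa>\<in>partitions m. if \<kappa> = \<mu> then ip f (P \<mu>) else 0)"
      unfolding ip_sum_left ip_Const_left using pos P_orthogonal \<mu>
      by (intro sum.cong refl) (auto simp: partitions_iff)
    then show "ip (f - ?g) (P \<mu>) = 0" using assms(2)[OF \<mu>] by (auto simp: ip_diff_left)
  qed
  then show ?thesis by simp
qed

section \<open>Identification of the eigenvectors with the Jack polynomials\<close>

lemma scalar_prod_eq_ip:
  assumes "f \<in> symfuns" "g \<in> symfuns"
  shows "scalar_prod (a - 1) f g = ip f g"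
proof -
  have *: "(\<Sum>\<mu>\<in>kys g. lu f \<nu> * lu g \<mu> * p_pairing (a - 1) \<nu> \<mu>) = lu f \<nu> * lu g \<nu> * nrm \<nu>" if "\<nu> \<in> kys f" for \<nu>
  proof -
    have "nz \<nu> = \<nu>" using that assms(1) by (auto simp: symfuns_def is_partition_def intro: nz_id)
    then have "(\<Sum>\<mu>\<in>kys g. lu f \<nu> * lu g \<mu> * p_pairing (a - 1) \<nu> \<mu>) = (\<Sum>\<mu>\<in>kys g. if \<mu> = \<nu> then lu f \<nu> * lu g \<nu> * nrm \<nu> else 0)"
      by (intro sum.cong) (auto simp: p_pairing_def nrm_def)
    then show ?thesis by (simp add: in_keys_iff)
  qed
  show ?thesis unfolding scalar_prod_def ip_def by (intro sum.cong refl *)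
qed

text \<open>Reduces an identity in every number of variables to coefficients; the witness for c is
  \<open>mcoeff f\<close>.\<close>

lemma unitriangular_iff:
  assumes f: "f \<in> symfuns" and \<kappa>: "0 \<notin># \<kappa>"
  shows "unitriangular (a - 1) \<kappa> f \<longleftrightarrow> mcoeff f \<kappa> = 1 \<and>
    (\<forall>\<mu>. 0 \<notin># \<mu> \<longrightarrow> \<mu> \<noteq> \<kappa> \<longrightarrow> mcoeff f \<mu> \<in> rat_adjoin (a - 1) \<and> (mcoeff f \<mu> \<noteq> 0 \<longrightarrow> dle \<mu> \<kappa>))" (is "_ \<longleftrightarrow> ?R")
proof -
  have sb: "\<mu> \<in> strictly_below \<kappa> \<longleftrightarrow> 0 \<notin># \<mu> \<and> dle \<mu> \<kappa> \<and> \<mu> \<noteq> \<kappa>" for \<mu>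
    by (simp add: strictly_below_def is_partition_def dominance_le_iff_dle)
  have fin: "finite (strictly_below \<kappa>)"
    by (rule finite_subset[OF _ finite_partitions[of "sum_mset \<kappa>"]]) (auto simp: sb partitions_iff dle_def)
  have lk: "lu (monomial_sym N \<kappa> + (\<Sum>\<mu>\<in>strictly_below \<kappa>. Const (c \<mu>) * monomial_sym N \<mu>)) \<alpha> =
     (if set_mset \<alpha> \<subseteq> {..<N} then if exponents \<alpha> = \<kappa> then 1 else if exponents \<alpha> \<in> strictly_below \<kappa> then c (exponents \<alpha>) else 0 else 0)"
    for c N \<alpha>
  proof -
    have "(\<Sum>\<mu>\<in>strictly_below \<kappa>. lu (Const (c \<mu>) * monomial_sym N \<mu>) \<alpha>) =
      (\<Sum>\<mu>\<in>strictly_below \<kappa>. if \<mu> = exponents \<alpha> then if set_mset \<alpha> \<subseteq> {..<N} then c (exponents \<alpha>) else 0 else 0)"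
      by (intro sum.cong) (auto simp: lookup_Const_mult lookup_monomial_sym)
    also have "\<dots> = (if exponents \<alpha> \<in> strictly_below \<kappa> then if set_mset \<alpha> \<subseteq> {..<N} then c (exponents \<alpha>) else 0 else 0)"
      using fin by simp
    finally show ?thesis by (auto simp: lookup_add lookup_sum lookup_monomial_sym sb)
  qed
  show ?thesis
  proof
    assume "unitriangular (a - 1) \<kappa> f"
    then obtain c where c: "\<And>\<mu>. \<mu> \<in> strictly_below \<kappa> \<Longrightarrow> c \<mu> \<in> rat_adjoin (a - 1)"
      and eq: "\<And>N. in_vars N f = monomial_sym N \<kappa> + (\<Sum>\<mu>\<in>strictly_below \<kappa>. Const (c \<mu>) * monomial_sym N \<mu>)"
      by (auto simp: unitriangular_def)
    have "mcoeff f \<mu> = (if \<mu> = \<kappa> then 1 else if \<mu> \<in> strictly_below \<kappa> then c \<mu> else 0)" if "0 \<notin># \<mu>" for \<mu>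
      using std[OF that] lk[of "size \<mu>" c "std \<mu>"] by (simp add: mcoeff_def eq)
    then show ?R using c \<kappa> by (auto simp: sb rat_adjoin_Rats)
  next
    assume R: ?R
    have R': "mcoeff f \<mu> = 0" if "0 \<notin># \<mu>" "\<mu> \<noteq> \<kappa>" "\<not> dle \<mu> \<kappa>" for \<mu> using R that by blast
    have "in_vars N f = monomial_sym N \<kappa> + (\<Sum>\<mu>\<in>strictly_below \<kappa>. Const (mcoeff f \<mu>) * monomial_sym N \<mu>)" for N
    proof (rule poly_mapping_eqI)
      fix \<alpha>
      show "lu (in_vars N f) \<alpha> = lu (monomial_sym N \<kappa> + (\<Sum>\<mu>\<in>strictly_below \<kappa>. Const (mcoeff f \<mu>) * monomial_sym N \<mu>)) \<alpha>"
        unfolding lk lookup_in_vars[OF f] using R R' by (auto simp: sb)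
    qed
    then show "unitriangular (a - 1) \<kappa> f"
      unfolding unitriangular_def using R by (intro exI[of _ "mcoeff f"]) (auto simp: sb)
  qed
qed

lemma jack_family_P: "jack_family (a - 1) P"
  unfolding jack_family_def
  using unitriangular_iff cc_properties cc_nonzero
  by (auto simp: is_partition_def mcoeff_P scalar_prod_eq_ip P_orthogonal)

text \<open>By induction the two families agree strictly below \<open>\<kappa>\<close>. The
  difference d at \<open>\<kappa>\<close> is a combination of monomial functions there and
  orthogonal to all of them, hence to itself.\<close>

lemma jack_family_unique:
  assumes Q: "jack_family (a - 1) Q"
  shows "0 \<notin># \<kappa> \<Longrightarrow> Q \<kappa> = P \<kappa>"
proof (induction "sqs \<kappa>" arbitrary: \<kappa> rule: less_induct)
  case less
  have sQ: "Q \<mu> \<in> symfuns" "unitriangular (a - 1) \<mu> (Q \<mu>)" if "0 \<notin># \<mu>" for \<mu>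
    using Q that by (auto simp: jack_family_def is_partition_def)
  have oQ: "ip (Q \<mu>) (Q \<nu>) = 0" if "0 \<notin># \<mu>" "0 \<notin># \<nu>" "\<mu> \<noteq> \<nu>" for \<mu> \<nu>
    using Q that by (auto simp: jack_family_def is_partition_def sQ simp flip: scalar_prod_eq_ip)
  define d where "d = Q \<kappa> - P \<kappa>"
  have d: "d \<in> symfuns" unfolding d_def using sQ less.prems by auto
  let ?D = "{\<mu>. 0 \<notin># \<mu> \<and> dle \<mu> \<kappa> \<and> \<mu> \<noteq> \<kappa>}"
  have supp: "\<mu> \<in> ?D" if "0 \<notin># \<mu>" "mcoeff d \<mu> \<noteq> 0" for \<mu>
    using that unitriangular_iff[OF sQ(1) less.prems] sQ(2)[OF less.prems] less.prems mcoeff_P[OF less.prems] cc_nonzero[OF less.prems, of \<mu>]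
    by (auto simp: d_def mcoeff_diff)
  have zero: "ip d (msym \<mu>) = 0" if "\<mu> \<in> ?D" for \<mu>
  proof (rule ip_msym_zero[of ?D])
    show "\<mu> \<in> ?D" "0 \<notin># \<mu>" using that by auto
    show "\<nu> \<in> ?D" if "\<mu> \<in> ?D" "0 \<notin># \<nu>" "dle \<nu> \<mu>" for \<mu> \<nu>
      using that dle_trans[of \<nu> \<mu> \<kappa>] dle_antisym[of \<mu> \<kappa>] less.prems by auto
    show "ip d (P \<mu>) = 0" if "\<mu> \<in> ?D" for \<mu>
    proof -
      have "Q \<mu> = P \<mu>" using less.hyps[of \<mu>] sqs_less[of \<mu> \<kappa>] that less.prems by auto
      then show ?thesis using oQ[of \<kappa> \<mu>] P_orthogonal[of \<kappa> \<mu>] that less.prems by (auto simp: d_def ip_diff_left)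
    qed
  qed
  obtain n where n: "d = (\<Sum>\<mu>\<in>(\<Union>j\<le>n. partitions j). Const (mcoeff d \<mu>) * msym \<mu>)"
    using msym_expand_bounded[OF d] by blast
  have "mcoeff d \<mu> * ip d (msym \<mu>) = 0" if "0 \<notin># \<mu>" for \<mu>
    using supp[OF that] zero[of \<mu>] by auto
  then have "ip d d = 0"
    by (subst (2) n) (auto simp: ip_sum_right ip_Const_right partitions_iff intro!: sum.neutral)
  then have "d = 0" by (rule ip_eq_0_imp)
  then show ?case by (simp add: d_def)
qed

lemma jack_P_eq:
  assumes "0 \<notin># \<kappa>"
  shows "jack_P (a - 1) \<kappa> = P \<kappa>"
  unfolding jack_P_def
proof (rule the_equality)
  show "\<exists>Q. jack_family (a - 1) Q \<and> P \<kappa> = Q \<kappa>" using jack_family_P by (intro exI[of _ P] conjI refl)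
  fix f assume "\<exists>Q. jack_family (a - 1) Q \<and> f = Q \<kappa>"
  then obtain Q where "jack_family (a - 1) Q" "f = Q \<kappa>" by blast
  then show "f = P \<kappa>" using jack_family_unique assms by simp
qed

end

section \<open>The Pieri rule\<close>

context jack_parameter
begin

lemma partitions_Suc_iff: "add_mset k \<mu> \<in> partitions n \<longleftrightarrow> k \<noteq> 0 \<and> \<mu> \<in> partitions (n - k) \<and> k \<le> n"
  by (auto simp: partitions_iff)

lemma homogeneous_Var: "k \<noteq> 0 \<Longrightarrow> kys f \<subseteq> partitions n \<Longrightarrow> kys (Var k * f) \<subseteq> partitions (n + k)"
  using keys_mon_mult[of "{#k#}" f] by (force simp: Var_eq_mon partitions_Suc_iff)

lemma keys_Jm:
  assumes "kys f \<subseteq> partitions n" "\<nu> \<in> kys (Jm k f)"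
  shows "k \<le> n \<and> \<nu> \<in> partitions (n - k)"
proof -
  have "Jm k f = lin (\<lambda>\<mu>. Const (a * real k * real (count \<mu> k)) * mon (\<mu> - {#k#})) f"
    by (rule islin_ext) (simp_all add: islin_rules Jm_mon)
  then obtain \<mu> where "\<mu> \<in> kys f" and \<nu>: "\<nu> \<in> kys (Const (a * real k * real (count \<mu> k)) * mon (\<mu> - {#k#}))"
    using assms(2) keys_lin[of "\<lambda>\<mu>. Const (a * real k * real (count \<mu> k)) * mon (\<mu> - {#k#})" f] by auto
  then have "\<mu> \<in> partitions n" "\<nu> = \<mu> - {#k#}" "k \<in># \<mu>"
    using assms(1) by (auto simp: in_keys_iff lookup_Const_mult lookup_mon not_in_iff split: if_splits)
  then show ?thesis using partitions_Suc_iff[of k "\<mu> - {#k#}" n] by auto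
qed

lemma Jm_zero: "kys f \<subseteq> partitions n \<Longrightarrow> n < k \<Longrightarrow> Jm k f = 0"
  using keys_Jm[of f n _ k] by (metis all_not_in_conv keys_eq_empty not_le)

lemma homogeneous_Jm: "kys f \<subseteq> partitions n \<Longrightarrow> kys (Jm k f) \<subseteq> partitions (n - k)"
  using keys_Jm by blast

lemma ip_homogeneous:
  assumes "kys f \<subseteq> partitions m" "kys g \<subseteq> partitions n" "m \<noteq> n"
  shows "ip f g = 0"
proof -
  have "lu g \<mu> = 0" if "\<mu> \<in> kys f" for \<mu>
  proof -
    have "\<mu> \<notin> partitions n" using that assms by (auto simp: partitions_iff)
    then show ?thesis using assms(2) by (auto simp: in_keys_iff)
  qed
  then show ?thesis by (simp add: ip_def)
qed

lemma Jp_homogeneous: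
  assumes "kys f \<subseteq> partitions n" "n \<le> m"
  shows "Jp f = (\<Sum>k=1..m. Var 0 ^ k * Jm k f)"
proof (rule Jp_expand)
  fix \<mu> assume "\<mu> \<in> kys f"
  then show "set_mset \<mu> \<subseteq> insert 0 {1..m}"
    using assms member_le_sum_mset[of _ \<mu>] by (fastforce simp: partitions_iff)
qed auto

definition psi :: "nat multiset \<Rightarrow> nat multiset \<Rightarrow> real" where
  "psi \<rho> \<kappa> = ip (Var 1 * P \<rho>) (P \<kappa>)"

text \<open>
  Where \<^term>\<open>psi \<rho> \<kappa>\<close> does not vanish, this turns out to be the content of the box added to \<open>\<rho>\<close>.
\<close>

definition step :: "nat multiset \<Rightarrow> nat multiset \<Rightarrow> real" where
  "step \<rho> \<kappa> = (kap \<kappa> - kap \<rho>) / (2 * a)"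

lemma psi_nonzero:
  assumes "psi \<rho> \<kappa> \<noteq> 0"
  shows "sum_mset \<kappa> = Suc (sum_mset \<rho>)"
proof (rule ccontr)
  assume "sum_mset \<kappa> \<noteq> Suc (sum_mset \<rho>)"
  then have "psi \<rho> \<kappa> = 0"
    unfolding psi_def using homogeneous_Var[OF _ keys_P, of 1 \<rho>] by (intro ip_homogeneous[OF _ keys_P]) auto
  then show False using assms by simp
qed

text \<open>\<open>B_F\<close> evaluated between eigenvectors: the commutator with B becomes
  multiplication by the difference of eigenvalues, which is 2 a times \<open>step\<close>.\<close>

lemma matrix_F:
  assumes "0 \<notin># \<rho>" "0 \<notin># \<kappa>"
  shows "ip (F 0 (P \<rho>)) (P \<kappa>) = psi \<rho> \<kappa>"
    and "ip (F (Suc k) (P \<rho>)) (P \<kappa>) = step \<rho> \<kappa> * ip (F k (P \<rho>)) (P \<kappa>) - h k \<rho> * psi \<rho> \<kappa>"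
proof -
  show "ip (F 0 (P \<rho>)) (P \<kappa>) = psi \<rho> \<kappa>" by (simp add: F_0 psi_def)
  have "kap \<kappa> * ip (F k (P \<rho>)) (P \<kappa>) = ip (B (F k (P \<rho>))) (P \<kappa>)"
    by (simp add: B_adjoint B_P assms ip_Const_right)
  also have "\<dots> = kap \<rho> * ip (F k (P \<rho>)) (P \<kappa>) + 2 * a * (ip (F (Suc k) (P \<rho>)) (P \<kappa>) + h k \<rho> * psi \<rho> \<kappa>)"
    by (simp add: B_F B_P H_P assms islin_Const[OF islin_F] ip_add_left ip_Const_left psi_def
        mult.left_commute[of "Var (Suc 0)"])
  finally show "ip (F (Suc k) (P \<rho>)) (P \<kappa>) = step \<rho> \<kappa> * ip (F k (P \<rho>)) (P \<kappa>) - h k \<rho> * psi \<rho> \<kappa>"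
    using a_pos by (simp add: step_def field_simps)
qed

text \<open>Moving a factor \<open>Z\<close> across w yields the index j + 1, the scalar a - 1, and
  a term with h_j. By \<open>matrix_F\<close> the first of these is \<open>step\<close> times the
  old value minus the same h_j term, so the latter cancels.\<close>

lemma matrix_ZwZ:
  assumes "0 \<notin># \<rho>" "0 \<notin># \<kappa>"
  shows "ip (pr ((Z ^^ i) (Var 0 * (Z ^^ j) (P \<rho>)))) (P \<kappa>) =
    (a - 1 + step \<rho> \<kappa>) ^ i * ip (F j (P \<rho>)) (P \<kappa>)"
proof (induction i arbitrary: j)
  case 0
  then show ?case by (simp add: F_def)
next
  case (Suc i)
  have "pr ((Z ^^ j) (P \<rho>)) = Const (h j \<rho>) * P \<rho>" using H_P[OF assms(1), of j] by (simp add: H_def)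
  then have "(Z ^^ i) (Var 0 * pr ((Z ^^ j) (P \<rho>))) = Const (h j \<rho>) * (Z ^^ i) (Var 0 * (Z ^^ 0) (P \<rho>))"
    using islin_Const[OF islin_funpow[OF islin_Z, of i]] by (simp add: mult.left_commute[of "Var 0" "Const _"])
  then have "ip (pr ((Z ^^ Suc i) (Var 0 * (Z ^^ j) (P \<rho>)))) (P \<kappa>) =
      ip (pr ((Z ^^ i) (Var 0 * (Z ^^ Suc j) (P \<rho>)))) (P \<kappa>) +
      (a - 1) * ip (pr ((Z ^^ i) (Var 0 * (Z ^^ j) (P \<rho>)))) (P \<kappa>) +
      h j \<rho> * ip (pr ((Z ^^ i) (Var 0 * (Z ^^ 0) (P \<rho>)))) (P \<kappa>)"
    unfolding Z_pow_w by (simp add: pr_add pr_Const ip_add_left ip_Const_left)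
  then show ?case unfolding Suc.IH by (simp add: matrix_F[OF assms] algebra_simps)
qed

lemma matrix_H_diff:
  assumes "0 \<notin># \<rho>" "0 \<notin># \<kappa>"
  shows "(h k \<kappa> - h k \<rho>) * psi \<rho> \<kappa> =
    a * (\<Sum>j<k. (a - 1 + step \<rho> \<kappa>) ^ j * ip (F (k - 1 - j) (P \<rho>)) (P \<kappa>))"
proof -
  have s: "Var 1 * P \<rho> \<in> symfuns" by auto
  have "h k \<kappa> * psi \<rho> \<kappa> = ip (H k (Var 1 * P \<rho>)) (P \<kappa>)"
    using H_adjoint[OF s, of "P \<kappa>" k] by (simp add: psi_def H_P assms ip_Const_right)
  also have "H k (Var 1 * P \<rho>) = Var 1 * H k (P \<rho>) + Const a * (\<Sum>j<k. pr ((Z ^^ j) (Var 0 * (Z ^^ (k - 1 - j)) (P \<rho>))))"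
    unfolding H_def Z_pow_p1 by (simp add: pr_add pr_Const pr_sum pr_Var)
  also have "ip \<dots> (P \<kappa>) = h k \<rho> * psi \<rho> \<kappa> + a * (\<Sum>j<k. (a - 1 + step \<rho> \<kappa>) ^ j * ip (F (k - 1 - j) (P \<rho>)) (P \<kappa>))"
    by (simp only: ip_add_left ip_Const_left ip_sum_left matrix_ZwZ[OF assms] H_P[OF assms(1)]
        mult.left_commute[of "Var 1"] psi_def)
  finally show ?thesis by (simp add: algebra_simps)
qed

text \<open>\<open>matrix_F\<close> reads L(c) \<Phi> = \<psi> eta(\<rho>), and
  \<open>matrix_H_diff\<close> says that \<psi> times the difference of the two series is -a X^2
  \<Gamma> \<Phi> with \<Gamma> = 1 / L(c + a - 1). The quotient of the series is thus 1 - a X^2 /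
  (L(c) L(c + a - 1)), precisely the factor of one box of content c.\<close>

lemma eta_pieri:
  assumes "0 \<notin># \<rho>" "0 \<notin># \<kappa>" "psi \<rho> \<kappa> \<noteq> 0"
  defines "c \<equiv> step \<rho> \<kappa>"
  shows "eta \<kappa> * (L c * L (c + a - 1)) = eta \<rho> * (L (c + a) * L (c - 1))"
proof -
  define \<psi> where "\<psi> = psi \<rho> \<kappa>"
  define \<Phi> where "\<Phi> = Abs_fps (\<lambda>k. ip (F k (P \<rho>)) (P \<kappa>))"
  define \<Gamma> where "\<Gamma> = Abs_fps (\<lambda>k. (a - 1 + c) ^ k)"
  have \<Phi>: "L c * \<Phi> = fps_const \<psi> * eta \<rho>"
  proof (rule fps_ext)
    fix k show "fps_nth (L c * \<Phi>) k = fps_nth (fps_const \<psi> * eta \<rho>) k"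
      using matrix_F[OF assms(1,2)]
      by (cases k) (simp_all add: L_def left_diff_distrib mult.assoc \<Phi>_def eta_def c_def \<psi>_def)
  qed
  have \<Gamma>: "L (c + a - 1) * \<Gamma> = 1"
  proof (rule fps_ext)
    fix k show "fps_nth (L (c + a - 1) * \<Gamma>) k = fps_nth 1 k"
      by (cases k) (simp_all add: L_def left_diff_distrib mult.assoc \<Gamma>_def, simp add: algebra_simps)
  qed
  have diff: "fps_const \<psi> * (eta \<kappa> - eta \<rho>) = - (fps_const a * (fps_X * (fps_X * (\<Gamma> * \<Phi>))))"
  proof (rule fps_ext)
    fix k
    have *: "fps_nth (\<Gamma> * \<Phi>) j = (\<Sum>i<Suc j. (a - 1 + c) ^ i * ip (F (Suc j - 1 - i) (P \<rho>)) (P \<kappa>))" for j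
      by (simp add: fps_mult_nth \<Gamma>_def \<Phi>_def atLeast0AtMost lessThan_Suc_atMost)
    consider "k = 0" | "k = 1" | j where "k = Suc (Suc j)" by (metis One_nat_def not0_implies_Suc)
    then show "fps_nth (fps_const \<psi> * (eta \<kappa> - eta \<rho>)) k = fps_nth (- (fps_const a * (fps_X * (fps_X * (\<Gamma> * \<Phi>))))) k"
    proof cases
      case 2 then show ?thesis by (simp add: eta_def h_def)
    next
      case (3 j)
      have "fps_nth (fps_const \<psi> * (eta \<kappa> - eta \<rho>)) k = - ((h (Suc j) \<kappa> - h (Suc j) \<rho>) * \<psi>)"
        by (simp add: 3 eta_def algebra_simps)
      then show ?thesis unfolding \<psi>_def matrix_H_diff[OF assms(1,2)] c_def[symmetric] *[symmetric]
        by (simp add: 3)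
    qed (simp add: eta_def)
  qed
  have LL: "L (c + a) * L (c - 1) = L c * L (c + a - 1) - fps_const a * (fps_X * fps_X)"
  proof -
    have "L (c + a) = 1 - (fps_const c + fps_const a) * fps_X" "L (c - 1) = 1 - (fps_const c - 1) * fps_X"
      "L (c + a - 1) = 1 - (fps_const c + fps_const a - 1) * fps_X"
      by (simp_all add: L_def flip: fps_const_add fps_const_sub)
    then show ?thesis by (simp add: L_def algebra_simps)
  qed
  have "fps_const \<psi> * (eta \<kappa> * (L c * L (c + a - 1))) =
      fps_const \<psi> * (eta \<kappa> - eta \<rho>) * (L c * L (c + a - 1)) + fps_const \<psi> * eta \<rho> * (L c * L (c + a - 1))"
    by (simp add: algebra_simps)
  also have "fps_const \<psi> * (eta \<kappa> - eta \<rho>) * (L c * L (c + a - 1)) =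
      - (fps_const a * (fps_X * (fps_X * ((L (c + a - 1) * \<Gamma>) * (L c * \<Phi>)))))"
    unfolding diff by (simp add: algebra_simps)
  also have "\<dots> + fps_const \<psi> * eta \<rho> * (L c * L (c + a - 1)) = fps_const \<psi> * (eta \<rho> * (L (c + a) * L (c - 1)))"
    unfolding \<Phi> \<Gamma> LL by (simp add: algebra_simps)
  finally show ?thesis using assms(3) by (simp add: \<psi>_def)
qed

text \<open>Nothing so far says that \<open>step\<close> is a content. Injectivity of the eigenvalue
  series turns the new factor into an element of the multiset.\<close>

lemma cont_pieri:
  assumes "0 \<notin># \<rho>" "0 \<notin># \<kappa>" "psi \<rho> \<kappa> \<noteq> 0"
  shows "cont \<kappa> = add_mset (step \<rho> \<kappa>) (cont \<rho>)"
proof (rule ratio_inject)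
  let ?c = "step \<rho> \<kappa>"
  have N: "Num (add_mset ?c (cont \<rho>)) = L (?c + a) * L (?c - 1) * Num (cont \<rho>)"
    and D: "Den (add_mset ?c (cont \<rho>)) = L ?c * L (?c + a - 1) * Den (cont \<rho>)"
    by (simp_all add: Num_def Den_def)
  have "Num (cont \<kappa>) * Den (add_mset ?c (cont \<rho>)) =
      (eta \<kappa> * (L ?c * L (?c + a - 1))) * Den (cont \<kappa>) * Den (cont \<rho>)"
    unfolding D eta_cont[OF assms(2), symmetric] by (simp only: mult_ac)
  also have "\<dots> = (eta \<rho> * Den (cont \<rho>)) * (L (?c + a) * L (?c - 1)) * Den (cont \<kappa>)"
    unfolding eta_pieri[OF assms] by (simp only: mult_ac)
  also have "\<dots> = Num (add_mset ?c (cont \<rho>)) * Den (cont \<kappa>)"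
    unfolding eta_cont[OF assms(1)] N by (simp only: mult_ac)
  finally show "Num (cont \<kappa>) * Den (add_mset ?c (cont \<rho>)) = Num (add_mset ?c (cont \<rho>)) * Den (cont \<kappa>)" .
  show "size (cont \<kappa>) = size (add_mset ?c (cont \<rho>))"
    using psi_nonzero[OF assms(3)] by (simp add: size_cont)
qed

section \<open>Specialisations of Jack polynomials\<close>

definition nsq :: "nat multiset \<Rightarrow> real" where
  "nsq \<kappa> = ip (P \<kappa>) (P \<kappa>)"

lemma psi_expand:
  assumes "f \<in> symfuns" "\<rho> \<in> partitions n"
    and "\<And>\<kappa>. 0 \<notin># \<kappa> \<Longrightarrow> ip f (P \<kappa>) = g \<kappa> * psi \<rho> \<kappa>"
  shows "f = (\<Sum>\<kappa>\<in>partitions (Suc n). Const (g \<kappa> * psi \<rho> \<kappa> / nsq \<kappa>) * P \<kappa>)"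
proof -
  have "f = (\<Sum>\<kappa>\<in>partitions (Suc n). Const (ip f (P \<kappa>) / ip (P \<kappa>) (P \<kappa>)) * P \<kappa>)"
  proof (rule P_expand[OF assms(1)])
    fix \<mu> :: "nat multiset" assume "0 \<notin># \<mu>" "\<mu> \<notin> partitions (Suc n)"
    then show "ip f (P \<mu>) = 0" using assms(2,3) psi_nonzero[of \<rho> \<mu>] by (auto simp: partitions_iff)
  qed
  also have "\<dots> = (\<Sum>\<kappa>\<in>partitions (Suc n). Const (g \<kappa> * psi \<rho> \<kappa> / nsq \<kappa>) * P \<kappa>)"
    by (intro sum.cong refl) (simp add: assms(3) nsq_def partitions_iff)
  finally show ?thesis .
qed

lemma psi_expand_adjoint:
  assumes "f \<in> symfuns" "\<kappa> \<in> partitions (Suc n)"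
    and "\<And>\<rho>. 0 \<notin># \<rho> \<Longrightarrow> ip f (P \<rho>) = g \<rho> * psi \<rho> \<kappa>"
  shows "f = (\<Sum>\<rho>\<in>partitions n. Const (g \<rho> * psi \<rho> \<kappa> / nsq \<rho>) * P \<rho>)"
proof -
  have "f = (\<Sum>\<rho>\<in>partitions n. Const (ip f (P \<rho>) / ip (P \<rho>) (P \<rho>)) * P \<rho>)"
  proof (rule P_expand[OF assms(1)])
    fix \<mu> :: "nat multiset" assume "0 \<notin># \<mu>" "\<mu> \<notin> partitions n"
    then show "ip f (P \<mu>) = 0" using assms(2,3) psi_nonzero[of \<mu> \<kappa>] by (auto simp: partitions_iff)
  qed
  also have "\<dots> = (\<Sum>\<rho>\<in>partitions n. Const (g \<rho> * psi \<rho> \<kappa> / nsq \<rho>) * P \<rho>)"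
    by (intro sum.cong refl) (simp add: assms(3) nsq_def partitions_iff)
  finally show ?thesis .
qed

lemma F_1_expand:
  assumes "kys f \<subseteq> partitions n" "n \<le> m"
  shows "F 1 f = (\<Sum>k=1..m. Var (Suc k) * Jm k f)"
proof -
  note f = symfuns_homogeneous[OF assms(1)]
  have "F 1 f = (\<Sum>k=1..m. pr (Var 0 ^ Suc k * Jm k f))"
    by (simp add: F_def Z_symfuns[OF f] Jp_homogeneous[OF assms] sum_distrib_left pr_sum mult.assoc)
  also have "\<dots> = (\<Sum>k=1..m. Var (Suc k) * Jm k f)"
    unfolding pr_w_power[OF Jm_in_symfuns[OF f]] by simp
  finally show ?thesis .
qed

lemma Jm_1_P:
  assumes "\<kappa> \<in> partitions (Suc n)"
  shows "Jm 1 (P \<kappa>) = (\<Sum>\<rho>\<in>partitions n. Const (psi \<rho> \<kappa> / nsq \<rho>) * P \<rho>)"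
proof -
  have "ip (Jm 1 (P \<kappa>)) (P \<rho>) = 1 * psi \<rho> \<kappa>" for \<rho>
    using ip_Var[of 1 "P \<rho>" "P \<kappa>"] ip_sym[of "P \<rho>"] by (simp add: psi_def)
  from psi_expand_adjoint[OF Jm_in_symfuns[OF P_in_symfuns] assms this] show ?thesis by simp
qed

text \<open>The operator on the left is the adjoint of \<open>F 1\<close>, whose matrix elements are
  \<open>step\<close> times \<open>psi\<close>.\<close>

lemma lowering_P:
  assumes "\<kappa> \<in> partitions (Suc n)"
  shows "(\<Sum>k=1..Suc n. Var k * Jm (Suc k) (P \<kappa>)) = (\<Sum>\<rho>\<in>partitions n. Const (step \<rho> \<kappa> * psi \<rho> \<kappa> / nsq \<rho>) * P \<rho>)"
proof (rule psi_expand_adjoint[OF _ assms])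
  let ?T = "\<Sum>k=1..Suc n. Var k * Jm (Suc k) (P \<kappa>)"
  show "?T \<in> symfuns" by (intro symfuns_sum symfuns_mult Jm_in_symfuns) auto
  fix \<rho> :: "nat multiset" assume \<rho>: "0 \<notin># \<rho>"
  have \<kappa>: "0 \<notin># \<kappa>" "sum_mset \<kappa> = Suc n" using assms by (auto simp: partitions_iff)
  have adj: "ip ?T (P \<rho>) = ip (\<Sum>k=1..Suc n. Var (Suc k) * Jm k (P \<rho>)) (P \<kappa>)"
  proof -
    have "ip (Var k * Jm (Suc k) (P \<kappa>)) (P \<rho>) = ip (Var (Suc k) * Jm k (P \<rho>)) (P \<kappa>)" if "k \<noteq> 0" for k
      using ip_Var[OF that, of "Jm (Suc k) (P \<kappa>)" "P \<rho>"] ip_Var[of "Suc k" "Jm k (P \<rho>)" "P \<kappa>"]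
        ip_sym[of "Jm k (P \<rho>)"] by simp
    then show ?thesis unfolding ip_sum_left by (intro sum.cong) auto
  qed
  show "ip ?T (P \<rho>) = step \<rho> \<kappa> * psi \<rho> \<kappa>"
  proof (cases "sum_mset \<rho> = n")
    case True
    then have "F 1 (P \<rho>) = (\<Sum>k=1..Suc n. Var (Suc k) * Jm k (P \<rho>))"
      by (intro F_1_expand[OF keys_P]) simp
    then show ?thesis unfolding adj using matrix_F(1)[OF \<rho> \<kappa>(1)] matrix_F(2)[OF \<rho> \<kappa>(1), of 0] by (simp add: h_def)
  next
    case False
    have "ip (Var (Suc k) * Jm k (P \<rho>)) (P \<kappa>) = 0" for k
    proof (cases "k \<le> sum_mset \<rho>")
      case True
      have "kys (Jm k (P \<rho>)) \<subseteq> partitions (sum_mset \<rho> - k)" by (rule homogeneous_Jm[OF keys_P])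
      then have "kys (Var (Suc k) * Jm k (P \<rho>)) \<subseteq> partitions (Suc (sum_mset \<rho>))"
        using homogeneous_Var[of "Suc k" "Jm k (P \<rho>)" "sum_mset \<rho> - k"] True by simp
      then show ?thesis using ip_homogeneous[OF _ keys_P] False \<kappa> by simp
    qed (simp add: Jm_zero[OF keys_P])
    then have "ip ?T (P \<rho>) = 0" unfolding adj unfolding ip_sum_left by simp
    moreover have "psi \<rho> \<kappa> = 0" using psi_nonzero[of \<rho> \<kappa>] False \<kappa> by auto
    ultimately show ?thesis by simp
  qed
qed

section \<open>Evaluation with all power sums equal, and the content product\<close>

lemma constant_subst_mon: "subst (\<lambda>_. U) (mon \<nu>) = U ^ size \<nu>"
  by (simp add: subst_mon image_mset_const_eq)

text \<open>Once all power sums equal U, removing a part k costs one factor U whatever k is, and k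
  times its multiplicity sums to the degree. Lowering a part k + 1 to k restores this factor; a part
  1 disappears and needs the explicit U.\<close>

lemma constant_subst_euler:
  assumes "kys f \<subseteq> partitions n"
  shows "subst (\<lambda>_. U) (\<Sum>k=1..n. Var k * Jm (Suc k) f) + U * subst (\<lambda>_. U) (Jm 1 f) = Const (a * real n) * subst (\<lambda>_. U) f"
proof (rule islin_ext_on[of "\<lambda>f. subst (\<lambda>_. U) (\<Sum>k=1..n. Var k * Jm (Suc k) f) + U * subst (\<lambda>_. U) (Jm 1 f)"])
  fix \<nu> assume "\<nu> \<in> kys f"
  then have \<nu>: "0 \<notin># \<nu>" "sum_mset \<nu> = n" using assms by (auto simp: partitions_iff)
  have 1: "U * subst (\<lambda>_. U) (Jm k (mon \<nu>)) = Const (a * real k * real (count \<nu> k)) * U ^ size \<nu>" for k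
  proof (cases "k \<in># \<nu>")
    case True
    then have "size \<nu> = Suc (size (\<nu> - {#k#}))" by (metis insert_DiffM size_add_mset)
    then show ?thesis by (simp add: Jm_mon subst_Const_mult constant_subst_mon mult.left_commute)
  qed (simp add: Jm_mon not_in_iff subst_0)
  have sub: "set_mset \<nu> \<subseteq> {1..Suc n}"
  proof
    fix x assume "x \<in># \<nu>"
    then show "x \<in> {1..Suc n}" using \<nu> member_le_sum_mset[of x \<nu>] by (cases x) auto
  qed
  have "subst (\<lambda>_. U) (\<Sum>k=1..n. Var k * Jm (Suc k) (mon \<nu>)) + U * subst (\<lambda>_. U) (Jm 1 (mon \<nu>))
      = (\<Sum>k=1..n. Const (a * real (Suc k) * real (count \<nu> (Suc k))) * U ^ size \<nu>) + Const (a * real 1 * real (count \<nu> 1)) * U ^ size \<nu>"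
    unfolding subst_sum subst_mult subst_Var 1 ..
  also have "\<dots> = (\<Sum>k=1..Suc n. Const (a * real k * real (count \<nu> k)) * U ^ size \<nu>)"
    by (subst sum.atLeast_Suc_atMost[of 1 "Suc n"]) (simp_all add: sum.shift_bounds_cl_Suc_ivl add.commute del: sum.cl_ivl_Suc)
  also have "\<dots> = Const (a * (\<Sum>k=1..Suc n. real (count \<nu> k) * real k)) * U ^ size \<nu>"
    by (simp add: sum_distrib_left sum_distrib_right Const_sum mult_ac del: sum.cl_ivl_Suc)
  also have "(\<Sum>k=1..Suc n. real (count \<nu> k) * real k) = (\<Sum>x\<in>#\<nu>. real x)"
    using sub by (subst sum_mset_count[of "{1..Suc n}"]) auto
  also have "\<dots> = real n" using \<nu>(2) by auto
  finally show "subst (\<lambda>_. U) (\<Sum>k=1..n. Var k * Jm (Suc k) (mon \<nu>)) + U * subst (\<lambda>_. U) (Jm 1 (mon \<nu>)) =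
     Const (a * real n) * subst (\<lambda>_. U) (mon \<nu>)" by (simp only: constant_subst_mon)
qed (intro islin_rules)+

text \<open>The coefficient of p_1^n, by which \<open>jack\<close> divides.\<close>

definition tcoef :: "nat multiset \<Rightarrow> real" where
  "tcoef \<kappa> = lu (P \<kappa>) (replicate_mset (sum_mset \<kappa>) 1)"

lemma lookup_pdiff: "lu (pdiff v f) \<mu> = real (Suc (count \<mu> v)) * lu f (add_mset v \<mu>)"
proof -
  have "lu (pdiff v f) \<mu> = lu (Var v * pdiff v f) (add_mset v \<mu>)"
    using lookup_mon_mult[of "{#v#}" "pdiff v f" "add_mset v \<mu>"] by (simp add: Var_eq_mon)
  then show ?thesis using lookup_Var_pdiff[of v f "add_mset v \<mu>"] by simp
qed

text \<open>Compares the coefficients of p_1^n in the expansion of the p_1-derivative; this sum over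
  Pieri coefficients is the one that occurs later.\<close>

lemma tcoef_rec:
  assumes "\<kappa> \<in> partitions (Suc n)"
  shows "a * real (Suc n) * tcoef \<kappa> = (\<Sum>\<rho>\<in>partitions n. psi \<rho> \<kappa> * tcoef \<rho> / nsq \<rho>)"
proof -
  have "a * real (Suc n) * tcoef \<kappa> = lu (Jm 1 (P \<kappa>)) (replicate_mset n 1)"
    using assms by (simp add: tcoef_def Jm_def lookup_Const_mult lookup_pdiff partitions_iff)
  also have "\<dots> = (\<Sum>\<rho>\<in>partitions n. psi \<rho> \<kappa> * tcoef \<rho> / nsq \<rho>)"
    unfolding Jm_1_P[OF assms] lookup_sum lookup_Const_mult
    by (intro sum.cong refl) (simp add: tcoef_def partitions_iff)
  finally show ?thesis .
qed

definition content_prod :: "'v mpol \<Rightarrow> nat multiset \<Rightarrow> 'v mpol" where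
  "content_prod U \<kappa> = (\<Prod>v\<in>#cont \<kappa>. U + Const v)"

lemma content_prod_pieri:
  "0 \<notin># \<rho> \<Longrightarrow> 0 \<notin># \<kappa> \<Longrightarrow> psi \<rho> \<kappa> \<noteq> 0 \<Longrightarrow> content_prod U \<kappa> = (U + Const (step \<rho> \<kappa>)) * content_prod U \<rho>"
  by (simp add: content_prod_def cont_pieri)

text \<open>\<open>constant_subst_euler\<close> expresses the value at \<open>\<kappa>\<close>
  through partitions with one box less, each with the factor U + step. This factor completes the
  content product to that of \<open>\<kappa>\<close>, independently of \<open>\<rho>\<close>, and
  \<open>tcoef_rec\<close> evaluates the remaining sum.\<close>

lemma constant_subst_P: "0 \<notin># \<kappa> \<Longrightarrow> subst (\<lambda>_. U) (P \<kappa>) = Const (tcoef \<kappa>) * content_prod U \<kappa>"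
proof (induction "sum_mset \<kappa>" arbitrary: \<kappa>)
  case 0
  then have \<kappa>: "\<kappa> = {#}" by (cases "\<kappa> = {#}") (auto dest: multi_nonempty_split)
  have "x = {#}" if "x \<in> partitions 0" for x using that by (cases x) (auto simp: partitions_iff)
  then have "kys (P {#}) \<subseteq> {{#}}" using keys_P[of "{#}"] by auto
  then have "P {#} = Const (tcoef {#})" using mpol_expand[of "{{#}}" "P {#}"] by (simp add: tcoef_def)
  moreover have "cont {#} = {#}" by (simp add: cont_def)
  ultimately show ?case by (simp add: \<kappa> content_prod_def)
next
  case (Suc n)
  then have \<kappa>: "\<kappa> \<in> partitions (Suc n)" by (simp add: partitions_iff)
  have IH: "subst (\<lambda>_. U) (P \<rho>) = Const (tcoef \<rho>) * content_prod U \<rho>" if "\<rho> \<in> partitions n" for \<rho>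
    using that Suc.hyps(1)[of \<rho>] by (simp add: partitions_iff)
  have kP: "kys (P \<kappa>) \<subseteq> partitions (Suc n)" using keys_P[of \<kappa>] Suc.hyps(2) by simp
  have "Const (a * real (Suc n)) * subst (\<lambda>_. U) (P \<kappa>) =
     (\<Sum>\<rho>\<in>partitions n. Const (psi \<rho> \<kappa> / nsq \<rho>) * ((U + Const (step \<rho> \<kappa>)) * subst (\<lambda>_. U) (P \<rho>)))"
    unfolding constant_subst_euler[OF kP, symmetric] lowering_P[OF \<kappa>] Jm_1_P[OF \<kappa>] subst_sum subst_Const_mult sum_distrib_left sum.distrib[symmetric]
  proof (intro sum.cong refl)
    fix \<rho>
    have eq: "Const (step \<rho> \<kappa> * psi \<rho> \<kappa> / nsq \<rho>) = Const (step \<rho> \<kappa>) * Const (psi \<rho> \<kappa> / nsq \<rho>)"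
      by (simp flip: Const_mult)
    show "Const (step \<rho> \<kappa> * psi \<rho> \<kappa> / nsq \<rho>) * subst (\<lambda>_. U) (P \<rho>) + U * (Const (psi \<rho> \<kappa> / nsq \<rho>) * subst (\<lambda>_. U) (P \<rho>)) =
        Const (psi \<rho> \<kappa> / nsq \<rho>) * ((U + Const (step \<rho> \<kappa>)) * subst (\<lambda>_. U) (P \<rho>))"
      unfolding eq by (simp only: algebra_simps)
  qed
  also have "\<dots> = (\<Sum>\<rho>\<in>partitions n. Const (psi \<rho> \<kappa> * tcoef \<rho> / nsq \<rho>) * content_prod U \<kappa>)"
  proof (intro sum.cong refl)
    fix \<rho> assume \<rho>: "\<rho> \<in> partitions n"
    show "Const (psi \<rho> \<kappa> / nsq \<rho>) * ((U + Const (step \<rho> \<kappa>)) * subst (\<lambda>_. U) (P \<rho>)) = Const (psi \<rho> \<kappa> * tcoef \<rho> / nsq \<rho>) * content_prod U \<kappa>"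
    proof (cases "psi \<rho> \<kappa> = 0")
      case False
      have eq: "Const (psi \<rho> \<kappa> * tcoef \<rho> / nsq \<rho>) = Const (psi \<rho> \<kappa> / nsq \<rho>) * Const (tcoef \<rho>)"
        by (simp flip: Const_mult)
      have "0 \<notin># \<rho>" using \<rho> by (simp add: partitions_iff)
      from content_prod_pieri[OF this Suc.prems False, of U] show ?thesis unfolding eq IH[OF \<rho>] by (simp only: mult_ac)
    qed simp
  qed
  also have "\<dots> = Const (a * real (Suc n)) * (Const (tcoef \<kappa>) * content_prod U \<kappa>)"
    unfolding sum_distrib_right[symmetric] Const_sum[symmetric] tcoef_rec[OF \<kappa>, symmetric] by (simp only: Const_mult mult.assoc)
  finally have "Const (1 / (a * real (Suc n))) * (Const (a * real (Suc n)) * subst (\<lambda>_. U) (P \<kappa>)) =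
      Const (1 / (a * real (Suc n))) * (Const (a * real (Suc n)) * (Const (tcoef \<kappa>) * content_prod U \<kappa>))" by simp
  then show ?case using a_pos by (simp only: mult.assoc[symmetric] Const_mult[symmetric]) (simp add: Const_mult)
qed

text \<open>With as many variables as parts, all set to 1, every power sum equals that number. By
  nonnegativity of the monomial coefficients the value is at least the leading coefficient 1,
  whereas a vanishing \<open>tcoef\<close> would make it 0.\<close>

lemma tcoef_nonzero:
  assumes \<kappa>: "0 \<notin># \<kappa>"
  shows "tcoef \<kappa> \<noteq> 0"
proof
  assume "tcoef \<kappa> = 0"
  then have zero: "subst (\<lambda>_. Const (real (size \<kappa>)) :: nat mpol) (P \<kappa>) = 0" using constant_subst_P[OF \<kappa>] by simp
  let ?g = "in_vars (size \<kappa>) (P \<kappa>)"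
  have "subst (\<lambda>_. 1 :: nat mpol) ?g = 0"
    unfolding zero[symmetric] by (simp add: in_vars_def subst_subst subst_sum subst_power Const_of_nat)
  moreover have "subst (\<lambda>_. 1 :: nat mpol) ?g = Const (\<Sum>\<alpha>\<in>kys ?g. lu ?g \<alpha>)"
    unfolding islin_expand[OF islin_subst, of _ ?g] by (simp add: constant_subst_mon Const_sum)
  ultimately have sum: "(\<Sum>\<alpha>\<in>kys ?g. lu ?g \<alpha>) = 0" by simp
  have nonneg: "lu ?g \<alpha> \<ge> 0" for \<alpha>
    using cc_properties[OF \<kappa>] by (simp add: lookup_in_vars mcoeff_P[OF \<kappa>])
  have "lu ?g (std \<kappa>) = 1"
    using std[OF \<kappa>] by (simp add: lookup_in_vars mcoeff_P[OF \<kappa>] \<kappa>)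
  moreover have "lu ?g (std \<kappa>) \<le> (\<Sum>\<alpha>\<in>kys ?g. lu ?g \<alpha>)"
    using nonneg \<open>lu ?g (std \<kappa>) = 1\<close> by (intro member_le_sum) (auto simp: in_keys_iff)
  ultimately show False using sum by simp
qed

section \<open>Cut-and-join operators\<close>

definition Tm :: "nat \<Rightarrow> nat mpol \<Rightarrow> nat mpol" where
  "Tm n f = (\<Sum>k=1..<n. Jm (n - k) (Jm k f))"

text \<open>\<open>F 2\<close> yields p_(k+1-t) p_t only for t < k. The summand with
  \<open>H 1\<close> supplies the missing t = k, so that all splittings of k + 1 into two positive
  parts occur. The result is sorted by the index i of an outer factor p_i, to be compared with the
  constraint operators.\<close>

lemma F_2_expand:
  assumes f: "kys f \<subseteq> partitions n"
  shows "F 2 f + Var 1 * H 1 f = (\<Sum>i=1..Suc n. Var i *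
    (Tm (i - 1) f + (\<Sum>k=1..n. Var k * Jm (i - 1 + k) f) + Const ((a - 1) * real (i - 1)) * Jm (i - 1) f))"
proof -
  note fs = symfuns_homogeneous[OF f]
  have hJ: "kys (Jm k f) \<subseteq> partitions (n - k)" for k by (rule homogeneous_Jm[OF f])
  have JJ0: "Jm l (Jm k f) = 0" if "n < k + l" for k l
    using that Jm_zero[OF hJ[of k], of l] Jm_zero[OF f, of k] islin_0[OF islin_Jm, of l] by (cases "k \<le> n") auto
  have one: "pr (Var 0 * Z (Var 0 ^ k * Jm k f)) =
      (\<Sum>l=1..n. Var (Suc (k + l)) * Jm l (Jm k f)) + (\<Sum>t=1..<k. Var (Suc k - t) * (Var t * Jm k f))
      + Const ((a - 1) * real k) * (Var (Suc k) * Jm k f)" if k: "k \<noteq> 0" for k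
  proof -
    let ?g = "Jm k f"
    note gs = Jm_in_symfuns[OF fs, of k]
    have "Jp ?g = (\<Sum>l=1..n. Var 0 ^ l * Jm l ?g)" by (rule Jp_homogeneous[OF hJ]) simp
    then have "Var 0 * (Var 0 ^ k * Jp ?g) = (\<Sum>l=1..n. Var 0 ^ Suc (k + l) * Jm l ?g)"
      by (simp add: sum_distrib_left power_add mult_ac)
    then have 1: "pr (Var 0 * (Var 0 ^ k * Jp ?g)) = (\<Sum>l=1..n. Var (Suc (k + l)) * Jm l ?g)"
      by (simp only: pr_sum pr_w_power[OF Jm_in_symfuns[OF gs]]) simp
    have "Var 0 * Pm (Var 0 ^ k * ?g) = (\<Sum>t=1..<k. Var 0 ^ (Suc k - t) * (Var t * ?g))"
      unfolding Pm_w_power[OF gs] sum_distrib_left by (intro sum.cong refl) (auto simp: Suc_diff_le mult.assoc)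
    then have "pr (Var 0 * Pm (Var 0 ^ k * ?g)) = (\<Sum>t=1..<k. pr (Var 0 ^ (Suc k - t) * (Var t * ?g)))"
      by (simp only: pr_sum)
    also have "\<dots> = (\<Sum>t=1..<k. Var (Suc k - t) * (Var t * ?g))"
      using gs by (intro sum.cong refl, subst pr_w_power) auto
    finally have 2: "pr (Var 0 * Pm (Var 0 ^ k * ?g)) = (\<Sum>t=1..<k. Var (Suc k - t) * (Var t * ?g))" .
    have 3: "pr (Var 0 * (Var 0 ^ k * ?g)) = Var (Suc k) * ?g"
      using pr_w_power[OF gs, of "Suc k"] by (simp add: mult.assoc)
    show ?thesis
      unfolding Z_def Jp_w_power th_w_power[OF gs] distrib_left mult.left_commute[of "Var 0" "Const _"] pr_add pr_Const 1 2 3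
      by (simp add: Const_mult mult.assoc)
  qed
  have Zf: "Z f = (\<Sum>k=1..n. Var 0 ^ k * Jm k f)"
    using Jp_homogeneous[OF f order_refl] by (simp add: Z_symfuns[OF fs])
  have F2: "F 2 f = (\<Sum>k=1..n. (\<Sum>l=1..n. Var (Suc (k + l)) * Jm l (Jm k f)) + (\<Sum>t=1..<k. Var (Suc k - t) * (Var t * Jm k f))
      + Const ((a - 1) * real k) * (Var (Suc k) * Jm k f))"
    unfolding F_def numeral_2_eq_2 funpow.simps comp_apply id_apply Zf islin_sum[OF islin_Z] sum_distrib_left pr_sum
    by (intro sum.cong refl one) auto
  have "H 1 f = (\<Sum>k=1..n. Var k * Jm k f)"
    unfolding H_def One_nat_def funpow.simps comp_apply id_apply Zf pr_sum
    by (intro sum.cong refl, subst pr_w_power[OF Jm_in_symfuns[OF fs]]) auto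
  then have H1: "Var 1 * H 1 f = (\<Sum>k=1..n. Var (Suc k - k) * (Var k * Jm k f))"
    by (simp add: sum_distrib_left)
  have t: "(\<Sum>t=1..<k. Var (Suc k - t) * (Var t * Jm k f)) + Var (Suc k - k) * (Var k * Jm k f)
      = (\<Sum>t=1..k. Var (Suc k - t) * (Var t * Jm k f))" if "k \<in> {1..n}" for k
    using that by (simp add: atLeastLessThanSuc_atLeastAtMost[symmetric])
  have "F 2 f + Var 1 * H 1 f = (\<Sum>k=1..n. \<Sum>l=1..n. Var (Suc (k + l)) * Jm l (Jm k f))
      + (\<Sum>k=1..n. \<Sum>t=1..k. Var (Suc k - t) * (Var t * Jm k f))
      + (\<Sum>k=1..n. Const ((a - 1) * real k) * (Var (Suc k) * Jm k f))"
  proof -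
    have "F 2 f + Var 1 * H 1 f = (\<Sum>k=1..n. (\<Sum>l=1..n. Var (Suc (k + l)) * Jm l (Jm k f))
        + ((\<Sum>t=1..<k. Var (Suc k - t) * (Var t * Jm k f)) + Var (Suc k - k) * (Var k * Jm k f))
        + Const ((a - 1) * real k) * (Var (Suc k) * Jm k f))"
      unfolding F2 H1 sum.distrib[symmetric] by (intro sum.cong refl) (simp only: add_ac)
    also have "\<dots> = (\<Sum>k=1..n. (\<Sum>l=1..n. Var (Suc (k + l)) * Jm l (Jm k f))
        + (\<Sum>t=1..k. Var (Suc k - t) * (Var t * Jm k f))
        + Const ((a - 1) * real k) * (Var (Suc k) * Jm k f))"
      by (intro sum.cong refl) (simp only: t)
    finally show ?thesis by (simp only: sum.distrib)
  qed
  also have "(\<Sum>k=1..n. \<Sum>l=1..n. Var (Suc (k + l)) * Jm l (Jm k f)) = (\<Sum>i=1..Suc n. Var i * Tm (i - 1) f)"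
  proof -
    have "(\<Sum>i=1..Suc n. Var i * Tm (i - 1) f) = (\<Sum>(i, k)\<in>Sigma {1..Suc n} (\<lambda>i. {1..<i - 1}). Var i * Jm (i - 1 - k) (Jm k f))"
      unfolding Tm_def sum_distrib_left by (subst sum.Sigma) auto
    \<comment> \<open>Here i = k + l + 1; pairs with k + l > n, added next, vanish for degree
      reasons.\<close>
    also have "\<dots> = (\<Sum>(k, l)\<in>{(k, l) \<in> {1..n} \<times> {1..n}. k + l \<le> n}. Var (Suc (k + l)) * Jm l (Jm k f))"
      by (rule sum.reindex_bij_witness[of _ "\<lambda>(k, l). (Suc (k + l), k)" "\<lambda>(i, k). (k, i - 1 - k)"]) auto
    also have "\<dots> = (\<Sum>(k, l)\<in>{1..n} \<times> {1..n}. Var (Suc (k + l)) * Jm l (Jm k f))"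
      by (rule sum.mono_neutral_left) (auto, metis JJ0 mult_zero_right not_le)
    finally show ?thesis by (simp add: sum.cartesian_product)
  qed
  also have "(\<Sum>k=1..n. \<Sum>t=1..k. Var (Suc k - t) * (Var t * Jm k f)) = (\<Sum>i=1..Suc n. Var i * (\<Sum>k=1..n. Var k * Jm (i - 1 + k) f))"
  proof -
    have "(\<Sum>k=1..n. \<Sum>t=1..k. Var (Suc k - t) * (Var t * Jm k f)) = (\<Sum>(k, t)\<in>Sigma {1..n} (\<lambda>k. {1..k}). Var (Suc k - t) * (Var t * Jm k f))"
      by (subst sum.Sigma) auto
    also have "\<dots> = (\<Sum>(i, k)\<in>{(i, k) \<in> {1..Suc n} \<times> {1..n}. i - 1 + k \<le> n}. Var i * (Var k * Jm (i - 1 + k) f))"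
      by (rule sum.reindex_bij_witness[of _ "\<lambda>(i, k). (i - 1 + k, k)" "\<lambda>(k, t). (Suc k - t, t)"]) auto
    also have "\<dots> = (\<Sum>(i, k)\<in>{1..Suc n} \<times> {1..n}. Var i * (Var k * Jm (i - 1 + k) f))"
      by (rule sum.mono_neutral_left) (auto, metis Jm_zero[OF f] mult_zero_right not_le)
    finally show ?thesis unfolding sum_distrib_left sum.cartesian_product .
  qed
  also have "(\<Sum>k=1..n. Const ((a - 1) * real k) * (Var (Suc k) * Jm k f)) = (\<Sum>i=1..Suc n. Var i * (Const ((a - 1) * real (i - 1)) * Jm (i - 1) f))"
    by (subst (2) sum.atLeast_Suc_atMost) (simp_all add: sum.shift_bounds_cl_Suc_ivl mult.left_commute del: sum.cl_ivl_Suc)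
  finally show ?thesis by (simp only: distrib_left sum.distrib)
qed

lemma Jm_0: "Jm 0 f = 0"
  by (simp add: Jm_def)

lemma F_1_expand':
  assumes "kys f \<subseteq> partitions n"
  shows "F 1 f = (\<Sum>i=1..Suc n. Var i * Jm (i - 1) f)"
  unfolding F_1_expand[OF assms order_refl]
  by (subst (2) sum.atLeast_Suc_atMost) (simp_all add: Jm_0 sum.shift_bounds_cl_Suc_ivl del: sum.cl_ivl_Suc)

text \<open>The matrix elements are \<open>psi\<close> times 1, step and step squared. For
  \<open>F 2\<close> the recursion leaves a term -h_1 psi, which p_1 \<open>H 1\<close>
  compensates.\<close>

lemma P_raise:
  assumes \<rho>: "\<rho> \<in> partitions n"
  shows "F 0 (P \<rho>) = (\<Sum>\<kappa>\<in>partitions (Suc n). Const (psi \<rho> \<kappa> / nsq \<kappa>) * P \<kappa>)" (is ?A)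
    and "F 1 (P \<rho>) = (\<Sum>\<kappa>\<in>partitions (Suc n). Const (step \<rho> \<kappa> * psi \<rho> \<kappa> / nsq \<kappa>) * P \<kappa>)" (is ?B)
    and "F 2 (P \<rho>) + Var 1 * H 1 (P \<rho>) =
      (\<Sum>\<kappa>\<in>partitions (Suc n). Const (step \<rho> \<kappa> * step \<rho> \<kappa> * psi \<rho> \<kappa> / nsq \<kappa>) * P \<kappa>)" (is ?C)
proof -
  have \<rho>0: "0 \<notin># \<rho>" using \<rho> by (simp add: partitions_iff)
  note m = matrix_F[OF \<rho>0]
  show ?A
    using psi_expand[OF F_in_symfuns \<rho>, of 0 "P \<rho>" "\<lambda>_. 1"] m by simp
  show ?B
    by (rule psi_expand[OF F_in_symfuns \<rho>]) (simp add: m h_def)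
  have "ip (F 2 (P \<rho>) + Var 1 * H 1 (P \<rho>)) (P \<kappa>) = step \<rho> \<kappa> * step \<rho> \<kappa> * psi \<rho> \<kappa>" if "0 \<notin># \<kappa>" for \<kappa>
  proof -
    have "ip (Var 1 * H 1 (P \<rho>)) (P \<kappa>) = h 1 \<rho> * psi \<rho> \<kappa>"
      by (simp only: H_P[OF \<rho>0] mult.left_commute[of "Var 1"] ip_Const_left psi_def)
    then show ?thesis
      unfolding ip_add_left numeral_2_eq_2 m[OF that] One_nat_def by (simp add: h_def)
  qed
  then show ?C
    by (intro psi_expand[OF _ \<rho>]) (auto intro!: symfuns_add symfuns_mult)
qed

end

section \<open>Virasoro relations\<close>

text \<open>A commutator of derivations is a derivation, so its values on variables determine
  it.\<close>

lemma der_commutator: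
  assumes "\<And>v. der g1 (g2 v) - der g2 (g1 v) = der g3 (Var v)"
  shows "der g1 (der g2 f) - der g2 (der g1 f) = der g3 f"
proof (rule islin_ext[of "\<lambda>f. der g1 (der g2 f) - der g2 (der g1 f)"])
  fix \<mu> show "der g1 (der g2 (mon \<mu>)) - der g2 (der g1 (mon \<mu>)) = der g3 (mon \<mu>)"
  proof (induction \<mu>)
    case (add v \<mu>)
    have "der g1 (der g2 (mon (add_mset v \<mu>))) - der g2 (der g1 (mon (add_mset v \<mu>))) =
       (der g1 (g2 v) - der g2 (g1 v)) * mon \<mu> + Var v * (der g1 (der g2 (mon \<mu>)) - der g2 (der g1 (mon \<mu>)))"
      by (simp add: der_mon_add_mset der_add der_mult algebra_simps)
    then show ?case unfolding assms add by (simp add: der_mon_add_mset)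
  qed (simp add: der_0)
qed (intro islin_rules)+

text \<open>The polynomials in the \<open>u\<^sub>j\<close> and \<open>q\<^sub>i\<close> are the constants of all derivations used below.\<close>

definition pfree :: "var mpol \<Rightarrow> bool" where
  "pfree f \<longleftrightarrow> (\<forall>k. pdiff (PV k) f = 0)"

context jack_parameter
begin

definition jg :: "nat \<Rightarrow> var \<Rightarrow> var mpol" where
  "jg k v = (if v = PV k then Const (a * real k) else 0)"

text \<open>Makes \<open>Sv n\<close> the sum over k of p_k J_(n+k); as a derivation it needs no
  infinite sum.\<close>

definition sg :: "nat \<Rightarrow> var \<Rightarrow> var mpol" where
  "sg n v = (case v of PV l \<Rightarrow> if n < l then Const (a * real l) * Var (PV (l - n)) else 0 | _ \<Rightarrow> 0)"

definition eg :: "var \<Rightarrow> var mpol" where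
  "eg v = (case v of PV l \<Rightarrow> Const (real l) * Var (PV l) | _ \<Rightarrow> 0)"

abbreviation "Jv k \<equiv> der (jg k)"
abbreviation "Sv n \<equiv> der (sg n)"
abbreviation "Eu \<equiv> der eg"

definition Tv :: "nat \<Rightarrow> var mpol \<Rightarrow> var mpol" where
  "Tv n f = (\<Sum>k=1..<n. Jv (n - k) (Jv k f))"

lemma islin_Tv [islin_rules]: "islin (Tv n)"
  unfolding Tv_def by (intro islin_rules)

lemmas [islin_rules] = islin_comp[OF islin_Tv]

lemma Jv_pdiff: "Jv k f = Const (a * real k) * pdiff (PV k) f"
proof -
  have "Jv k f = (\<Sum>v\<in>{PV k}. jg k v * pdiff v f)" by (rule der_expand) (auto simp: jg_def)
  then show ?thesis by (simp add: jg_def)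
qed

lemma Jv_0 [simp]: "Jv 0 f = 0"
  by (simp add: Jv_pdiff)

lemma der_zero: "der (\<lambda>_. 0) f = 0"
  by (simp add: der_def lin_def)

lemma Jv_Jv: "Jv k (Jv l f) = Jv l (Jv k f)"
proof -
  have "Jv k (Jv l f) - Jv l (Jv k f) = der (\<lambda>_. 0) f"
    by (rule der_commutator) (simp add: jg_def der_0 der_zero)
  then show ?thesis by (simp add: der_zero)
qed

lemma der_Const_scale: "der (\<lambda>v. Const c * g v) f = Const c * der g f"
  by (rule islin_ext[of "der (\<lambda>v. Const c * g v)"])
    (auto simp: der_mon mult.assoc sum_mset_distrib_left intro!: islin_rules)

lemma Sv_Jv: "Sv n (Jv l f) = Jv l (Sv n f) - Const (a * real l) * Jv (n + l) f"
proof -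
  have "Sv n (Jv l f) - Jv l (Sv n f) = der (\<lambda>v. Const (- (a * real l)) * jg (n + l) v) f"
  proof (rule der_commutator)
    fix v
    show "Sv n (jg l v) - Jv l (sg n v) = der (\<lambda>v. Const (- (a * real l)) * jg (n + l) v) (Var v)"
    proof (cases v)
      case (PV m)
      have "Sv n (jg l v) = 0" by (simp add: jg_def der_0)
      moreover have "Jv l (sg n v) = (if n < m \<and> m - n = l then Const (a * real m) * Const (a * real l) else 0)"
        by (simp add: sg_def PV der_Const_mult der_0) (simp add: jg_def)
      ultimately show ?thesis
        by (cases "l = 0") (auto simp: PV jg_def Const_uminus simp flip: Const_mult)
    qed (auto simp: jg_def sg_def der_0)
  qed
  then show ?thesis unfolding der_Const_scale by (simp add: Const_uminus algebra_simps)
qed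

lemma Sv_Sv: "Sv n (Sv m f) = Sv m (Sv n f) + Const (a * (real n - real m)) * Sv (n + m) f"
proof -
  have "Sv n (Sv m f) - Sv m (Sv n f) = der (\<lambda>v. Const (a * (real n - real m)) * sg (n + m) v) f"
  proof (rule der_commutator)
    fix v
    have *: "Sv n (sg m v) = (case v of PV l \<Rightarrow> if n + m < l then Const (a * real l * (a * (real l - real m))) * Var (PV (l - (n + m))) else 0 | _ \<Rightarrow> 0)" for n m
      by (auto simp: sg_def der_0 der_Const_mult Const_mult of_nat_diff mult.assoc add.commute split: var.splits)
    show "Sv n (sg m v) - Sv m (sg n v) = der (\<lambda>v. Const (a * (real n - real m)) * sg (n + m) v) (Var v)"
    proof (cases v)
      case (PV l)
      have "Const (a * real l * (a * (real l - real m))) - Const (a * real l * (a * (real l - real n))) =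
          Const (a * (real n - real m)) * Const (a * real l)"
        unfolding Const_mult[symmetric] Const_diff[symmetric] by (simp add: algebra_simps)
      then have e: "Const (a * real l * (a * (real l - real m))) * X - Const (a * real l * (a * (real l - real n))) * X =
          Const (a * (real n - real m)) * (Const (a * real l) * X)" for X
        unfolding left_diff_distrib[symmetric] mult.assoc[of _ _ X, symmetric] by (rule arg_cong)
      show ?thesis unfolding * by (simp add: PV sg_def add.commute[of m n] e)
    qed (simp_all add: * sg_def der_0)
  qed
  then show ?thesis unfolding der_Const_scale by (simp add: algebra_simps)
qed

lemma Eu_Jv: "Eu (Jv k f) = Jv k (Eu f) - Const (real k) * Jv k f"
proof -
  have "Eu (Jv k f) - Jv k (Eu f) = der (\<lambda>v. Const (- real k) * jg k v) f"
    by (rule der_commutator)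
      (auto simp: eg_def jg_def der_0 der_Const_mult Const_uminus mult.commute split: var.splits)
  then show ?thesis unfolding der_Const_scale by (simp add: Const_uminus algebra_simps)
qed

lemma Eu_Sv: "Eu (Sv n f) = Sv n (Eu f) - Const (real n) * Sv n f"
proof -
  have "Eu (Sv n f) - Sv n (Eu f) = der (\<lambda>v. Const (- real n) * sg n v) f"
    by (rule der_commutator)
      (auto simp: eg_def sg_def der_0 der_Const_mult Const_uminus of_nat_diff Const_diff algebra_simps split: var.splits)
  then show ?thesis unfolding der_Const_scale by (simp add: Const_uminus algebra_simps)
qed

lemma Eu_Tv: "Eu (Tv n f) = Tv n (Eu f) - Const (real n) * Tv n f"
proof -
  have "Eu (Jv (n - k) (Jv k f)) = Jv (n - k) (Jv k (Eu f)) - Const (real n) * Jv (n - k) (Jv k f)" if "k \<in> {1..<n}" for k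
    using that by (simp add: Eu_Jv der_diff der_Const_mult of_nat_diff Const_diff algebra_simps)
  then show ?thesis
    unfolding Tv_def der_sum sum_distrib_left sum_subtractf[symmetric] by (intro sum.cong) auto
qed

lemma Jv_Tv: "Jv i (Tv n f) = Tv n (Jv i f)"
  unfolding Tv_def der_sum by (intro sum.cong refl) (simp add: Jv_Jv[of i])

lemma Tv_Tv: "Tv n (Tv m f) = Tv m (Tv n f)"
  by (simp add: Tv_def[of n] Tv_def[of n "Tv m f"] islin_sum[OF islin_Tv] flip: Jv_Tv)

lemma Sv_Tv: "Sv n (Tv m f) = Tv m (Sv n f) -
   Const (2 * a) * (\<Sum>k=1..<n + m. Const (real (m - k)) * Jv k (Jv (n + m - k) f))"
proof -
  define c :: "nat \<Rightarrow> var mpol" where "c k = Const (a * real k)" for k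
  have "Sv n (Jv (m - k) (Jv k f)) = Jv (m - k) (Jv k (Sv n f)) - c k * Jv (m - k) (Jv (n + k) f)
      - c (m - k) * Jv (n + (m - k)) (Jv k f)" for k
    by (simp add: Sv_Jv der_diff der_Const_mult c_def)
  then have "Sv n (Tv m f) = Tv m (Sv n f) - (\<Sum>k=1..<m. c k * Jv (m - k) (Jv (n + k) f))
      - (\<Sum>k=1..<m. c (m - k) * Jv (n + (m - k)) (Jv k f))"
    by (simp add: Tv_def der_sum sum_subtractf)
  also have "(\<Sum>k=1..<m. c k * Jv (m - k) (Jv (n + k) f)) = (\<Sum>k=1..<m. c (m - k) * Jv k (Jv (n + (m - k)) f))"
    by (rule sum.reindex_bij_witness[of _ "\<lambda>k. m - k" "\<lambda>k. m - k"]) auto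
  also have "(\<Sum>k=1..<m. c (m - k) * Jv (n + (m - k)) (Jv k f)) = (\<Sum>k=1..<m. c (m - k) * Jv k (Jv (n + (m - k)) f))"
    by (simp add: Jv_Jv)
  also have "(\<Sum>k=1..<m. c (m - k) * Jv k (Jv (n + (m - k)) f)) = (\<Sum>k=1..<m. c (m - k) * Jv k (Jv (n + m - k) f))"
    by (intro sum.cong refl) auto
  also have "\<dots> = (\<Sum>k=1..<n + m. c (m - k) * Jv k (Jv (n + m - k) f))"
    by (rule sum.mono_neutral_left) (auto simp: c_def)
  also have "\<dots> = Const a * (\<Sum>k=1..<n + m. Const (real (m - k)) * Jv k (Jv (n + m - k) f))"
    by (simp add: c_def Const_mult sum_distrib_left mult.assoc)
  finally show ?thesis by (simp add: Const_mult Const_numeral algebra_simps)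
qed

text \<open>The sums from \<open>Sv_Tv\<close> are averaged with their reflections of k into n + m -
  k. Truncated weights then pair up by max(x,0) - max(-x,0) = x, giving (n - k) + (k - m) = n - m
  for every k.\<close>

lemma Sv_Tv_antisym:
  "(Sv n (Tv m f) - Tv m (Sv n f)) - (Sv m (Tv n f) - Tv n (Sv m f)) = Const (a * (real n - real m)) * Tv (n + m) f"
proof -
  let ?N = "n + m"
  define X where "X k = Jv k (Jv (?N - k) f)" for k
  have T: "Tv ?N f = (\<Sum>k=1..<?N. X k)"
    unfolding Tv_def X_def by (simp add: Jv_Jv)
  have flip: "(\<Sum>k=1..<?N. Const (real (j - k)) * X k) = (\<Sum>k=1..<?N. Const (real (j - (?N - k))) * X k)" for j
    by (rule sum.reindex_bij_witness[of _ "\<lambda>k. ?N - k" "\<lambda>k. ?N - k"]) (auto simp: X_def Jv_Jv)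
  have "2 * ((\<Sum>k=1..<?N. Const (real (n - k)) * X k) - (\<Sum>k=1..<?N. Const (real (m - k)) * X k))
     = (\<Sum>k=1..<?N. Const (real (n - k)) * X k) - (\<Sum>k=1..<?N. Const (real (m - k)) * X k)
     + ((\<Sum>k=1..<?N. Const (real (n - (?N - k))) * X k) - (\<Sum>k=1..<?N. Const (real (m - (?N - k))) * X k))"
    unfolding flip[symmetric] by simp
  also have "\<dots> = (\<Sum>k=1..<?N. Const (real n - real m) * X k)"
    unfolding sum_subtractf[symmetric] sum.distrib[symmetric]
  proof (intro sum.cong refl)
    fix k assume k: "k \<in> {1..<?N}"
    have "real (n - k) - real (m - k) + (real (n - (?N - k)) - real (m - (?N - k))) = real n - real m"
      using k by (cases "k \<le> n"; cases "k \<le> m") (auto simp: of_nat_diff)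
    then have "Const (real n - real m) * X k = Const (real (n - k) - real (m - k) + (real (n - (?N - k)) - real (m - (?N - k)))) * X k"
      by simp
    also have "\<dots> = Const (real (n - k)) * X k - Const (real (m - k)) * X k + (Const (real (n - (?N - k))) * X k - Const (real (m - (?N - k))) * X k)"
      by (simp only: Const_add Const_diff left_diff_distrib distrib_right)
    finally show "Const (real (n - k)) * X k - Const (real (m - k)) * X k + (Const (real (n - (?N - k))) * X k - Const (real (m - (?N - k))) * X k)
        = Const (real n - real m) * X k" ..
  qed
  finally have "Const (2 * a) * ((\<Sum>k=1..<?N. Const (real (n - k)) * X k) - (\<Sum>k=1..<?N. Const (real (m - k)) * X k))
      = Const a * (\<Sum>k=1..<?N. Const (real n - real m) * X k)"
    by (simp add: Const_mult Const_numeral mult.assoc mult.left_commute)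
  also have "Const a * (\<Sum>k=1..<?N. Const (real n - real m) * X k) = Const (a * (real n - real m)) * Tv ?N f"
    by (simp only: T Const_mult[of a] sum_distrib_left mult.assoc)
  finally have *: "Const (2 * a) * (\<Sum>k=1..<?N. Const (real (n - k)) * X k) - Const (2 * a) * (\<Sum>k=1..<?N. Const (real (m - k)) * X k)
      = Const (a * (real n - real m)) * Tv ?N f"
    by (simp only: right_diff_distrib)
  show ?thesis
    unfolding *[symmetric] Sv_Tv[of n m] Sv_Tv[of m n] by (simp add: X_def add.commute[of m n])
qed

lemma pfree_Const [simp]: "pfree (Const c)"
  by (simp add: pfree_def pdiff_eq_der)

lemma pfree_UV [simp]: "pfree (Var (UV j))"
  by (simp add: pfree_def pdiff_Var)

lemma pfree_add: "pfree f \<Longrightarrow> pfree g \<Longrightarrow> pfree (f + g)"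
  by (simp add: pfree_def islin_add[OF islin_pdiff])

lemma pfree_mult: "pfree f \<Longrightarrow> pfree g \<Longrightarrow> pfree (f * g)"
  by (simp add: pfree_def pdiff_mult)

lemma pfree_prod_mset: "(\<And>x. x \<in># M \<Longrightarrow> pfree (f x)) \<Longrightarrow> pfree (\<Prod>x\<in>#M. f x)"
proof (induction M)
  case empty
  then show ?case using pfree_Const[of 1] by simp
qed (auto intro: pfree_mult)

lemma der_pfree:
  assumes "pfree u" "\<And>v. (\<forall>l. v \<noteq> PV l) \<Longrightarrow> g v = 0"
  shows "der g u = 0"
proof -
  have "der g u = (\<Sum>v\<in>\<Union>(set_mset ` kys u). g v * pdiff v u)"
    by (rule der_expand) auto
  also have "\<dots> = 0" using assms by (intro sum.neutral) (auto simp: pfree_def, metis mult_zero_left mult_zero_right)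
  finally show ?thesis .
qed

lemma Jv_pfree: "pfree u \<Longrightarrow> Jv k (u * f) = u * Jv k f"
  and Sv_pfree: "pfree u \<Longrightarrow> Sv n (u * f) = u * Sv n f"
  and Eu_pfree: "pfree u \<Longrightarrow> Eu (u * f) = u * Eu f"
  using der_pfree[of u "jg k"] der_pfree[of u "sg n"] der_pfree[of u eg]
  by (auto simp: der_mult jg_def sg_def eg_def split: var.splits)

lemma Tv_pfree: "pfree u \<Longrightarrow> Tv n (u * f) = u * Tv n f"
  by (simp add: Tv_def Jv_pfree sum_distrib_left)

definition s1 :: "var mpol" where "s1 = Var (UV 1) + Var (UV 2)"
definition s2 :: "var mpol" where "s2 = Var (UV 1) * Var (UV 2)"

definition Vc :: "nat \<Rightarrow> var mpol" where
  "Vc n = Const ((a - 1) * real n) + s1"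

lemma pfree_Vc: "pfree (Vc n)" and pfree_s2: "pfree s2"
  by (simp_all add: Vc_def s1_def s2_def pfree_add pfree_mult)

text \<open>\<open>\<alpha>\<close> times the operator \<open>A\<^sub>n\<^sub>+\<^sub>1(2) + e\<^sub>1 A\<^sub>n\<^sub>+\<^sub>1(1) + e\<^sub>2 A\<^sub>n\<^sub>+\<^sub>1(0)\<close>.\<close>

definition Av :: "nat \<Rightarrow> var mpol \<Rightarrow> var mpol" where
  "Av n f = Tv n f + Sv n f + Vc n * Jv n f + (if n = 0 then s2 * f else 0)"

lemma islin_Av: "islin (Av n)"
proof -
  have *: "islin (\<lambda>f. if n = 0 then s2 * f else 0)" by (cases "n = 0") (auto intro!: islin_rules)
  show ?thesis unfolding Av_def by (intro islin_rules *)
qed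

lemma Vc_antisym: "Const (a * real n) * Vc n - Const (a * real m) * Vc m = Const (a * (real n - real m)) * Vc (n + m)"
proof -
  have "Const (a * real n) * Const ((a - 1) * real n) - Const (a * real m) * Const ((a - 1) * real m)
      = Const (a * (real n - real m)) * Const ((a - 1) * real (n + m))"
    unfolding Const_mult[symmetric] Const_diff[symmetric] by (simp add: algebra_simps)
  moreover have "Const (a * real n) * s1 - Const (a * real m) * s1 = Const (a * (real n - real m)) * s1"
    by (simp add: Const_diff algebra_simps)
  ultimately show ?thesis by (simp add: Vc_def algebra_simps)
qed

text \<open>Virasoro relations for nonnegative indices. Second-order parts commute among themselves,
  so everything arises from commutators with the first-order part \<open>Sv\<close>.\<close>

lemma Av_commutator: "Av n (Av m f) - Av m (Av n f) = Const (a * (real n - real m)) * Av (n + m) f"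
proof -
  define D where "D k f = (if k = 0 then s2 * f else 0)" for k :: nat and f
  have D: "Tv n (D m f) = D m (Tv n f)" "Sv n (D m f) = D m (Sv n f)" "Jv n (D m f) = D m (Jv n f)" "u * D m f = D m (u * f)"
    "D m (f + f') = D m f + D m f'" "D m (D n f) = D n (D m f)" for n m f f' u
    by (auto simp: D_def Tv_pfree Sv_pfree Jv_pfree pfree_s2 islin_0[OF islin_Tv] der_0 distrib_left mult.left_commute)
  have A: "Av k f = Tv k f + Sv k f + Vc k * Jv k f + D k f" for k f by (simp add: Av_def D_def)
  have AA: "Av n (Av m f) = Tv n (Tv m f) + Tv n (Sv m f) + Vc m * Tv n (Jv m f) + D m (Tv n f)
      + (Sv n (Tv m f) + Sv n (Sv m f) + Vc m * Sv n (Jv m f) + D m (Sv n f))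
      + (Vc n * Jv n (Tv m f) + Vc n * Jv n (Sv m f) + Vc n * (Vc m * Jv n (Jv m f)) + D m (Vc n * Jv n f))
      + (D n (Tv m f) + D n (Sv m f) + D n (Vc m * Jv m f) + D n (D m f))" for n m
    unfolding A by (simp add: islin_add[OF islin_Tv] der_add Tv_pfree Sv_pfree Jv_pfree pfree_Vc D distrib_left)
  \<comment> \<open>n + m = 0 forces n = m, so the scalar term s2 on the right side has coefficient
    0.\<close>
  have Dz: "Const (a * (real n - real m)) * D (n + m) f = 0" by (simp add: D_def)
  have "Av n (Av m f) - Av m (Av n f) =
      ((Sv n (Tv m f) - Tv m (Sv n f)) - (Sv m (Tv n f) - Tv n (Sv m f)))
      + (Sv n (Sv m f) - Sv m (Sv n f))
      + (Vc m * (Sv n (Jv m f) - Jv m (Sv n f)) - Vc n * (Sv m (Jv n f) - Jv n (Sv m f)))"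
    unfolding AA using Tv_Tv[of n m f] Jv_Tv[of n m f] Jv_Tv[of m n f] Jv_Jv[of n m f] D(6)[of m n f]
    by (simp add: right_diff_distrib mult.left_commute)
  also have "Vc m * (Sv n (Jv m f) - Jv m (Sv n f)) - Vc n * (Sv m (Jv n f) - Jv n (Sv m f)) =
      (Const (a * real n) * Vc n - Const (a * real m) * Vc m) * Jv (n + m) f"
    unfolding Sv_Jv by (simp add: algebra_simps)
  also have "Sv n (Sv m f) - Sv m (Sv n f) = Const (a * (real n - real m)) * Sv (n + m) f"
    unfolding Sv_Sv[of n m f] by simp
  finally show ?thesis
    unfolding Sv_Tv_antisym Vc_antisym A using Dz by (simp add: distrib_left mult.assoc)
qed

text \<open>\<open>Sv\<close> is the only summand that does not commute with
  \<open>Jv\<close>.\<close>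

lemma Jv_Av: "Jv i (Av m f) = Av m (Jv i f) + Const (a * real i) * Jv (m + i) f"
  unfolding Av_def
  by (simp add: der_add Jv_Tv Sv_Jv Jv_pfree pfree_Vc pfree_s2 Jv_Jv[of m i] algebra_simps der_0)

lemma Eu_Av: "Eu f = Const x * f \<Longrightarrow> Eu (Av n f) = Const (x - real n) * Av n f"
proof -
  assume e: "Eu f = Const x * f"
  have "Eu (Tv n f) = Const (x - real n) * Tv n f" "Eu (Sv n f) = Const (x - real n) * Sv n f"
      "Eu (Jv n f) = Const (x - real n) * Jv n f"
    by (simp_all add: Eu_Tv Eu_Sv Eu_Jv e islin_Const[OF islin_Tv] der_Const_mult Const_diff left_diff_distrib)
  then show ?thesis
    unfolding Av_def by (auto simp: der_add Eu_pfree pfree_Vc pfree_s2 e distrib_left mult.left_commute der_0)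
qed

section \<open>The grading by degree in the variables p_i\<close>

definition wt :: "var multiset \<Rightarrow> nat" where
  "wt \<mu> = (\<Sum>v\<in>#\<mu>. case v of PV l \<Rightarrow> l | _ \<Rightarrow> 0)"

lemma Eu_mon: "Eu (mon \<mu>) = Const (real (wt \<mu>)) * mon \<mu>"
proof (induction \<mu>)
  case (add v \<mu>)
  have "eg v = Const (real (case v of PV l \<Rightarrow> l | _ \<Rightarrow> 0)) * Var v" by (cases v) (simp_all add: eg_def)
  moreover have "real (wt (add_mset v \<mu>)) = real (case v of PV l \<Rightarrow> l | _ \<Rightarrow> 0) + real (wt \<mu>)"
    by (simp add: wt_def del: of_nat_sum_mset)
  moreover have "Eu (mon (add_mset v \<mu>)) = eg v * mon \<mu> + Var v * Eu (mon \<mu>)" by (rule der_mon_add_mset)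
  ultimately show ?case by (simp only: add.IH mon_add_mset[of v \<mu>] Const_add) (simp only: algebra_simps)
qed (simp add: wt_def der_0)

lemma Eu_keys:
  assumes "Eu f = Const x * f" "\<mu> \<in> kys f"
  shows "real (wt \<mu>) = x"
proof -
  have "Eu f = (\<Sum>\<nu>\<in>kys f. Const (lu f \<nu>) * (Const (real (wt \<nu>)) * mon \<nu>))"
    unfolding islin_expand[OF islin_der, of _ f] Eu_mon ..
  then have "lu (Eu f) \<mu> = (\<Sum>\<nu>\<in>kys f. lu f \<nu> * (real (wt \<nu>) * lu (mon \<nu>) \<mu>))"
    by (simp add: lookup_sum lookup_Const_mult)
  also have "\<dots> = (\<Sum>\<nu>\<in>kys f. if \<nu> = \<mu> then lu f \<mu> * real (wt \<mu>) else 0)"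
    by (intro sum.cong refl) (auto simp: lookup_mon)
  finally show ?thesis using assms by (simp add: lookup_Const_mult in_keys_iff)
qed

lemma Eu_negative: "Eu f = Const x * f \<Longrightarrow> x < 0 \<Longrightarrow> f = 0"
  using Eu_keys[of f x] by (metis all_not_in_conv keys_eq_empty not_less of_nat_0_le_iff)

lemma Jv_vanish:
  assumes "Eu f = Const x * f" "x < real k" shows "Jv k f = 0"
proof (rule Eu_negative)
  show "Eu (Jv k f) = Const (x - real k) * Jv k f"
    by (simp add: Eu_Jv assms(1) der_Const_mult Const_diff left_diff_distrib)
qed (use assms in simp)

lemma PV_bound:
  assumes "Eu f = Const (real n) * f" "\<mu> \<in> kys f" "PV l \<in># \<mu>"
  shows "l \<le> n"
proof -
  have "wt \<mu> = n" using Eu_keys[OF assms(1,2)] by simp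
  moreover obtain \<mu>' where "\<mu> = add_mset (PV l) \<mu>'" using assms(3) by (auto dest: multi_member_split)
  ultimately show ?thesis by (simp add: wt_def)
qed

lemma der_expand_PV:
  assumes f: "Eu f = Const (real n) * f" and g: "\<And>v. (\<forall>l. v \<noteq> PV l) \<Longrightarrow> g v = 0" "g (PV 0) = 0" and "n \<le> m"
  shows "der g f = (\<Sum>l=1..m. g (PV l) * pdiff (PV l) f)"
proof -
  have "der g f = (\<Sum>v\<in>PV ` {1..m}. g v * pdiff v f)"
  proof (rule der_expand)
    fix \<mu> assume \<mu>: "\<mu> \<in> kys f"
    show "\<forall>v\<in>#\<mu>. v \<in> PV ` {1..m} \<or> g v = 0"
    proof
      fix v assume v: "v \<in># \<mu>"
      show "v \<in> PV ` {1..m} \<or> g v = 0"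
      proof (cases "\<exists>l. v = PV l")
        case True
        then obtain l where l: "v = PV l" by blast
        then show ?thesis using PV_bound[OF f \<mu>, of l] v g(2) \<open>n \<le> m\<close> by (cases "l = 0") auto
      qed (use g(1) in blast)
    qed
  qed simp
  also have "\<dots> = (\<Sum>l=1..m. g (PV l) * pdiff (PV l) f)"
    by (subst sum.reindex) (auto simp: inj_on_def)
  finally show ?thesis .
qed

lemma Eu_expand:
  assumes "Eu f = Const (real n) * f" "n \<le> m"
  shows "(\<Sum>l=1..m. Var (PV l) * Jv l f) = Const (a * real n) * f"
proof -
  have "(\<Sum>l=1..m. Var (PV l) * Jv l f) = Const a * Eu f"
    unfolding der_expand_PV[OF assms(1), of eg m, OF _ _ assms(2)] sum_distrib_left
    by (subst der_expand_PV[OF assms(1), of eg m]) (auto simp: assms(2) eg_def Jv_pdiff Const_mult sum_distrib_left mult_ac split: var.splits intro!: sum.cong)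
  then show ?thesis by (simp add: assms(1) Const_mult mult.assoc)
qed

lemma Sv_expand:
  assumes "Eu f = Const (real n) * f" "n \<le> m"
  shows "Sv j f = (\<Sum>k=1..m. Var (PV k) * Jv (j + k) f)"
proof -
  have "Sv j f = (\<Sum>l=1..j + m. sg j (PV l) * pdiff (PV l) f)"
    using assms by (intro der_expand_PV) (auto simp: sg_def split: var.splits)
  also have "\<dots> = (\<Sum>l=j + 1..j + m. sg j (PV l) * pdiff (PV l) f)"
    by (rule sum.mono_neutral_right) (auto simp: sg_def)
  also have "\<dots> = (\<Sum>k=1..m. Var (PV k) * Jv (j + k) f)"
    by (rule sum.reindex_bij_witness[of _ "\<lambda>k. j + k" "\<lambda>l. l - j"]) (auto simp: sg_def Jv_pdiff mult_ac)
  finally show ?thesis .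
qed

text \<open>
  The constraint for \<open>J\<^sub>i\<close> at the next order follows from the cut-and-join equation: the Virasoro
  relations turn \<open>J\<^sub>i A\<^sub>j Zs\<^sub>n\<close> into \<open>J\<^sub>j A\<^sub>i Zs\<^sub>n\<close>, and \<open>\<Sum> p\<^sub>j J\<^sub>j\<close> counts degrees.
\<close>

lemma constraints:
  assumes deg: "\<And>n. Eu (Zs n) = Const (real n) * Zs n"
    and cut_join: "\<And>n. Const (a * real (Suc n)) * Zs (Suc n) = (\<Sum>j=1..Suc n. Var (PV j) * Av (j - 1) (Zs n))"
  shows "i \<ge> 1 \<Longrightarrow> Jv i (Zs n) = (case n of 0 \<Rightarrow> 0 | Suc m \<Rightarrow> Av (i - 1) (Zs m))"
proof (induction n arbitrary: i)
  case 0
  then show ?case using Jv_vanish[OF deg[of 0], of i] by simp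
next
  case (Suc n)
  \<comment> \<open>The term of order n - 1. Its value 0 for n = 0 is consistent, since every J_j
    annihilates the term of order 0.\<close>
  define Y where "Y = (case n of 0 \<Rightarrow> 0 | Suc m \<Rightarrow> Zs m)"
  have IH: "Jv j (Zs n) = Av (j - 1) Y" if "j \<ge> 1" for j
    using Suc.IH[OF that] by (auto simp: Y_def islin_0[OF islin_Av] split: nat.splits)
  let ?i = "i - 1"
  have i: "i = Suc ?i" using Suc.prems by simp
  have swap: "Jv i (Av j (Zs n)) = Jv (Suc j) (Av ?i (Zs n))" for j
  proof -
    have "Jv i (Av j (Zs n)) = Av j (Av ?i Y) + Const (a * real i) * Av (j + ?i) Y"
      using IH[of i] IH[of "j + i"] Suc.prems by (simp add: Jv_Av)
    also have "Av j (Av ?i Y) = Av ?i (Av j Y) + Const (a * (real j - real ?i)) * Av (j + ?i) Y"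
      using Av_commutator[of j ?i Y] by (simp only: diff_eq_eq add.commute)
    also have "Av ?i (Av j Y) + Const (a * (real j - real ?i)) * Av (j + ?i) Y + Const (a * real i) * Av (j + ?i) Y
        = Av ?i (Av j Y) + Const (a * (real j - real ?i) + a * real i) * Av (j + ?i) Y"
      by (simp only: Const_add distrib_right add.assoc)
    also have "a * (real j - real ?i) + a * real i = a * real (Suc j)"
      using Suc.prems by (simp add: of_nat_diff algebra_simps)
    also have "Av ?i (Av j Y) + Const (a * real (Suc j)) * Av (j + ?i) Y = Jv (Suc j) (Av ?i (Zs n))"
      using IH[of "Suc j"] IH[of "?i + Suc j"] by (simp add: Jv_Av add.commute[of j])
    finally show ?thesis .
  qed
  have "Const (a * real (Suc n)) * Jv i (Zs (Suc n)) = Jv i (Const (a * real (Suc n)) * Zs (Suc n))"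
    by (simp add: der_Const_mult)
  also have "\<dots> = (\<Sum>j=1..Suc n. (if j = i then Const (a * real i) * Av ?i (Zs n) else 0) + Var (PV j) * Jv j (Av ?i (Zs n)))"
    unfolding cut_join der_sum
    by (intro sum.cong refl) (auto simp: der_mult swap jg_def)
  also have "\<dots> = (if i \<le> Suc n then Const (a * real i) * Av ?i (Zs n) else 0) + (\<Sum>j=1..Suc n. Var (PV j) * Jv j (Av ?i (Zs n)))"
    using Suc.prems by (simp add: sum.distrib del: sum.cl_ivl_Suc)
  \<comment> \<open>The contribution a i of the product rule and the degree n - (i - 1) of the
    argument add up to a (n + 1). For i > n + 1 that degree is negative and both sides
    vanish.\<close>
  also have "\<dots> = Const (a * real (Suc n)) * Av ?i (Zs n)"
  proof (cases "i \<le> Suc n")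
    case True
    then have le: "?i \<le> n" by simp
    have "Eu (Av ?i (Zs n)) = Const (real (n - ?i)) * Av ?i (Zs n)"
      using Eu_Av[OF deg[of n], of ?i] by (simp only: of_nat_diff[OF le])
    from Eu_expand[OF this, of "Suc n"] have "(\<Sum>j=1..Suc n. Var (PV j) * Jv j (Av ?i (Zs n))) = Const (a * real (n - ?i)) * Av ?i (Zs n)"
      by simp
    moreover have "a * real i + a * real (n - ?i) = a * real (Suc n)"
      using True Suc.prems by (simp add: of_nat_diff algebra_simps)
    ultimately show ?thesis using True by (simp del: sum.cl_ivl_Suc flip: distrib_right Const_add)
  next
    case False
    have "Av ?i (Zs n) = 0"
      using Eu_negative[OF Eu_Av[OF deg[of n], of ?i]] False by simp
    then show ?thesis by (simp add: der_0)
  qed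
  finally have "Const (1 / (a * real (Suc n))) * (Const (a * real (Suc n)) * Jv i (Zs (Suc n))) =
     Const (1 / (a * real (Suc n))) * (Const (a * real (Suc n)) * Av ?i (Zs n))" by simp
  then have "Jv i (Zs (Suc n)) = Av ?i (Zs n)"
    using a_pos by (simp only: mult.assoc[symmetric] Const_mult[symmetric]) simp
  then show ?case by simp
qed

section \<open>The generating series\<close>

abbreviation iota :: "nat mpol \<Rightarrow> var mpol" where "iota \<equiv> subst (\<lambda>i. Var (PV i))"

lemma Jv_iota: "Jv k (iota f) = iota (Jm k f)"
proof -
  have "pdiff (PV k) (iota f) = iota (pdiff k f)"
  proof (rule derivation_ext[of "\<lambda>f. pdiff (PV k) (iota f)"])
    show "pdiff (PV k) (iota 1) = iota (pdiff k 1)" by (simp add: pdiff_eq_der subst_0)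
    fix v f assume "pdiff (PV k) (iota f) = iota (pdiff k f)"
    then show "pdiff (PV k) (iota (Var v * f)) = iota (pdiff k (Var v * f))"
      by (simp add: subst_mult pdiff_mult pdiff_Var subst_add subst_0)
  qed (intro islin_rules)+
  then show ?thesis by (simp add: Jv_pdiff Jm_def subst_Const_mult)
qed

lemma Tv_iota: "Tv n (iota f) = iota (Tm n f)"
  by (simp add: Tv_def Tm_def Jv_iota subst_sum)

lemma Eu_iota: "kys f \<subseteq> partitions n \<Longrightarrow> Eu (iota f) = Const (real n) * iota f"
proof (rule islin_ext_on[of "\<lambda>f. Eu (iota f)"])
  fix \<mu> assume "kys f \<subseteq> partitions n" "\<mu> \<in> kys f"
  then have n: "sum_mset \<mu> = n" by (auto simp: partitions_iff)
  have "iota (mon \<mu>) = mon (image_mset PV \<mu>)" by (induction \<mu>) (simp_all add: mon_add_mset subst_mult)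
  moreover have "wt (image_mset PV \<mu>) = sum_mset \<mu>" by (induction \<mu>) (simp_all add: wt_def)
  ultimately show "Eu (iota (mon \<mu>)) = Const (real n) * iota (mon \<mu>)" by (simp add: Eu_mon n)
qed (intro islin_rules)+

text \<open>In Stanley's normalisation the q-factor specialises to 1, the norm is nsq / tcoef^2, and
  the p-factor carries 1 / tcoef; together they leave tcoef / nsq in front of
  \<open>P \<kappa>\<close>.\<close>

definition weight :: "nat multiset \<Rightarrow> var mpol" where
  "weight \<kappa> = Const (tcoef \<kappa> / nsq \<kappa>) * (content_prod (Var (UV 1)) \<kappa> * content_prod (Var (UV 2)) \<kappa>)"

definition Zs :: "nat \<Rightarrow> var mpol" where
  "Zs n = (\<Sum>\<kappa>\<in>partitions n. weight \<kappa> * iota (P \<kappa>))"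

lemma pfree_weight: "pfree (weight \<kappa>)"
  unfolding weight_def content_prod_def by (intro pfree_mult pfree_prod_mset pfree_add pfree_Const pfree_UV)

lemma Zs_degree: "Eu (Zs n) = Const (real n) * Zs n"
  unfolding Zs_def der_sum sum_distrib_left
proof (intro sum.cong refl)
  fix \<kappa> assume "\<kappa> \<in> partitions n"
  then have "kys (P \<kappa>) \<subseteq> partitions n" using keys_P[of \<kappa>] by (simp add: partitions_iff)
  then show "Eu (weight \<kappa> * iota (P \<kappa>)) = Const (real n) * (weight \<kappa> * iota (P \<kappa>))"
    by (simp add: Eu_pfree pfree_weight Eu_iota mult.left_commute)
qed

text \<open>The constraint operators weighted by p_j recombine into the operators with known matrix
  elements, with coefficients 1, e_1 and e_2.\<close>

lemma Av_iota:
  assumes f: "kys f \<subseteq> partitions n"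
  shows "(\<Sum>j=1..Suc n. Var (PV j) * Av (j - 1) (iota f)) = iota (F 2 f + Var 1 * H 1 f) + s1 * iota (F 1 f) + s2 * iota (F 0 f)"
proof -
  have Sv: "Sv j (iota f) = iota (\<Sum>k=1..n. Var k * Jm (j + k) f)" for j
    unfolding Sv_expand[OF Eu_iota[OF f] order_refl] by (simp add: subst_sum subst_mult Jv_iota)
  have "(\<Sum>j=1..Suc n. Var (PV j) * Av (j - 1) (iota f)) = (\<Sum>j=1..Suc n.
      iota (Var j * (Tm (j - 1) f + (\<Sum>k=1..n. Var k * Jm (j - 1 + k) f) + Const ((a - 1) * real (j - 1)) * Jm (j - 1) f))
      + s1 * iota (Var j * Jm (j - 1) f) + (if j = 1 then s2 * iota (Var 1 * f) else 0))"
    unfolding Av_def Vc_def Tv_iota Sv Jv_iota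
    by (intro sum.cong refl) (auto simp: subst_mult subst_add algebra_simps)
  also have "\<dots> = iota (F 2 f + Var 1 * H 1 f) + s1 * iota (F 1 f) + s2 * iota (Var 1 * f)"
    unfolding F_2_expand[OF f] F_1_expand'[OF f] subst_sum sum.distrib sum_distrib_left by simp
  finally show ?thesis by (simp add: F_0 symfuns_homogeneous[OF f])
qed

lemma Av_pfree: "pfree u \<Longrightarrow> Av n (u * f) = u * Av n f"
  by (simp add: Av_def Tv_pfree Sv_pfree Jv_pfree distrib_left mult.left_commute)

text \<open>Acting on \<open>P \<rho>\<close>, the operator multiplies each Pieri coefficient by
  (u_1 + c)(u_2 + c) with c = step. These are the factors by which the two content products grow, so
  the coefficient of \<open>P \<kappa>\<close> no longer sees \<open>\<rho>\<close> except through
  the sum evaluated by \<open>tcoef_rec\<close>.\<close>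

lemma cut_join: "Const (a * real (Suc n)) * Zs (Suc n) = (\<Sum>j=1..Suc n. Var (PV j) * Av (j - 1) (Zs n))"
proof -
  let ?U1 = "Var (UV 1) :: var mpol" and ?U2 = "Var (UV 2) :: var mpol"
  define C where "C \<rho> \<kappa> = Const (psi \<rho> \<kappa> * tcoef \<rho> / (nsq \<rho> * nsq \<kappa>)) * (content_prod ?U1 \<kappa> * content_prod ?U2 \<kappa>) * iota (P \<kappa>)" for \<rho> \<kappa>
  have C: "weight \<rho> * (Const (psi \<rho> \<kappa> / nsq \<kappa>) * ((?U1 + Const (step \<rho> \<kappa>)) * (?U2 + Const (step \<rho> \<kappa>))) * iota (P \<kappa>)) = C \<rho> \<kappa>"
    if "\<rho> \<in> partitions n" "\<kappa> \<in> partitions (Suc n)" for \<rho> \<kappa>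
  proof (cases "psi \<rho> \<kappa> = 0")
    case False
    have \<rho>: "0 \<notin># \<rho>" and \<kappa>: "0 \<notin># \<kappa>" using that by (auto simp: partitions_iff)
    have eq: "Const (psi \<rho> \<kappa> * tcoef \<rho> / (nsq \<rho> * nsq \<kappa>)) = Const (tcoef \<rho> / nsq \<rho>) * Const (psi \<rho> \<kappa> / nsq \<kappa>)"
      by (simp flip: Const_mult)
    show ?thesis
      unfolding C_def eq weight_def content_prod_pieri[OF \<rho> \<kappa> False, of ?U1] content_prod_pieri[OF \<rho> \<kappa> False, of ?U2] by (simp only: mult_ac)
  qed (simp add: C_def)
  have "(\<Sum>j=1..Suc n. Var (PV j) * Av (j - 1) (Zs n)) =
      (\<Sum>\<rho>\<in>partitions n. weight \<rho> * (\<Sum>j=1..Suc n. Var (PV j) * Av (j - 1) (iota (P \<rho>))))"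
    unfolding Zs_def islin_sum[OF islin_Av] Av_pfree[OF pfree_weight] sum_distrib_left
    by (subst sum.swap) (simp only: mult.left_commute)
  also have "\<dots> = (\<Sum>\<rho>\<in>partitions n. \<Sum>\<kappa>\<in>partitions (Suc n). C \<rho> \<kappa>)"
  proof (intro sum.cong refl)
    fix \<rho> assume \<rho>: "\<rho> \<in> partitions n"
    then have k: "kys (P \<rho>) \<subseteq> partitions n" using keys_P[of \<rho>] by (simp add: partitions_iff)
    have "(\<Sum>j=1..Suc n. Var (PV j) * Av (j - 1) (iota (P \<rho>))) =
       (\<Sum>\<kappa>\<in>partitions (Suc n). Const (psi \<rho> \<kappa> / nsq \<kappa>) * ((?U1 + Const (step \<rho> \<kappa>)) * (?U2 + Const (step \<rho> \<kappa>))) * iota (P \<kappa>))"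
      unfolding Av_iota[OF k] P_raise[OF \<rho>] subst_sum subst_Const_mult sum_distrib_left sum.distrib[symmetric]
    proof (intro sum.cong refl)
      fix \<kappa>
      have 1: "Const (step \<rho> \<kappa> * psi \<rho> \<kappa> / nsq \<kappa>) = Const (step \<rho> \<kappa>) * Const (psi \<rho> \<kappa> / nsq \<kappa>)"
        "Const (step \<rho> \<kappa> * step \<rho> \<kappa> * psi \<rho> \<kappa> / nsq \<kappa>) = Const (step \<rho> \<kappa>) * (Const (step \<rho> \<kappa>) * Const (psi \<rho> \<kappa> / nsq \<kappa>))"
        by (simp_all flip: Const_mult)
      show "Const (step \<rho> \<kappa> * step \<rho> \<kappa> * psi \<rho> \<kappa> / nsq \<kappa>) * iota (P \<kappa>) + s1 * (Const (step \<rho> \<kappa> * psi \<rho> \<kappa> / nsq \<kappa>) * iota (P \<kappa>))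
          + s2 * (Const (psi \<rho> \<kappa> / nsq \<kappa>) * iota (P \<kappa>)) =
          Const (psi \<rho> \<kappa> / nsq \<kappa>) * ((?U1 + Const (step \<rho> \<kappa>)) * (?U2 + Const (step \<rho> \<kappa>))) * iota (P \<kappa>)"
        unfolding 1 s1_def s2_def by (simp only: algebra_simps)
    qed
    then show "weight \<rho> * (\<Sum>j=1..Suc n. Var (PV j) * Av (j - 1) (iota (P \<rho>))) = (\<Sum>\<kappa>\<in>partitions (Suc n). C \<rho> \<kappa>)"
      by (simp only: sum_distrib_left C[OF \<rho>] cong: sum.cong)
  qed
  also have "\<dots> = (\<Sum>\<kappa>\<in>partitions (Suc n). \<Sum>\<rho>\<in>partitions n. C \<rho> \<kappa>)" by (rule sum.swap)
  also have "\<dots> = Const (a * real (Suc n)) * Zs (Suc n)"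
    unfolding Zs_def sum_distrib_left
  proof (intro sum.cong refl)
    fix \<kappa> assume \<kappa>: "\<kappa> \<in> partitions (Suc n)"
    have "(\<Sum>\<rho>\<in>partitions n. psi \<rho> \<kappa> * tcoef \<rho> / (nsq \<rho> * nsq \<kappa>)) = a * real (Suc n) * tcoef \<kappa> / nsq \<kappa>"
      unfolding tcoef_rec[OF \<kappa>] sum_divide_distrib by simp
    then have "(\<Sum>\<rho>\<in>partitions n. C \<rho> \<kappa>) = Const (a * real (Suc n) * (tcoef \<kappa> / nsq \<kappa>)) * (content_prod ?U1 \<kappa> * content_prod ?U2 \<kappa>) * iota (P \<kappa>)"
      unfolding C_def sum_distrib_right[symmetric] Const_sum[symmetric] by simp
    then show "(\<Sum>\<rho>\<in>partitions n. C \<rho> \<kappa>) = Const (a * real (Suc n)) * (weight \<kappa> * iota (P \<kappa>))"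
      unfolding weight_def Const_mult[of "a * real (Suc n)"] by (simp only: mult.assoc)
  qed
  finally show ?thesis by simp
qed

lemma jack_eq: "0 \<notin># \<kappa> \<Longrightarrow> jack (a - 1) \<kappa> = Const (1 / tcoef \<kappa>) * P \<kappa>"
  by (simp add: jack_def jack_P_eq tcoef_def)

lemma jack_norm_eq: "0 \<notin># \<kappa> \<Longrightarrow> jack_norm (a - 1) \<kappa> = nsq \<kappa> / (tcoef \<kappa> * tcoef \<kappa>)"
  unfolding jack_norm_def jack_eq
  by (subst scalar_prod_eq_ip) (auto simp: ip_Const_left ip_Const_right nsq_def)

lemma jack_UV: "0 \<notin># \<kappa> \<Longrightarrow> subst (\<lambda>i. Var (UV j)) (jack (a - 1) \<kappa>) = content_prod (Var (UV j)) \<kappa>"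
  using tcoef_nonzero[of \<kappa>]
  by (simp add: jack_eq subst_Const_mult constant_subst_P mult.assoc[symmetric] Const_mult[symmetric])

text \<open>Only p_1^n survives the specialisation, and its coefficient in \<open>jack\<close> is
  1.\<close>

lemma jack_q_special:
  assumes \<kappa>: "0 \<notin># \<kappa>"
  shows "subst q_special (subst (\<lambda>i. Var (QV i)) (jack (a - 1) \<kappa>)) = 1"
proof -
  let ?S = "\<lambda>f :: nat mpol. subst q_special (subst (\<lambda>i. Var (QV i)) f)"
  define n where "n = sum_mset \<kappa>"
  have mon: "?S (mon \<nu>) = (if \<nu> = replicate_mset n 1 then 1 else 0)" if "\<nu> \<in> partitions n" for \<nu>
  proof -
    have "?S (mon \<nu>) = (\<Prod>i\<in>#\<nu>. if i = 1 then 1 else 0)"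
      by (simp add: subst_mon subst_prod_mset)
    also have "\<dots> = (if \<forall>i\<in>#\<nu>. i = 1 then 1 else 0)" by (induction \<nu>) auto
    also have "(\<forall>i\<in>#\<nu>. i = 1) \<longleftrightarrow> \<nu> = replicate_mset n 1"
    proof
      assume *: "\<forall>i\<in>#\<nu>. i = 1"
      then have "set_mset \<nu> \<subseteq> {1}" by auto
      then obtain k where k: "\<nu> = replicate_mset k 1" by (blast dest: set_mset_subset_singletonD)
      then have "k = n" using that by (simp add: partitions_iff)
      with k show "\<nu> = replicate_mset n 1" by simp
    qed (auto split: if_splits)
    finally show ?thesis .
  qed
  have l: "islin ?S" by (intro islin_rules)
  have "?S (P \<kappa>) = (\<Sum>\<nu>\<in>partitions n. Const (lu (P \<kappa>) \<nu>) * ?S (mon \<nu>))"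
    using keys_P[of \<kappa>] by (subst mpol_expand[of "partitions n" "P \<kappa>"]) (simp_all add: islin_sum[OF l] islin_Const[OF l] n_def del: mult_cancel_left)
  also have "\<dots> = (\<Sum>\<nu>\<in>partitions n. if \<nu> = replicate_mset n 1 then Const (tcoef \<kappa>) else 0)"
    by (intro sum.cong refl) (auto simp: mon tcoef_def n_def)
  also have "\<dots> = Const (tcoef \<kappa>)"
    by (auto simp: partitions_iff split: if_splits)
  finally have "?S (P \<kappa>) = Const (tcoef \<kappa>)" .
  then show ?thesis
    using tcoef_nonzero[OF \<kappa>] by (simp add: jack_eq[OF \<kappa>] subst_Const_mult Const_mult[symmetric])
qed

lemma specialise_q_Z: "fps_nth (specialise_q (Z_series (a - 1) 2)) n = Zs n"
  unfolding specialise_q_def fps_coeffwise_def Z_series_def Zs_def fps_nth_Abs_fps subst_sum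
proof (intro sum.cong refl)
  fix \<mu> assume "\<mu> \<in> partitions n"
  then have \<mu>: "0 \<notin># \<mu>" by (simp add: partitions_iff)
  have UV: "subst q_special (subst (\<lambda>i. Var (UV j)) f) = subst (\<lambda>i. Var (UV j)) f" for j f
    by (simp add: subst_subst)
  have content_prod: "subst q_special (content_prod (Var (UV j)) \<mu>) = content_prod (Var (UV j)) \<mu>" for j
    unfolding jack_UV[OF \<mu>, symmetric] UV ..
  have PV: "subst q_special (iota f) = iota f" for f by (simp add: subst_subst)
  have "{1..2::nat} = {1, 2}" by auto
  then have "subst q_special (Const (1 / jack_norm (a - 1) \<mu>) * subst (\<lambda>i. Var (QV i)) (jack (a - 1) \<mu>) *
      (\<Prod>j = 1..2. subst (\<lambda>i. Var (UV j)) (jack (a - 1) \<mu>)) * iota (jack (a - 1) \<mu>)) =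
      Const (1 / jack_norm (a - 1) \<mu>) * (content_prod (Var (UV 1)) \<mu> * content_prod (Var (UV 2)) \<mu>) * (Const (1 / tcoef \<mu>) * iota (P \<mu>))"
    by (simp add: subst_mult content_prod PV jack_q_special \<mu> jack_UV) (simp add: jack_eq \<mu> subst_mult)
  also have "\<dots> = Const (1 / jack_norm (a - 1) \<mu>) * Const (1 / tcoef \<mu>) * (content_prod (Var (UV 1)) \<mu> * content_prod (Var (UV 2)) \<mu>) * iota (P \<mu>)"
    by (simp only: mult_ac)
  also have "Const (1 / jack_norm (a - 1) \<mu>) * Const (1 / tcoef \<mu>) = Const (tcoef \<mu> / nsq \<mu>)"
    using tcoef_nonzero[OF \<mu>] by (simp add: jack_norm_eq \<mu> flip: Const_mult)
  finally show "subst q_special (Const (1 / jack_norm (a - 1) \<mu>) * subst (\<lambda>i. Var (QV i)) (jack (a - 1) \<mu>) *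
      (\<Prod>j = 1..2. subst (\<lambda>i. Var (UV j)) (jack (a - 1) \<mu>)) * iota (jack (a - 1) \<mu>)) = weight \<mu> * iota (P \<mu>)"
    by (simp only: weight_def)
qed

section \<open>The constraint operators\<close>

lemma J_op_pos: "J_op (a - 1) (int k) f = Jv k f"
  by (cases "k = 0") (simp_all add: J_op_def Jv_pdiff)

lemma J_op_neg: "k > 0 \<Longrightarrow> J_op (a - 1) (- int k) f = Var (PV k) * f"
  by (simp add: J_op_def)

lemma J_op_0 [simp]: "J_op (a - 1) i 0 = 0"
  by (simp add: J_op_def islin_0[OF islin_pdiff])

lemma A_op_0: "i \<ge> 1 \<Longrightarrow> A_op (a - 1) i 0 f = Const (1 / a) * (if i = 1 then f else 0)"
  by simp

lemma A_op_1:
  assumes "i \<ge> 1"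
  shows "A_op (a - 1) i (Suc 0) f = Const (1 / a) * Jv (i - 1) f"
proof -
  have "Sum_any (\<lambda>n. if n \<ge> 1 then J_op (a - 1) (int i - int n) (A_op (a - 1) n 0 f) else 0) =
     (\<Sum>n\<in>{1}. if n \<ge> 1 then J_op (a - 1) (int i - int n) (A_op (a - 1) n 0 f) else 0)"
    by (rule Sum_any.expand_superset) (auto split: if_splits)
  also have "\<dots> = J_op (a - 1) (int (i - 1)) (Const (1 / a) * f)"
    using assms by (simp add: of_nat_diff)
  finally show ?thesis
    unfolding A_op.simps(2) J_op_pos by (auto simp: der_Const_mult)
qed

text \<open>Indices n < i give the second-order part, n > i the first-order part with k = n - i. The
  index n = i drops out because J_0 = 0, as does n = 1 among the former. The degree N bounds the
  sum, J_(n-1) annihilating f for n - 1 > N.\<close>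

lemma A_op_2:
  assumes "i \<ge> 1" and f: "Eu f = Const (real N) * f"
  shows "A_op (a - 1) i (Suc (Suc 0)) f =
    Const (1 / a) * (Tv (i - 1) f + Sv (i - 1) f + Const ((a - 1) * real (i - 1)) * Jv (i - 1) f)"
proof -
  let ?g = "\<lambda>n. if n \<ge> 1 then J_op (a - 1) (int i - int n) (A_op (a - 1) n (Suc 0) f) else 0"
  have g: "?g n = Const (1 / a) * (if n < i then Jv (i - n) (Jv (n - 1) f) else if n = i then 0 else Var (PV (n - i)) * Jv (n - 1) f)"
    if "n \<ge> 1" for n
  proof -
    have A: "A_op (a - 1) n (Suc 0) f = Const (1 / a) * Jv (n - 1) f" using that by (rule A_op_1)
    consider "n < i" | "n = i" | "n > i" by linarith
    then show ?thesis
    proof cases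
      case 1
      then have "int i - int n = int (i - n)" by simp
      then show ?thesis unfolding A using that 1 by (simp only: J_op_pos) (simp add: der_Const_mult)
    next
      case 2
      then show ?thesis by (simp add: J_op_def)
    next
      case 3
      then have "int i - int n = - int (n - i)" by simp
      then show ?thesis unfolding A using that 3 by (simp only: J_op_neg) (simp add: J_op_neg mult.left_commute)
    qed
  qed
  have "Sum_any ?g = (\<Sum>n\<in>{1..i + N}. ?g n)"
  proof (rule Sum_any.expand_superset)
    show "{n. ?g n \<noteq> 0} \<subseteq> {1..i + N}"
    proof
      fix n assume n: "n \<in> {n. ?g n \<noteq> 0}"
      then have n1: "n \<ge> 1" by (auto split: if_splits)
      have "Jv (n - 1) f \<noteq> 0" using n g[OF n1] by (auto simp: der_0 split: if_splits)
      then have "\<not> real N < real (n - 1)" using Jv_vanish[OF f, of "n - 1"] by blast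
      then show "n \<in> {1..i + N}" using n1 assms(1) by auto
    qed
  qed simp
  also have "\<dots> = Const (1 / a) * (\<Sum>n\<in>{1..i + N}. if n < i then Jv (i - n) (Jv (n - 1) f) else if n = i then 0 else Var (PV (n - i)) * Jv (n - 1) f)"
    unfolding sum_distrib_left by (intro sum.cong refl g) simp
  also have "{1..i + N} = {1..<i} \<union> {i..i + N}" using assms(1) by auto
  also have "(\<Sum>n\<in>{1..<i} \<union> {i..i + N}. if n < i then Jv (i - n) (Jv (n - 1) f) else if n = i then 0 else Var (PV (n - i)) * Jv (n - 1) f) =
      (\<Sum>n\<in>{1..<i}. Jv (i - n) (Jv (n - 1) f)) + (\<Sum>n\<in>{i..i + N}. if n = i then 0 else Var (PV (n - i)) * Jv (n - 1) f)"
    by (subst sum.union_disjoint) auto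
  also have "(\<Sum>n\<in>{1..<i}. Jv (i - n) (Jv (n - 1) f)) = Tv (i - 1) f"
  proof -
    have "(\<Sum>n\<in>{1..<i}. Jv (i - n) (Jv (n - 1) f)) = (\<Sum>n\<in>{2..<i}. Jv (i - n) (Jv (n - 1) f))"
    proof (rule sum.mono_neutral_right)
      show "\<forall>n\<in>{1..<i} - {2..<i}. Jv (i - n) (Jv (n - 1) f) = 0"
      proof
        fix n assume "n \<in> {1..<i} - {2..<i}"
        then have "n = 1" by auto
        then show "Jv (i - n) (Jv (n - 1) f) = 0" by (simp add: der_0)
      qed
    qed auto
    also have "\<dots> = Tv (i - 1) f" unfolding Tv_def
      by (rule sum.reindex_bij_witness[of _ Suc "\<lambda>n. n - 1"]) auto
    finally show ?thesis .
  qed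
  also have "(\<Sum>n\<in>{i..i + N}. if n = i then 0 else Var (PV (n - i)) * Jv (n - 1) f) = Sv (i - 1) f"
  proof -
    have "(\<Sum>n\<in>{i..i + N}. if n = i then 0 else Var (PV (n - i)) * Jv (n - 1) f) = (\<Sum>n\<in>{i + 1..i + N}. Var (PV (n - i)) * Jv (n - 1) f)"
      by (rule sum.mono_neutral_cong_right) auto
    also have "\<dots> = (\<Sum>k=1..N. Var (PV k) * Jv (i - 1 + k) f)"
      using assms(1) by (intro sum.reindex_bij_witness[of _ "\<lambda>k. i + k" "\<lambda>n. n - i"]) auto
    finally show ?thesis using Sv_expand[OF f order_refl] by simp
  qed
  finally have S: "Sum_any ?g = Const (1 / a) * (Tv (i - 1) f + Sv (i - 1) f)" .
  show ?thesis
    unfolding A_op.simps(2)[of _ _ "Suc 0"] S A_op_1[OF assms(1)]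
    using assms(1) by (simp add: of_nat_diff distrib_left mult.left_commute)
qed

lemma elem_sym_1: "elem_sym 2 1 = s1"
proof -
  have "{S. S \<subseteq> {1..2::nat} \<and> card S = 1} = {{1}, {2}}"
    by (auto simp: card_1_singleton_iff)
  then show ?thesis by (simp add: elem_sym_def s1_def)
qed

lemma elem_sym_2: "elem_sym 2 2 = s2"
proof -
  have "S = {1..2}" if "S \<subseteq> {1..2::nat}" "card S = 2" for S
    using that by (intro card_subset_eq) auto
  then have "{S. S \<subseteq> {1..2::nat} \<and> card S = 2} = {{1..2}}" by auto
  moreover have "{1..2::nat} = {1, 2}" by auto
  ultimately show ?thesis by (simp add: elem_sym_def s2_def)
qed

text \<open>The derivative p_i^* equals J_i / a, and the bracket inherits the same factor 1 / a from
  A_1(0); what remains in order n is \<open>constraints\<close>.\<close>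

lemma L_bip_zero:
  assumes i: "i \<ge> 1"
  shows "L_bip (a - 1) i (specialise_q (Z_series (a - 1) 2)) = 0"
proof (rule fps_ext)
  fix n
  let ?T = "\<lambda>f. A_op (a - 1) i 2 f + elem_sym 2 1 * A_op (a - 1) i 1 f + elem_sym 2 2 * A_op (a - 1) i 0 f"
  have T: "?T (Zs m) = Const (1 / a) * Av (i - 1) (Zs m)" for m
  proof -
    have "A_op (a - 1) i 2 (Zs m) = Const (1 / a) *
        (Tv (i - 1) (Zs m) + Sv (i - 1) (Zs m) + Const ((a - 1) * real (i - 1)) * Jv (i - 1) (Zs m))"
      using A_op_2[OF i Zs_degree] by (simp only: numeral_2_eq_2)
    moreover have "A_op (a - 1) i 1 (Zs m) = Const (1 / a) * Jv (i - 1) (Zs m)"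
      using A_op_1[OF i] by (simp only: One_nat_def)
    ultimately show ?thesis
      unfolding A_op_0[OF i] elem_sym_1 elem_sym_2 Av_def Vc_def
      using i by (cases "i = 1") (simp_all add: algebra_simps)
  qed
  have p: "p_star i f = Const (1 / a) * Jv i f" for f
    using a_pos by (simp add: p_star_def Jv_pdiff mult.assoc[symmetric] Const_mult[symmetric])
  have "fps_nth (L_bip (a - 1) i (specialise_q (Z_series (a - 1) 2))) n =
      - p_star i (Zs n) + (if n = 0 then 0 else ?T (Zs (n - 1)))"
    by (simp add: L_bip_def fps_coeffwise_def specialise_q_Z del: A_op.simps One_nat_def)
  also have "\<dots> = 0"
    unfolding T p constraints[OF Zs_degree cut_join i] by (cases n) auto
  finally show "fps_nth (L_bip (a - 1) i (specialise_q (Z_series (a - 1) 2))) n = fps_nth 0 n" by simp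
qed

end

theorem theorem2p3:
  fixes b :: real and i :: nat
  assumes "b > -1" and "i \<ge> 1"
  shows "L_bip b i (specialise_q (Z_series b 2)) = 0"
proof -
  interpret jack_parameter "1 + b" by standard (use assms in simp)
  show ?thesis using L_bip_zero[OF assms(2)] by simp
qed

end
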